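(* Let $\theta,\omega\in H^\infty$ be inner functions with $\theta(0)=0$, and suppose $U_{(\theta)1}$ has no eigenvalues. Let $g\in L^2(m)$ be such that the operator $X\in\mathcal L(\mathcal K_\theta,\mathcal K_\omega)$, $Xf=P_{\mathcal K_\omega}(gf)$, $f\in\mathcal K_\theta$, is (well defined and) bounded with $X\mathcal K_\theta$ dense in $\mathcal K_\omega$, and such that the operator $K\in\mathcal L(\mathcal K_\theta,L^2(m)\ominus\mathcal K_\omega)$, $Kf=P_{L^2(m)\ominus\mathcal K_\omega}(gf)$, $f\in\mathcal K_\theta$, is compact. Let $T\in\mathcal L(\mathcal K_\omega)$ be invertible with $XU_{(\theta)1}=TX$. Then $$\sup_{n\geq0}\|T^{-n}\|\leq\Bigl(\sup_{n\geq0}\|T^n\|\Bigr)^2 .$$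
   Context: $m$ is normalized Lebesgue measure on $\mathbb T$; $H^2$ is the Hardy space of $\mathbb D$, identified with a subspace of $L^2(m)$ via boundary values. $\chi(z)=z$, $\mathbf 1(z)=1$. For inner $\theta$, $\mathcal K_\theta=H^2\ominus\theta H^2$; $S$ is multiplication by $\chi$ on $H^2$, $S_\theta=P_{\mathcal K_\theta}S|_{\mathcal K_\theta}$. When $\theta(0)=0$, $\overline\chi\theta$ (the function $\zeta\mapsto\overline\zeta\theta(\zeta)$) lies in $\mathcal K_\theta$, and $U_{(\theta)1}=S_\theta+(\cdot,\overline\chi\theta)\mathbf 1$, i.e. $f\mapsto S_\theta f+(f,\overline\chi\theta)\mathbf 1$, a unitary operator on $\mathcal K_\theta$. *)

theory Defs
  imports "HOL-Analysis.Analysis"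
begin

text \<open>Functions on the unit circle are represented as functions complex \<Rightarrow> complex;
  only their values on the circle matter, since the measure m lives there.
  Elements of L2(m) are handled as representatives; everything below is
  insensitive to changes on m-null sets (norms, inner products, a.e. equalities).\<close>

definition m :: "complex measure" where
  "m = distr (uniform_measure lborel {0..<2*pi}) borel cis"

definition L2 :: "(complex \<Rightarrow> complex) set" where
  "L2 = {f. f \<in> borel_measurable m \<and> integrable m (\<lambda>z. (cmod (f z))\<^sup>2)}"

definition l2_inner :: "(complex \<Rightarrow> complex) \<Rightarrow> (complex \<Rightarrow> complex) \<Rightarrow> complex" where
  "l2_inner f g = (\<integral>z. f z * cnj (g z) \<partial>m)"

definition l2_norm :: "(complex \<Rightarrow> complex) \<Rightarrow> real" where
  "l2_norm f = sqrt (\<integral>z. (cmod (f z))\<^sup>2 \<partial>m)"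

definition fc :: "(complex \<Rightarrow> complex) \<Rightarrow> int \<Rightarrow> complex" where
  "fc f n = (\<integral>z. f z * (cnj z) powi n \<partial>m)"

definition H2 :: "(complex \<Rightarrow> complex) set" where
  "H2 = {f \<in> L2. \<forall>n<0. fc f n = 0}"

definition inner_fun :: "(complex \<Rightarrow> complex) \<Rightarrow> bool" where
  "inner_fun \<theta> \<longleftrightarrow> \<theta> \<in> borel_measurable m \<and> (AE z in m. cmod (\<theta> z) = 1)
      \<and> (\<forall>n<0. fc \<theta> n = 0)"

text \<open>Value at 0 of the analytic extension = 0-th Taylor/Fourier coefficient.\<close>
definition val0 :: "(complex \<Rightarrow> complex) \<Rightarrow> complex" where
  "val0 f = fc f 0"

definition Kmod :: "(complex \<Rightarrow> complex) \<Rightarrow> (complex \<Rightarrow> complex) set" where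
  "Kmod \<theta> = {f \<in> H2. \<forall>h\<in>H2. l2_inner f (\<lambda>z. \<theta> z * h z) = 0}"

definition ocomp :: "(complex \<Rightarrow> complex) set \<Rightarrow> (complex \<Rightarrow> complex) set" where
  "ocomp M = {f \<in> L2. \<forall>h\<in>M. l2_inner f h = 0}"

definition Proj :: "(complex \<Rightarrow> complex) set \<Rightarrow> (complex \<Rightarrow> complex) \<Rightarrow> (complex \<Rightarrow> complex)" where
  "Proj M f = (SOME p. p \<in> M \<and> (\<forall>h\<in>M. l2_inner (\<lambda>z. f z - p z) h = 0))"

definition U1 :: "(complex \<Rightarrow> complex) \<Rightarrow> (complex \<Rightarrow> complex) \<Rightarrow> (complex \<Rightarrow> complex)" where
  "U1 \<theta> f = (\<lambda>z. Proj (Kmod \<theta>) (\<lambda>w. w * f w) z + l2_inner f (\<lambda>w. cnj w * \<theta> w))"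

definition bounded_op ::
  "(complex \<Rightarrow> complex) set \<Rightarrow> (complex \<Rightarrow> complex) set \<Rightarrow> ((complex \<Rightarrow> complex) \<Rightarrow> (complex \<Rightarrow> complex)) \<Rightarrow> bool" where
  "bounded_op A B T \<longleftrightarrow> (\<forall>f\<in>A. T f \<in> B)
     \<and> (\<forall>f\<in>A. \<forall>g\<in>A. \<forall>c::complex.
          l2_norm (\<lambda>z. T (\<lambda>w. f w + c * g w) z - (T f z + c * T g z)) = 0)
     \<and> (\<exists>C. \<forall>f\<in>A. l2_norm (T f) \<le> C * l2_norm f)"

definition op_norm :: "(complex \<Rightarrow> complex) set \<Rightarrow> ((complex \<Rightarrow> complex) \<Rightarrow> (complex \<Rightarrow> complex)) \<Rightarrow> ennreal" where
  "op_norm A T = (SUP f\<in>{f\<in>A. l2_norm f \<le> 1}. ennreal (l2_norm (T f)))"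

definition compact_oper :: "(complex \<Rightarrow> complex) set \<Rightarrow> ((complex \<Rightarrow> complex) \<Rightarrow> (complex \<Rightarrow> complex)) \<Rightarrow> bool" where
  "compact_oper A T \<longleftrightarrow> (\<forall>s::nat \<Rightarrow> complex \<Rightarrow> complex. (\<forall>n. s n \<in> A \<and> l2_norm (s n) \<le> 1) \<longrightarrow>
     (\<exists>r y. strict_mono r \<and> y \<in> L2 \<and> (\<lambda>n. l2_norm (\<lambda>z. T (s (r n)) z - y z)) \<longlonglongrightarrow> 0))"

definition has_eigenvalue :: "(complex \<Rightarrow> complex) set \<Rightarrow> ((complex \<Rightarrow> complex) \<Rightarrow> (complex \<Rightarrow> complex)) \<Rightarrow> bool" where
  "has_eigenvalue A T \<longleftrightarrow> (\<exists>c::complex. \<exists>f\<in>A. l2_norm f \<noteq> 0 \<and> l2_norm (\<lambda>z. T f z - c * f z) = 0)"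

end

theory Submission
  imports Defs "HOL-Probability.Probability_Measure"
begin

text \<open>
  On the model space of \<open>\<theta>\<close> the Clark operator is the rank one perturbation
  \<open>U f = \<chi> f + (f, \<chi>\<^sup>-\<theta>) (1 - \<theta>)\<close> of the shift, where \<open>\<chi>\<^sup>- = cnj \<chi>\<close>; it is unitary, \<open>\<one>\<close> is a cyclic vector
  for it, and the conjugation \<open>C f = \<chi>\<^sup>- \<theta> cnj f\<close> satisfies \<open>C U = U\<^sup>-\<^sup>1 C\<close> and
  \<open>\<bar>C f\<bar> = \<bar>f\<bar>\<close> almost everywhere. Hence \<open>\<parallel>g U\<^sup>-\<^sup>n f\<parallel> = \<parallel>g U\<^sup>n C f\<parallel>\<close>, and expanding along the orbit
  of \<open>\<one>\<close> shows that the Cesaro averages of \<open>\<parallel>g U\<^sup>n f\<parallel>\<^sup>2\<close> over the future and over the past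
  agree in the limit. As \<open>U\<close> has no eigenvalues and \<open>K\<close> is compact, \<open>\<parallel>K U\<^sup>n f\<parallel>\<^sup>2\<close> averages to \<open>0\<close>,
  so \<open>\<parallel>g U\<^sup>n f\<parallel>\<close> may be replaced by \<open>\<parallel>X U\<^sup>n f\<parallel>\<close>. With \<open>M = sup \<parallel>T\<^sup>n\<parallel>\<close>, the average over the future is at
  most \<open>M\<^sup>2 \<parallel>X f\<parallel>\<^sup>2\<close>, while the one over the past is at least \<open>M\<^sup>-\<^sup>2 \<parallel>X U\<^sup>-\<^sup>n f\<parallel>\<^sup>2\<close> for every \<open>n\<close>;
  therefore \<open>\<parallel>T\<^sup>-\<^sup>n X f\<parallel> = \<parallel>X U\<^sup>-\<^sup>n f\<parallel> \<le> M\<^sup>2 \<parallel>X f\<parallel>\<close>, and \<open>X\<close> has dense range.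
\<close>

section \<open>Complex Hilbert spaces\<close>

class complex_hilbert = real_inner + complete_space +
  fixes scaleC :: "complex \<Rightarrow> 'a \<Rightarrow> 'a" (infixr "*\<^sub>C" 75)
    and cinner :: "'a \<Rightarrow> 'a \<Rightarrow> complex"
  assumes scaleC_add_right: "c *\<^sub>C (x + y) = c *\<^sub>C x + c *\<^sub>C y"
    and scaleC_add_left: "(c + d) *\<^sub>C x = c *\<^sub>C x + d *\<^sub>C x"
    and scaleC_scaleC: "c *\<^sub>C d *\<^sub>C x = (c * d) *\<^sub>C x"
    and scaleR_scaleC: "r *\<^sub>R x = complex_of_real r *\<^sub>C x"
    and cinner_commute: "cinner x y = cnj (cinner y x)"
    and cinner_add_left: "cinner (x + y) z = cinner x z + cinner y z"
    and cinner_scaleC_left: "cinner (c *\<^sub>C x) y = c * cinner x y"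
    and inner_eq_Re_cinner: "inner x y = Re (cinner x y)"

lemma cinner_add_right: "cinner x (y + z) = cinner x y + cinner x (z::'a::complex_hilbert)"
  by (metis cinner_add_left cinner_commute complex_cnj_add)

lemma cinner_scaleC_right: "cinner x (c *\<^sub>C y) = cnj c * cinner x (y::'a::complex_hilbert)"
  by (metis cinner_commute cinner_scaleC_left complex_cnj_mult)

lemma scaleC_one [simp]: "1 *\<^sub>C x = (x::'a::complex_hilbert)"
  by (metis of_real_1 scaleR_one scaleR_scaleC)

lemma scaleC_minus_one: "(- 1) *\<^sub>C x = - (x::'a::complex_hilbert)"
  by (metis of_real_1 of_real_minus scaleR_minus1_left scaleR_scaleC)

lemma scaleC_zero_left [simp]: "0 *\<^sub>C x = (0::'a::complex_hilbert)"
  by (metis of_real_0 scaleR_zero_left scaleR_scaleC)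

lemma scaleC_zero_right [simp]: "c *\<^sub>C 0 = (0::'a::complex_hilbert)"
  by (metis add_cancel_right_right scaleC_add_right)

lemma cinner_zero_left [simp]: "cinner 0 (x::'a::complex_hilbert) = 0"
  by (metis cinner_scaleC_left mult_zero_left scaleC_zero_left)

lemma cinner_zero_right [simp]: "cinner (x::'a::complex_hilbert) 0 = 0"
  by (metis cinner_commute cinner_zero_left complex_cnj_zero)

lemma cinner_minus_left [simp]: "cinner (- x) y = - cinner x (y::'a::complex_hilbert)"
  by (metis cinner_scaleC_left mult_minus1 scaleC_minus_one)

lemma cinner_minus_right [simp]: "cinner x (- y) = - cinner x (y::'a::complex_hilbert)"
  by (metis cinner_commute cinner_minus_left complex_cnj_minus)

lemma cinner_diff_left: "cinner (x - y) z = cinner x z - cinner y (z::'a::complex_hilbert)"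
  by (metis cinner_add_left cinner_minus_left diff_conv_add_uminus)

lemma cinner_diff_right: "cinner x (y - z) = cinner x y - cinner x (z::'a::complex_hilbert)"
  by (metis cinner_add_right cinner_minus_right diff_conv_add_uminus)

lemma scaleC_minus_right: "c *\<^sub>C (- x) = - (c *\<^sub>C (x::'a::complex_hilbert))"
  by (metis mult.commute scaleC_minus_one scaleC_scaleC)

lemma scaleC_diff_right: "c *\<^sub>C (x - y) = c *\<^sub>C x - c *\<^sub>C (y::'a::complex_hilbert)"
  by (metis diff_conv_add_uminus scaleC_add_right scaleC_minus_right)

lemma scaleC_sum_right: "c *\<^sub>C (\<Sum>i\<in>I. f i) = (\<Sum>i\<in>I. c *\<^sub>C (f i :: 'a::complex_hilbert))"
  by (induction I rule: infinite_finite_induct) (auto simp: scaleC_add_right)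

lemma cinner_sum_left: "cinner (\<Sum>i\<in>I. f i) y = (\<Sum>i\<in>I. cinner (f i) (y :: 'a::complex_hilbert))"
  by (induction I rule: infinite_finite_induct) (auto simp: cinner_add_left)

lemma cinner_sum_right: "cinner y (\<Sum>i\<in>I. f i) = (\<Sum>i\<in>I. cinner (y :: 'a::complex_hilbert) (f i))"
  by (induction I rule: infinite_finite_induct) (auto simp: cinner_add_right)

lemma cinner_self: "cinner x x = complex_of_real ((norm (x::'a::complex_hilbert))\<^sup>2)"
proof -
  have "Im (cinner x x) = 0"
    using arg_cong[OF cinner_commute[of x x], of Im] by simp
  then show ?thesis
    by (simp add: complex_eq_iff power2_norm_eq_inner inner_eq_Re_cinner)
qed

lemma norm_scaleC [simp]: "norm (c *\<^sub>C x) = cmod c * norm (x::'a::complex_hilbert)"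
proof -
  have "cinner (c *\<^sub>C x) (c *\<^sub>C x) = (c * cnj c) * cinner x x"
    by (simp add: cinner_scaleC_left cinner_scaleC_right)
  then have "complex_of_real ((norm (c *\<^sub>C x))\<^sup>2) = complex_of_real ((cmod c * norm x)\<^sup>2)"
    unfolding cinner_self complex_norm_square[symmetric] power_mult_distrib of_real_mult .
  then have "(norm (c *\<^sub>C x))\<^sup>2 = (cmod c * norm x)\<^sup>2"
    unfolding of_real_eq_iff .
  then show ?thesis by (rule power2_eq_imp_eq) auto
qed

lemma cmod_cinner_le: "cmod (cinner x y) \<le> norm x * norm (y::'a::complex_hilbert)"
proof (cases "cinner x y = 0")
  case False
  define c where "c = cnj (sgn (cinner x y))"
  have c: "cmod c = 1" using False by (simp add: c_def norm_sgn)
  have "c * cinner x y = cinner x y * cnj (cinner x y) / cmod (cinner x y)"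
    by (simp add: c_def sgn_eq)
  also have "\<dots> = cmod (cinner x y)"
    unfolding complex_norm_square[symmetric] using False by (simp add: power2_eq_square)
  finally have "c * cinner x y = cmod (cinner x y)" .
  then have "cmod (cinner x y) = inner (c *\<^sub>C x) y"
    by (simp add: inner_eq_Re_cinner cinner_scaleC_left)
  also have "\<dots> \<le> norm (c *\<^sub>C x) * norm y" by (rule norm_cauchy_schwarz)
  finally show ?thesis using c by simp
qed simp

lemma bounded_linear_cinner_left: "bounded_linear (\<lambda>x. cinner x (y::'a::complex_hilbert))"
  by (rule bounded_linear_intro[where K = "norm y"])
     (auto simp: cinner_add_left scaleR_scaleC cinner_scaleC_left scaleR_conv_of_real cmod_cinner_le)

lemma bounded_linear_scaleC_right: "bounded_linear (\<lambda>x::'a::complex_hilbert. c *\<^sub>C x)"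
  by (rule bounded_linear_intro[where K = "cmod c"])
     (auto simp: scaleC_add_right scaleR_scaleC scaleC_scaleC mult.commute)

lemma bounded_linear_scaleC_left: "bounded_linear (\<lambda>c. c *\<^sub>C (x::'a::complex_hilbert))"
  by (rule bounded_linear_intro[where K = "norm x"])
     (auto simp: scaleC_add_left scaleR_scaleC scaleC_scaleC scaleR_conv_of_real mult.commute)

lemma norm_add_Pythagoras:
  "cinner x y = 0 \<Longrightarrow> (norm (x + y))\<^sup>2 = (norm x)\<^sup>2 + (norm (y::'a::complex_hilbert))\<^sup>2"
  by (simp add: power2_norm_eq_inner inner_add_left inner_add_right inner_commute[of y x])
     (simp add: inner_eq_Re_cinner)

subsection \<open>Closed subspaces and projections\<close>

definition csubspace :: "'a::complex_hilbert set \<Rightarrow> bool" where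
  "csubspace S \<longleftrightarrow> 0 \<in> S \<and> (\<forall>x\<in>S. \<forall>y\<in>S. x + y \<in> S) \<and> (\<forall>c. \<forall>x\<in>S. c *\<^sub>C x \<in> S)"

lemma csubspaceD:
  assumes "csubspace S"
  shows csubspace_0: "0 \<in> S"
    and csubspace_add: "x \<in> S \<Longrightarrow> y \<in> S \<Longrightarrow> x + y \<in> S"
    and csubspace_scaleC: "x \<in> S \<Longrightarrow> c *\<^sub>C x \<in> S"
    and csubspace_scaleR: "x \<in> S \<Longrightarrow> r *\<^sub>R x \<in> S"
    and csubspace_minus: "x \<in> S \<Longrightarrow> - x \<in> S"
    and csubspace_diff: "x \<in> S \<Longrightarrow> y \<in> S \<Longrightarrow> x - y \<in> S"
  using assms unfolding csubspace_def diff_conv_add_uminus scaleC_minus_one[symmetric] scaleR_scaleC by metis+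

lemma csubspace_sum:
  assumes "csubspace S" "\<And>i. i \<in> I \<Longrightarrow> f i \<in> S"
  shows "(\<Sum>i\<in>I. f i) \<in> S"
  using assms(2)
  by (induction I rule: infinite_finite_induct) (auto simp: csubspaceD[OF assms(1)])

lemma csubspace_orthogonal: "csubspace {x. \<forall>h\<in>A. cinner x h = 0}"
  by (auto simp: csubspace_def cinner_add_left cinner_scaleC_left)

lemma closed_orthogonal: "closed {x::'a::complex_hilbert. \<forall>h\<in>A. cinner x h = 0}"
proof -
  have "closed (\<Inter>h\<in>A. (\<lambda>x. cinner x h) -` {0})"
    by (intro closed_INT ballI closed_vimage closed_singleton
        linear_continuous_on[OF bounded_linear_cinner_left])
  also have "(\<Inter>h\<in>A. (\<lambda>x. cinner x h) -` {0}) = {x. \<forall>h\<in>A. cinner x h = 0}"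
    by auto
  finally show ?thesis .
qed

lemma csubspace_closure:
  assumes "csubspace S"
  shows "csubspace (closure S)"
  unfolding csubspace_def
proof (intro conjI ballI allI)
  show "0 \<in> closure S" using csubspace_0[OF assms] closure_subset by blast
next
  fix x y assume "x \<in> closure S" "y \<in> closure S"
  then obtain s t where s: "\<And>n. s n \<in> S" "s \<longlonglongrightarrow> x" and t: "\<And>n. t n \<in> S" "t \<longlonglongrightarrow> y"
    unfolding closure_sequential by blast
  have "(\<lambda>n. s n + t n) \<longlonglongrightarrow> x + y" "\<And>n. s n + t n \<in> S"
    using s t csubspace_add[OF assms] by (auto intro: tendsto_add)
  then show "x + y \<in> closure S"
    unfolding closure_sequential by (intro exI[of _ "\<lambda>n. s n + t n"]) auto
next
  fix c x assume "x \<in> closure S"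
  then obtain s where s: "\<And>n. s n \<in> S" "s \<longlonglongrightarrow> x"
    unfolding closure_sequential by blast
  have "(\<lambda>n. c *\<^sub>C s n) \<longlonglongrightarrow> c *\<^sub>C x" "\<And>n. c *\<^sub>C s n \<in> S"
    using s csubspace_scaleC[OF assms]
    by (auto intro: bounded_linear.tendsto[OF bounded_linear_scaleC_right])
  then show "c *\<^sub>C x \<in> closure S"
    unfolding closure_sequential by (intro exI[of _ "\<lambda>n. c *\<^sub>C s n"]) auto
qed

lemma parallelogram:
  "(norm (x + y))\<^sup>2 + (norm (x - y))\<^sup>2 = 2 * (norm x)\<^sup>2 + 2 * (norm (y::'a::real_inner))\<^sup>2"
  by (simp add: power2_norm_eq_inner inner_add inner_diff inner_commute)

lemma orthogonal_projection_exists: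
  fixes S :: "'a::complex_hilbert set"
  assumes S: "csubspace S" and cl: "closed S"
  shows "\<exists>p\<in>S. \<forall>h\<in>S. cinner (x - p) h = 0"
proof -
  note sub = csubspaceD[OF S]
  define d where "d = (INF s\<in>S. norm (x - s))"
  have bdd: "bdd_below ((\<lambda>s. norm (x - s)) ` S)" by (rule bdd_belowI[of _ 0]) auto
  have ne: "S \<noteq> {}" using sub(1) by auto
  have d_le: "d \<le> norm (x - s)" if "s \<in> S" for s
    unfolding d_def using bdd that by (rule cINF_lower)
  have d0: "0 \<le> d" unfolding d_def by (rule cINF_greatest[OF ne]) auto
  have "\<exists>s\<in>S. norm (x - s) < d + inverse (real (Suc n))" for n
    using cINF_less_iff[OF ne bdd, of "d + inverse (real (Suc n))"] by (auto simp: d_def[symmetric])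
  then obtain s where s: "\<And>n. s n \<in> S" "\<And>n. norm (x - s n) < d + inverse (real (Suc n))"
    by metis
  have lim: "(\<lambda>n. norm (x - s n)) \<longlonglongrightarrow> d"
  proof (rule tendsto_sandwich[of "\<lambda>_. d" _ _ "\<lambda>n. d + inverse (real (Suc n))"])
    show "(\<lambda>n. d + inverse (real (Suc n))) \<longlonglongrightarrow> d"
      using tendsto_add[OF tendsto_const LIMSEQ_inverse_real_of_nat] by simp
  qed (use s d_le in \<open>auto intro!: always_eventually less_imp_le\<close>)
  have mid: "(dist (s i) (s j))\<^sup>2 \<le> 2 * ((norm (x - s i))\<^sup>2 - d\<^sup>2) + 2 * ((norm (x - s j))\<^sup>2 - d\<^sup>2)" for i j
  proof -
    have "(1/2::real) *\<^sub>R (s i + s j) \<in> S" by (intro sub(2,4) s(1))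
    from d_le[OF this] have "2 * d \<le> norm ((x - s i) + (x - s j))"
    proof -
      have "(x - s i) + (x - s j) = 2 *\<^sub>R (x - (1/2::real) *\<^sub>R (s i + s j))"
        by (simp add: algebra_simps scaleR_2)
      then show ?thesis using d_le[OF \<open>(1/2::real) *\<^sub>R (s i + s j) \<in> S\<close>] by simp
    qed
    then have "(2 * d)\<^sup>2 \<le> (norm ((x - s i) + (x - s j)))\<^sup>2"
      using d0 by (intro power_mono) auto
    moreover have "norm ((x - s i) - (x - s j)) = dist (s i) (s j)"
      by (simp add: dist_norm norm_minus_commute)
    ultimately show ?thesis using parallelogram[of "x - s i" "x - s j"] by (simp add: power_mult_distrib)
  qed
  have "Cauchy s"
  proof (rule metric_CauchyI)
    fix e :: real assume e: "0 < e"
    have "(\<lambda>n. (norm (x - s n))\<^sup>2 - d\<^sup>2) \<longlonglongrightarrow> d\<^sup>2 - d\<^sup>2"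
      by (intro tendsto_intros lim)
    then have "eventually (\<lambda>n. (norm (x - s n))\<^sup>2 - d\<^sup>2 < e\<^sup>2 / 4) sequentially"
      by (rule order_tendstoD(2)) (use e in simp)
    then obtain N where N: "\<And>n. n \<ge> N \<Longrightarrow> (norm (x - s n))\<^sup>2 - d\<^sup>2 < e\<^sup>2 / 4"
      unfolding eventually_sequentially by blast
    show "\<exists>M. \<forall>m\<ge>M. \<forall>n\<ge>M. dist (s m) (s n) < e"
    proof (intro exI allI impI)
      fix i j assume "N \<le> i" "N \<le> j"
      have *: "A < E" if "A \<le> 2 * (a - D) + 2 * (b - D)" "a - D < E / 4" "b - D < E / 4"
        for A E D a b :: real using that by argo
      have "(dist (s i) (s j))\<^sup>2 < e\<^sup>2"
        by (rule *[OF mid[of i j] N[OF \<open>N \<le> i\<close>] N[OF \<open>N \<le> j\<close>]])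
      then show "dist (s i) (s j) < e" using e by (simp add: power_less_imp_less_base)
    qed
  qed
  then obtain p where p: "s \<longlonglongrightarrow> p" using Cauchy_convergent convergent_def by blast
  have pS: "p \<in> S" using closed_sequentially[OF cl _ p] s(1) by blast
  have "(\<lambda>n. norm (x - s n)) \<longlonglongrightarrow> norm (x - p)" by (intro tendsto_intros p)
  then have npd: "norm (x - p) = d" using lim LIMSEQ_unique by blast
  have "cinner (x - p) h = 0" if h: "h \<in> S" for h
  proof (rule ccontr)
    assume nz: "cinner (x - p) h \<noteq> 0"
    define a where "a = cinner (x - p) h"
    have h0: "norm h > 0" using nz by auto
    define t where "t = a / complex_of_real ((norm h)\<^sup>2)"
    have "t *\<^sub>C h + p \<in> S" by (intro sub(2,3) h pS)
    then have "d \<le> norm ((x - p) - t *\<^sub>C h)" using d_le[of "t *\<^sub>C h + p"] by (simp add: algebra_simps)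
    then have "d\<^sup>2 \<le> (norm ((x - p) - t *\<^sub>C h))\<^sup>2" using d0 by (intro power_mono)
    moreover have orth: "cinner ((x - p) - t *\<^sub>C h) (t *\<^sub>C h) = 0"
      using h0 by (simp add: cinner_diff_left cinner_scaleC_left cinner_scaleC_right cinner_self t_def a_def)
    have "(norm (x - p))\<^sup>2 = (norm ((x - p) - t *\<^sub>C h))\<^sup>2 + (norm (t *\<^sub>C h))\<^sup>2"
      using norm_add_Pythagoras[OF orth] by simp
    ultimately have "norm (t *\<^sub>C h) = 0" using npd by simp
    then show False using h0 nz by (auto simp: t_def a_def)
  qed
  then show ?thesis using pS by blast
qed

lemma mem_closure_if_orthogonal_trivial:
  assumes S: "csubspace S" and K: "csubspace K" "closed K" and SK: "S \<subseteq> K"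
    and triv: "\<And>y. y \<in> K \<Longrightarrow> (\<forall>h\<in>S. cinner y h = 0) \<Longrightarrow> y = 0"
    and x: "x \<in> K"
  shows "x \<in> closure S"
proof -
  obtain p where p: "p \<in> closure S" "\<forall>h\<in>closure S. cinner (x - p) h = 0"
    using orthogonal_projection_exists[OF csubspace_closure[OF S] closed_closure] by blast
  have "p \<in> K" using p(1) closure_minimal[OF SK K(2)] by blast
  then have "x - p = 0"
    using triv[of "x - p"] p(2) x csubspace_diff[OF K(1)] closure_subset by blast
  then show ?thesis using p(1) by simp
qed

definition proj :: "'a::complex_hilbert set \<Rightarrow> 'a \<Rightarrow> 'a" where
  "proj S x = (SOME p. p \<in> S \<and> (\<forall>h\<in>S. cinner (x - p) h = 0))"

lemma proj:
  assumes "csubspace S" "closed S"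
  shows proj_mem: "proj S x \<in> S" and proj_orthogonal: "h \<in> S \<Longrightarrow> cinner (x - proj S x) h = 0"
proof -
  have "proj S x \<in> S \<and> (\<forall>h\<in>S. cinner (x - proj S x) h = 0)"
    unfolding proj_def by (rule someI_ex) (use orthogonal_projection_exists[OF assms] in blast)
  then show "proj S x \<in> S" "h \<in> S \<Longrightarrow> cinner (x - proj S x) h = 0" by auto
qed

lemma proj_unique:
  assumes S: "csubspace S" "closed S" and p: "p \<in> S" "\<And>h. h \<in> S \<Longrightarrow> cinner (x - p) h = 0"
  shows "proj S x = p"
proof -
  have d: "proj S x - p \<in> S" using proj_mem[OF S] p(1) csubspace_diff[OF S(1)] by blast
  have "cinner (proj S x - p) (proj S x - p) = cinner (x - p) (proj S x - p) - cinner (x - proj S x) (proj S x - p)"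
    by (simp add: cinner_diff_left)
  also have "\<dots> = 0" using p(2)[OF d] proj_orthogonal[OF S d] by simp
  finally show ?thesis by (simp add: cinner_self)
qed

section \<open>The unit circle\<close>

lemma sets_m [simp, measurable_cong]: "sets m = sets borel"
  by (simp add: m_def)

lemma space_m [simp]: "space m = UNIV"
  by (simp add: m_def)

lemma measurable_cis: "cis \<in> borel_measurable borel"
  by (intro borel_measurable_continuous_onI continuous_intros)

lemma measurable_cis_uniform: "cis \<in> borel_measurable (uniform_measure lborel A)"
  using measurable_cis by (subst measurable_cong_sets[of _ borel _ borel]) auto

lemma uniform_2pi: "prob_space (uniform_measure lborel {0..<2 * pi})"
  by (rule prob_space_uniform_measure) auto

interpretation m: prob_space m
  unfolding m_def
  by (rule prob_space.prob_space_distr[OF uniform_2pi measurable_cis_uniform])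

lemma AE_cmod_eq_1: "AE z in m. cmod z = 1"
  unfolding m_def by (subst AE_distr_iff) (auto simp: measurable_cis_uniform)

lemma integral_m:
  fixes f :: "complex \<Rightarrow> complex"
  assumes [measurable]: "f \<in> borel_measurable borel"
  shows "(\<integral>z. f z \<partial>m) = (\<integral>x. indicator {0..<2 * pi} x *\<^sub>R f (cis x) \<partial>lborel) / (2 * pi)"
proof -
  have [measurable]: "cis \<in> borel_measurable borel" by (rule measurable_cis)
  have "(\<integral>z. f z \<partial>m) = (\<integral>x. f (cis x) \<partial>uniform_measure lborel {0..<2 * pi})"
    unfolding m_def by (rule integral_distr[OF measurable_cis_uniform]) auto
  also have "\<dots> = (\<integral>x. f (cis x) \<partial>density lborel (\<lambda>x. ennreal (indicator {0..<2 * pi} x / (2 * pi))))"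
    unfolding uniform_measure_def
    by (intro arg_cong2[where f = "lebesgue_integral"] density_cong refl)
       (auto simp: indicator_def divide_ennreal[symmetric] ennreal_1[symmetric] simp del: ennreal_1)
  also have "\<dots> = (\<integral>x. (indicator {0..<2 * pi} x / (2 * pi)) *\<^sub>R f (cis x) \<partial>lborel)"
    by (rule integral_density) (auto simp: indicator_def)
  also have "\<dots> = (\<integral>x. (1 / (2 * pi)) *\<^sub>R (indicator {0..<2 * pi} x *\<^sub>R f (cis x)) \<partial>lborel)"
    by simp
  also have "\<dots> = (1 / (2 * pi)) *\<^sub>R (\<integral>x. indicator {0..<2 * pi} x *\<^sub>R f (cis x) \<partial>lborel)"
    by (rule integral_scaleR_right)
  finally show ?thesis by (simp add: scaleR_conv_of_real)
qed

lemma measurable_powi [measurable]: "(\<lambda>z::complex. z powi k) \<in> borel_measurable borel"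
  by (cases "k \<ge> 0") (simp_all add: power_int_def)

lemma measurable_cnj [measurable]: "cnj \<in> borel_measurable borel"
  by (intro borel_measurable_continuous_onI continuous_intros)

lemma integrable_bounded_m:
  fixes f :: "complex \<Rightarrow> complex"
  assumes "f \<in> borel_measurable borel" "AE z in m. cmod (f z) \<le> C"
  shows "integrable m f"
  by (rule m.integrable_const_bound[of _ C]) (use assms in \<open>auto simp: measurable_cong_sets[OF sets_m refl]\<close>)

lemma AE_cmod_powi: "AE z in m. cmod (z powi k) = 1"
  using AE_cmod_eq_1 by eventually_elim (simp add: norm_power_int)

lemma integrable_powi: "integrable m (\<lambda>z. z powi k)"
  by (rule integrable_bounded_m[of _ 1]) (use AE_cmod_powi[of k] in auto)

lemma integral_powi: "(\<integral>z. z powi k \<partial>m) = (if k = 0 then 1 else 0)"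
proof (cases "k = 0")
  case True
  then show ?thesis by (simp add: m.prob_space[simplified])
next
  case False
  define F where "F x = cis (of_int k * x) / (\<i> * of_int k)" for x :: real
  have "(F has_vector_derivative cis x powi k) (at x within {0..2*pi})" for x
  proof -
    have "((\<lambda>z. exp (\<i> * (of_int k * z)) / (\<i> * of_int k)) has_field_derivative
        exp (\<i> * (of_int k * of_real x))) (at (of_real x))"
      using False by (auto intro!: derivative_eq_intros simp: mult.commute[of _ \<i>])
    from has_vector_derivative_real_field[OF this] show ?thesis
      unfolding F_def cis_power_int by (simp add: cis_conv_exp)
  qed
  then have "(\<integral>x. indicator {0..2 * pi} x *\<^sub>R (cis x powi k) \<partial>lborel) = F (2 * pi) - F 0"
    by (intro integral_FTC_Icc) (auto intro!: continuous_intros)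
  also have "F (2 * pi) = F 0"
    using cis_multiple_2pi[of "of_int k"] by (simp add: F_def mult.commute)
  finally have "(\<integral>x. indicator {0..2 * pi} x *\<^sub>R (cis x powi k) \<partial>lborel) = 0" by simp
  moreover have "(\<integral>x. indicator {0..2 * pi} x *\<^sub>R (cis x powi k) \<partial>lborel)
      = (\<integral>x. indicator {0..<2 * pi} x *\<^sub>R (cis x powi k) \<partial>lborel)"
    by (rule integral_cong_AE)
       (use AE_lborel_singleton[of "2*pi"] measurable_cis in \<open>auto simp: indicator_def intro!: measurable_If elim!: eventually_mono\<close>)
  ultimately show ?thesis using False by (simp add: integral_m)
qed

section \<open>Isometries without eigenvectors\<close>

locale isometry_without_eigenvectors =
  fixes K :: "'a::complex_hilbert set" and U :: "'a \<Rightarrow> 'a"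
  assumes csubspace_K: "csubspace K" and closed_K: "closed K"
    and U_mem: "x \<in> K \<Longrightarrow> U x \<in> K"
    and U_add: "x \<in> K \<Longrightarrow> y \<in> K \<Longrightarrow> U (x + y) = U x + U y"
    and U_scaleC: "x \<in> K \<Longrightarrow> U (c *\<^sub>C x) = c *\<^sub>C U x"
    and norm_U: "x \<in> K \<Longrightarrow> norm (U x) = norm x"
    and no_eigenvector: "x \<in> K \<Longrightarrow> U x = c *\<^sub>C x \<Longrightarrow> x = 0"
begin

lemmas K_closed = csubspaceD[OF csubspace_K]

lemma U_diff: "x \<in> K \<Longrightarrow> y \<in> K \<Longrightarrow> U (x - y) = U x - U y"
  using U_add[of x "- y"] U_scaleC[of y "- 1"] K_closed(5)[of y]
  by (simp add: scaleC_minus_one)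

lemma pow_mem: "x \<in> K \<Longrightarrow> (U ^^ n) x \<in> K"
  by (induction n) (auto simp: U_mem)

lemma norm_pow: "x \<in> K \<Longrightarrow> norm ((U ^^ n) x) = norm x"
  by (induction n) (auto simp: norm_U pow_mem)

lemma pow_add: "x \<in> K \<Longrightarrow> y \<in> K \<Longrightarrow> (U ^^ n) (x + y) = (U ^^ n) x + (U ^^ n) y"
  by (induction n) (auto simp: U_add pow_mem)

lemma pow_diff: "x \<in> K \<Longrightarrow> y \<in> K \<Longrightarrow> (U ^^ n) (x - y) = (U ^^ n) x - (U ^^ n) y"
  by (induction n) (auto simp: U_diff pow_mem)

lemma pow_scaleC: "x \<in> K \<Longrightarrow> (U ^^ n) (c *\<^sub>C x) = c *\<^sub>C (U ^^ n) x"
  by (induction n) (auto simp: U_scaleC pow_mem)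

lemma pow_zero: "(U ^^ n) 0 = 0"
  using pow_scaleC[of 0 n 0] K_closed(1) by simp

lemma pow_sum: "(\<And>i. i \<in> I \<Longrightarrow> f i \<in> K) \<Longrightarrow> (U ^^ n) (\<Sum>i\<in>I. f i) = (\<Sum>i\<in>I. (U ^^ n) (f i))"
  by (induction I rule: infinite_finite_induct)
     (auto simp: pow_zero pow_add csubspace_sum[OF csubspace_K])

lemma cinner_U:
  assumes x: "x \<in> K" and y: "y \<in> K"
  shows "cinner (U x) (U y) = cinner x y"
proof -
  have re: "Re (cinner (U x) (U y)) = Re (cinner x y)" if "x \<in> K" "y \<in> K" for x y
  proof -
    have *: "(norm (u + v))\<^sup>2 = (norm u)\<^sup>2 + (norm v)\<^sup>2 + 2 * Re (cinner u v)" for u v :: 'a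
      by (simp add: power2_norm_eq_inner inner_add inner_commute flip: inner_eq_Re_cinner)
    have "norm (U x + U y) = norm (x + y)"
      using norm_U[of "x + y"] U_add that K_closed(2) by simp
    with *[of "U x" "U y"] *[of x y] norm_U that show ?thesis by simp
  qed
  have "Im (cinner (U x) (U y)) = Re (cinner (U x) (U (\<i> *\<^sub>C y)))"
    using y by (simp add: U_scaleC cinner_scaleC_right)
  also have "\<dots> = Im (cinner x y)"
    using re[OF x K_closed(3)[OF y]] by (simp add: cinner_scaleC_right)
  finally show ?thesis using re[OF x y] by (simp add: complex_eq_iff)
qed

lemma cinner_pow: "x \<in> K \<Longrightarrow> y \<in> K \<Longrightarrow> cinner ((U ^^ n) x) ((U ^^ n) y) = cinner x y"
  by (induction n) (auto simp: cinner_U pow_mem)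

definition avg :: "complex \<Rightarrow> nat \<Rightarrow> 'a \<Rightarrow> 'a" where
  "avg c k x = (1 / 2 ^ k) *\<^sub>R (\<Sum>n<2 ^ k. c ^ n *\<^sub>C (U ^^ n) x)"

lemma norm_avg_le:
  assumes "x \<in> K" "cmod c = 1"
  shows "norm (avg c k x) \<le> norm x"
proof -
  have "norm (\<Sum>n<2 ^ k. c ^ n *\<^sub>C (U ^^ n) x) \<le> (\<Sum>n<2 ^ k::nat. norm x)"
    by (rule sum_norm_le) (use assms in \<open>simp add: norm_power norm_pow\<close>)
  then show ?thesis by (simp add: avg_def divide_le_eq mult.commute)
qed

lemma avg_diff: "x \<in> K \<Longrightarrow> y \<in> K \<Longrightarrow> avg c k (x - y) = avg c k x - avg c k y"
  by (simp add: avg_def pow_diff scaleC_diff_right sum_subtractf scaleR_diff_right)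

lemma avg_coboundary:
  assumes "x \<in> K"
  shows "avg c k (x - c *\<^sub>C U x) = (1 / 2 ^ k) *\<^sub>R (x - c ^ (2 ^ k) *\<^sub>C (U ^^ (2 ^ k)) x)"
proof -
  have *: "(\<Sum>n<N. c ^ n *\<^sub>C (U ^^ n) (x - c *\<^sub>C U x)) = x - c ^ N *\<^sub>C (U ^^ N) x" for N
  proof (induction N)
    case (Suc N)
    have "(U ^^ N) (x - c *\<^sub>C U x) = (U ^^ N) x - c *\<^sub>C (U ^^ Suc N) x"
      using assms by (simp only: pow_diff pow_scaleC K_closed(3) U_mem funpow_Suc_right o_apply)
    then have "c ^ N *\<^sub>C (U ^^ N) (x - c *\<^sub>C U x) = c ^ N *\<^sub>C (U ^^ N) x - c ^ Suc N *\<^sub>C (U ^^ Suc N) x"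
      by (simp only: scaleC_diff_right scaleC_scaleC power_Suc2)
    then show ?case using Suc by simp
  qed simp
  show ?thesis unfolding avg_def * ..
qed

lemma mean_ergodic:
  assumes x: "x \<in> K" and c: "cmod c = 1"
  shows "(\<lambda>k. avg c k x) \<longlonglongrightarrow> 0"
proof -
  define S where "S = (\<lambda>x. x - c *\<^sub>C U x) ` K"
  have SK: "S \<subseteq> K" by (auto simp: S_def intro!: K_closed(3,6) U_mem)
  have S: "csubspace S"
    unfolding csubspace_def
  proof (intro conjI ballI allI)
    show "0 \<in> S" using K_closed(1) pow_zero[of 1] by (auto simp: S_def intro!: image_eqI[of _ _ 0])
  next
    fix u v assume "u \<in> S" "v \<in> S"
    then obtain a b where "a \<in> K" "b \<in> K" "u = a - c *\<^sub>C U a" "v = b - c *\<^sub>C U b"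
      by (auto simp: S_def)
    then have "u + v = (a + b) - c *\<^sub>C U (a + b)" "a + b \<in> K"
      by (auto simp: U_add scaleC_add_right K_closed(2))
    then show "u + v \<in> S" by (auto simp: S_def)
  next
    fix d u assume "u \<in> S"
    then obtain a where "a \<in> K" "u = a - c *\<^sub>C U a" by (auto simp: S_def)
    then have "d *\<^sub>C u = d *\<^sub>C a - c *\<^sub>C U (d *\<^sub>C a)" "d *\<^sub>C a \<in> K"
      by (auto simp: U_scaleC scaleC_diff_right scaleC_scaleC mult.commute K_closed(3))
    then show "d *\<^sub>C u \<in> S" by (auto simp: S_def)
  qed
  have "x \<in> closure S"
  proof (rule mem_closure_if_orthogonal_trivial[OF S csubspace_K closed_K SK _ x])
    fix y assume y: "y \<in> K" and orth: "\<forall>h\<in>S. cinner y h = 0"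
    define w where "w = c *\<^sub>C U y"
    have "cinner y (y - w) = 0" using orth y by (auto simp: S_def w_def)
    then have "(norm (y - (y - w)))\<^sup>2 = (norm y)\<^sup>2 + (norm (y - w))\<^sup>2"
      using norm_add_Pythagoras[of y "- (y - w)"]
      by (simp add: cinner_diff_right norm_minus_commute)
    moreover have "norm w = norm y" using c y by (simp add: w_def norm_U)
    ultimately have "y = w" by simp
    then have "cnj c *\<^sub>C y = (c * cnj c) *\<^sub>C U y"
      by (metis w_def scaleC_scaleC mult.commute)
    then have "cnj c *\<^sub>C y = U y"
      unfolding complex_norm_square[symmetric] c by simp
    then show "y = 0" using no_eigenvector[OF y] by metis
  qed
  show ?thesis
  proof (rule LIMSEQ_I)
    fix e :: real assume e: "0 < e"
    obtain s where s: "s \<in> S" "dist s x < e / 2"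
      using \<open>x \<in> closure S\<close> e unfolding closure_approachable by (meson half_gt_zero)
    then obtain z where z: "z \<in> K" "s = z - c *\<^sub>C U z" by (auto simp: S_def)
    have "(\<lambda>k. (1 / 2) ^ k * (2 * norm z)) \<longlonglongrightarrow> 0 * (2 * norm z)"
      by (intro tendsto_intros LIMSEQ_power_zero) auto
    then have "eventually (\<lambda>k. (1 / 2) ^ k * (2 * norm z) < e / 2) sequentially"
      by (rule order_tendstoD) (use e in simp)
    then obtain k0 where k0: "\<And>k. k \<ge> k0 \<Longrightarrow> (1 / 2) ^ k * (2 * norm z) < e / 2"
      unfolding eventually_sequentially by blast
    have "norm (avg c k x - 0) < e" if "k \<ge> k0" for k
    proof -
      have "norm (avg c k s) = (1 / 2) ^ k * norm (z - c ^ (2 ^ k) *\<^sub>C (U ^^ (2 ^ k)) z)"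
        unfolding z avg_coboundary[OF z(1)] by (simp add: power_divide)
      also have "\<dots> \<le> (1 / 2) ^ k * (norm z + norm z)"
        using norm_triangle_ineq4[of z "c ^ (2 ^ k) *\<^sub>C (U ^^ (2 ^ k)) z"] c z
        by (intro mult_left_mono) (auto simp: norm_power norm_pow)
      finally have "norm (avg c k s) < e / 2" using k0[OF that] by simp
      moreover have "norm (avg c k (x - s)) < e / 2"
        using norm_avg_le[of "x - s" c k] s SK x c K_closed(6)[of x s]
        by (auto simp: dist_norm norm_minus_commute)
      moreover have "avg c k x = avg c k (x - s) + avg c k s"
        using avg_diff[of x s] x s SK by auto
      ultimately show ?thesis
        using norm_triangle_ineq[of "avg c k (x - s)" "avg c k s"] by simp
    qed
    then show "\<exists>no. \<forall>n\<ge>no. norm (avg c n x - 0) < e" by blast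
  qed
qed

lemma norm_avg_Suc_le:
  assumes x: "x \<in> K" and c: "cmod c = 1"
  shows "norm (avg c (Suc k) x) \<le> norm (avg c k x)"
proof -
  let ?N = "2 ^ k :: nat"
  define A where "A = (\<Sum>n<?N. c ^ n *\<^sub>C (U ^^ n) x)"
  have AK: "A \<in> K" unfolding A_def by (intro csubspace_sum[OF csubspace_K] K_closed(3) pow_mem x)
  have "(\<Sum>n<?N + ?N. c ^ n *\<^sub>C (U ^^ n) x) = A + (\<Sum>n<?N. c ^ (n + ?N) *\<^sub>C (U ^^ (n + ?N)) x)"
    unfolding A_def lessThan_atLeast0
    using sum.atLeastLessThan_concat[of 0 ?N "?N + ?N" "\<lambda>n. c ^ n *\<^sub>C (U ^^ n) x"]
      sum.shift_bounds_nat_ivl[of "\<lambda>n. c ^ n *\<^sub>C (U ^^ n) x" 0 ?N ?N] by simp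
  also have "(\<Sum>n<?N. c ^ (n + ?N) *\<^sub>C (U ^^ (n + ?N)) x) = c ^ ?N *\<^sub>C (U ^^ ?N) A"
  proof -
    have "(U ^^ ?N) A = (\<Sum>n<?N. (U ^^ ?N) (c ^ n *\<^sub>C (U ^^ n) x))"
      unfolding A_def by (intro pow_sum K_closed(3) pow_mem x)
    also have "\<dots> = (\<Sum>n<?N. c ^ n *\<^sub>C (U ^^ (n + ?N)) x)"
      by (intro sum.cong refl) (simp add: pow_scaleC pow_mem x add.commute[of _ ?N] funpow_add)
    finally show ?thesis by (simp add: scaleC_sum_right scaleC_scaleC power_add mult.commute)
  qed
  finally have "(\<Sum>n<?N + ?N. c ^ n *\<^sub>C (U ^^ n) x) = A + c ^ ?N *\<^sub>C (U ^^ ?N) A" .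
  moreover have "?N + ?N = 2 ^ Suc k" by simp
  ultimately have "(\<Sum>n<2 ^ Suc k. c ^ n *\<^sub>C (U ^^ n) x) = A + c ^ ?N *\<^sub>C (U ^^ ?N) A"
    by metis
  then have "norm (avg c (Suc k) x) = norm (A + c ^ ?N *\<^sub>C (U ^^ ?N) A) / (2 * 2 ^ k)"
    unfolding avg_def by (simp only: norm_scaleR) simp
  also have "\<dots> \<le> (norm A + norm A) / (2 * 2 ^ k)"
    using norm_triangle_ineq[of A "c ^ ?N *\<^sub>C (U ^^ ?N) A"] c AK
    by (intro divide_right_mono) (auto simp: norm_power norm_pow)
  finally show ?thesis by (simp add: avg_def A_def)
qed

text \<open>Dini's theorem on the compact circle makes the mean ergodic theorem uniform in the rotation.\<close>

lemma uniform_mean_ergodic: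
  assumes x: "x \<in> K" and e: "e > 0"
  shows "\<exists>k0. \<forall>k\<ge>k0. \<forall>c. cmod c = 1 \<longrightarrow> norm (avg c k x) < e"
proof (rule ccontr)
  assume neg: "\<not> ?thesis"
  have dec: "norm (avg c k x) \<le> norm (avg c i x)" if "cmod c = 1" "i \<le> k" for c i k
    using that(2) by (rule lift_Suc_antimono_le[where f = "\<lambda>k. norm (avg c k x)", rotated])
      (rule norm_avg_Suc_le[OF x that(1)])
  have "\<exists>c. cmod c = 1 \<and> e \<le> norm (avg c k x)" for k
    using neg dec by (meson not_less order_trans)
  then obtain c where c: "\<And>k. cmod (c k) = 1" "\<And>k. e \<le> norm (avg (c k) k x)" by metis
  have "\<forall>k. c k \<in> sphere 0 1" using c by simp
  then obtain d r where d: "d \<in> sphere 0 1" "strict_mono (r::nat \<Rightarrow> nat)" "(c \<circ> r) \<longlonglongrightarrow> d"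
    using compact_sphere[of "0::complex" 1] unfolding compact_def by metis
  have "e \<le> norm (avg d i x)" for i
  proof (rule LIMSEQ_le_const)
    show "(\<lambda>j. norm (avg (c (r j)) i x)) \<longlonglongrightarrow> norm (avg d i x)"
      unfolding avg_def using d(3)
      by (intro tendsto_intros bounded_linear.tendsto[OF bounded_linear_scaleC_left]) (simp add: o_def)
    have "e \<le> norm (avg (c (r j)) i x)" if "j \<ge> i" for j
      using c(2)[of "r j"] dec[OF c(1)[of "r j"], of i "r j"] seq_suble[OF d(2), of j] that by linarith
    then show "\<exists>N. \<forall>n\<ge>N. e \<le> norm (avg (c (r n)) i x)" by blast
  qed
  moreover have "(\<lambda>i. norm (avg d i x)) \<longlonglongrightarrow> norm (0::'a)"
    by (intro tendsto_intros mean_ergodic[OF x]) (use d in simp)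
  ultimately have "e \<le> norm (0::'a)"
    using LIMSEQ_le_const by blast
  then show False using e by simp
qed

end

lemma has_bochner_integral_powi:
  "has_bochner_integral m (\<lambda>z. z powi i * cnj (z powi j) * z powi l) (if i + l = j then 1 else 0)"
proof -
  have *: "AE z in m. z powi i * cnj (z powi j) * z powi l = z powi (i + l - j)"
    using AE_cmod_eq_1
  proof eventually_elim
    fix z :: complex assume z: "cmod z = 1"
    then have z0: "z \<noteq> 0" by auto
    have "z * cnj z = 1" using z by (simp add: complex_norm_square[symmetric])
    then have "cnj z = inverse z" using z0 by (simp add: field_simps)
    then have "cnj (z powi j) = z powi (- j)"
      by (simp add: power_int_minus power_int_inverse)
    then show "z powi i * cnj (z powi j) * z powi l = z powi (i + l - j)"
      using z0 by (simp add: power_int_add[symmetric] algebra_simps)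
  qed
  have "has_bochner_integral m (\<lambda>z. z powi (i + l - j)) (if i + l = j then 1 else 0)"
    using integrable_powi[of "i + l - j"] integral_powi[of "i + l - j"]
    by (simp add: has_bochner_integral_iff)
  then show ?thesis
    by (subst has_bochner_integral_cong_AE[OF _ _ *]) measurable
qed

context isometry_without_eigenvectors
begin

text \<open>The Fourier coefficients of \<open>\<lambda>z. (norm (\<Sum>n<N. z ^ n *\<^sub>C (U ^^ n) x))\<^sup>2\<close> are multiples of the
  correlations of the orbit. Pairing this function with a trigonometric polynomial \<open>D\<close> whose unimodular
  coefficients cancel their phases yields the sum of the moduli.\<close>

lemma gram_sum_bound:
  assumes x: "x \<in> K" and e: "e \<ge> 0"
    and avg: "\<And>c. cmod c = 1 \<Longrightarrow> norm (avg c k x) \<le> e"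
  shows "(\<Sum>n<2^k. \<Sum>l<2^k. cmod (cinner ((U ^^ n) x) ((U ^^ l) x)))
    \<le> e * (2 ^ k)\<^sup>2 * ((norm x)\<^sup>2 / 2 + 1)"
proof -
  define N :: nat where "N = 2 ^ k"
  define xs where "xs n = (U ^^ n) x" for n
  define \<gamma> where "\<gamma> j = (if 0 \<le> j then cinner x (xs (nat j)) else cinner (xs (nat (- j))) x)" for j :: int
  define s where "s j = cnj (sgn (\<gamma> j))" for j
  define J where "J = {- int N<..<int N}"
  define p where "p z = (\<Sum>n<N. z ^ n *\<^sub>C xs n)" for z
  define D where "D z = (\<Sum>j\<in>J. s j * z powi j)" for z
  have xsK: "xs n \<in> K" for n by (simp add: xs_def pow_mem x)
  have \<gamma>: "cinner (xs n) (xs l) = \<gamma> (int l - int n)" for n l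
  proof (cases "n \<le> l")
    case True
    then have "xs l = (U ^^ n) (xs (l - n))"
      by (simp add: xs_def) (metis comp_apply funpow_add le_add_diff_inverse)
    then show ?thesis using True cinner_pow[OF x xsK[of "l - n"], of n]
      by (simp add: \<gamma>_def xs_def[of n] nat_diff_distrib' flip: of_nat_diff)
  next
    case False
    then have "xs n = (U ^^ l) (xs (n - l))"
      by (simp add: xs_def) (metis comp_apply funpow_add le_add_diff_inverse nat_le_linear)
    then show ?thesis using False cinner_pow[OF xsK[of "n - l"] x, of l]
      by (simp add: \<gamma>_def xs_def[of l] nat_diff_distrib' flip: of_nat_diff)
  qed
  have \<gamma>s: "\<gamma> j * s j = cmod (\<gamma> j)" for j
    by (cases "\<gamma> j = 0") (simp_all add: s_def sgn_eq complex_norm_square[symmetric] power2_eq_square)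
  have s_le: "cmod (s j) \<le> 1" for j by (simp add: s_def norm_sgn)
  have p2: "complex_of_real ((norm (p z))\<^sup>2)
      = (\<Sum>n<N. \<Sum>l<N. cinner (xs n) (xs l) * (z powi int n * cnj (z powi int l) * z powi 0))" for z
    unfolding cinner_self[symmetric] p_def cinner_sum_left cinner_sum_right
    by (subst sum.swap) (auto intro!: sum.cong simp: cinner_scaleC_left cinner_scaleC_right)
  have "has_bochner_integral m (\<lambda>z. complex_of_real ((norm (p z))\<^sup>2))
      (\<Sum>n<N. \<Sum>l<N. cinner (xs n) (xs l) * (if int n + 0 = int l then 1 else 0))"
    unfolding p2
    by (intro has_bochner_integral_sum has_bochner_integral_mult_right has_bochner_integral_powi)
  also have "(\<Sum>n<N. \<Sum>l<N. cinner (xs n) (xs l) * (if int n + 0 = int l then 1 else 0))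
      = (\<Sum>n<N. complex_of_real ((norm x)\<^sup>2))"
    by (intro sum.cong refl) (simp add: if_distrib sum.delta' cinner_self xs_def norm_pow x cong: if_cong)
  finally have int_p: "has_bochner_integral m (\<lambda>z. (norm (p z))\<^sup>2) (N * (norm x)\<^sup>2)"
    using has_bochner_integral_bounded_linear[OF bounded_linear_Re] by fastforce
  have D2: "complex_of_real ((cmod (D z))\<^sup>2)
      = (\<Sum>i\<in>J. \<Sum>j\<in>J. (s i * cnj (s j)) * (z powi i * cnj (z powi j) * z powi 0))" for z
    unfolding complex_norm_square D_def cnj_sum sum_product
    by (auto intro!: sum.cong simp: mult_ac)
  have finJ: "finite J" by (simp add: J_def)
  have "has_bochner_integral m (\<lambda>z. complex_of_real ((cmod (D z))\<^sup>2))
      (\<Sum>i\<in>J. \<Sum>j\<in>J. (s i * cnj (s j)) * (if i + 0 = j then 1 else 0))"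
    unfolding D2
    by (intro has_bochner_integral_sum has_bochner_integral_mult_right has_bochner_integral_powi)
  also have "(\<Sum>i\<in>J. \<Sum>j\<in>J. (s i * cnj (s j)) * (if i + 0 = j then 1 else 0))
      = complex_of_real (\<Sum>i\<in>J. (cmod (s i))\<^sup>2)"
    using finJ unfolding of_real_sum
    by (intro sum.cong refl) (simp add: if_distrib sum.delta' complex_norm_square[symmetric] cong: if_cong)
  finally have int_D: "has_bochner_integral m (\<lambda>z. (cmod (D z))\<^sup>2) (\<Sum>i\<in>J. (cmod (s i))\<^sup>2)"
    using has_bochner_integral_bounded_linear[OF bounded_linear_Re] by fastforce
  have "(\<Sum>i\<in>J. (cmod (s i))\<^sup>2) \<le> (\<Sum>i\<in>J. 1)"
    by (intro sum_mono) (simp add: s_le power_le_one)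
  also have "\<dots> \<le> 2 * real N" by (simp add: J_def)
  finally have D_le: "(\<Sum>i\<in>J. (cmod (s i))\<^sup>2) \<le> 2 * real N" .
  have pD: "complex_of_real ((norm (p z))\<^sup>2) * D z
      = (\<Sum>n<N. \<Sum>l<N. \<Sum>j\<in>J. (cinner (xs n) (xs l) * s j) * (z powi int n * cnj (z powi int l) * z powi j))" for z
    unfolding p2 sum_distrib_right unfolding D_def sum_distrib_left by (auto intro!: sum.cong simp: mult_ac)
  have "has_bochner_integral m (\<lambda>z. complex_of_real ((norm (p z))\<^sup>2) * D z)
      (\<Sum>n<N. \<Sum>l<N. \<Sum>j\<in>J. (cinner (xs n) (xs l) * s j) * (if int n + j = int l then 1 else 0))"
    unfolding pD
    by (intro has_bochner_integral_sum has_bochner_integral_mult_right has_bochner_integral_powi)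
  also have "(\<Sum>n<N. \<Sum>l<N. \<Sum>j\<in>J. (cinner (xs n) (xs l) * s j) * (if int n + j = int l then 1 else 0))
      = complex_of_real (\<Sum>n<N. \<Sum>l<N. cmod (cinner (xs n) (xs l)))"
    unfolding of_real_sum
  proof (intro sum.cong refl)
    fix n l assume nl: "n \<in> {..<N}" "l \<in> {..<N}"
    then have "int l - int n \<in> J" by (auto simp: J_def)
    have "(\<Sum>j\<in>J. (cinner (xs n) (xs l) * s j) * (if int n + j = int l then 1 else 0))
        = (\<Sum>j\<in>J. if j = int l - int n then cinner (xs n) (xs l) * s j else 0)"
      by (intro sum.cong refl) auto
    also have "\<dots> = \<gamma> (int l - int n) * s (int l - int n)"
      using \<open>int l - int n \<in> J\<close> finJ by (simp add: \<gamma>)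
    finally show "(\<Sum>j\<in>J. (cinner (xs n) (xs l) * s j) * (if int n + j = int l then 1 else 0))
        = complex_of_real (cmod (cinner (xs n) (xs l)))"
      by (simp add: \<gamma> \<gamma>s)
  qed
  finally have int_pD: "has_bochner_integral m (\<lambda>z. Re (complex_of_real ((norm (p z))\<^sup>2) * D z))
      (\<Sum>n<N. \<Sum>l<N. cmod (cinner (xs n) (xs l)))"
    using has_bochner_integral_bounded_linear[OF bounded_linear_Re] by fastforce
  have int_R: "has_bochner_integral m (\<lambda>z. e * N / 2 * ((norm (p z))\<^sup>2 + (cmod (D z))\<^sup>2))
      (e * N / 2 * (N * (norm x)\<^sup>2 + (\<Sum>i\<in>J. (cmod (s i))\<^sup>2)))"
    by (intro has_bochner_integral_mult_right has_bochner_integral_add int_p int_D)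
  have "(\<Sum>n<N. \<Sum>l<N. cmod (cinner (xs n) (xs l))) = (\<integral>z. Re (complex_of_real ((norm (p z))\<^sup>2) * D z) \<partial>m)"
    using int_pD by (simp add: has_bochner_integral_iff)
  also have "\<dots> \<le> (\<integral>z. e * N / 2 * ((norm (p z))\<^sup>2 + (cmod (D z))\<^sup>2) \<partial>m)"
  proof (rule integral_mono_AE)
    show "AE z in m. Re (complex_of_real ((norm (p z))\<^sup>2) * D z) \<le> e * N / 2 * ((norm (p z))\<^sup>2 + (cmod (D z))\<^sup>2)"
      using AE_cmod_eq_1
    proof eventually_elim
      fix z :: complex assume z: "cmod z = 1"
      have "norm (p z) = N * norm (avg z k x)" by (simp add: avg_def p_def xs_def N_def)
      then have p_le: "norm (p z) \<le> e * N" using mult_left_mono[OF avg[OF z], of "real N"] by (simp add: mult.commute)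
      have "Re (complex_of_real ((norm (p z))\<^sup>2) * D z) = norm (p z) * (norm (p z) * Re (D z))"
        by (simp add: power2_eq_square)
      also have "\<dots> \<le> norm (p z) * (norm (p z) * cmod (D z))"
        by (intro mult_left_mono complex_Re_le_cmod) auto
      also have "\<dots> \<le> (e * N) * (norm (p z) * cmod (D z))"
        by (intro mult_right_mono p_le) auto
      also have "\<dots> \<le> (e * N) * (((norm (p z))\<^sup>2 + (cmod (D z))\<^sup>2) / 2)"
        using sum_squares_bound[of "norm (p z)" "cmod (D z)"] e by (intro mult_left_mono) auto
      finally show "Re (complex_of_real ((norm (p z))\<^sup>2) * D z) \<le> e * N / 2 * ((norm (p z))\<^sup>2 + (cmod (D z))\<^sup>2)"
        by simp
    qed
  qed (use int_pD int_R in \<open>auto simp: has_bochner_integral_iff\<close>)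
  also have "\<dots> = e * N / 2 * (N * (norm x)\<^sup>2 + (\<Sum>i\<in>J. (cmod (s i))\<^sup>2))"
    using int_R by (simp add: has_bochner_integral_iff)
  also have "\<dots> \<le> e * N / 2 * (N * (norm x)\<^sup>2 + 2 * real N)"
    using D_le e by (intro mult_left_mono) auto
  also have "\<dots> = e * (real N)\<^sup>2 * ((norm x)\<^sup>2 / 2 + 1)" by (simp add: power2_eq_square field_simps)
  finally show ?thesis by (simp add: xs_def N_def)
qed

lemma weighted_orbit_sums_small:
  assumes x: "x \<in> K" and e: "e > 0"
  shows "\<exists>k0. \<forall>k\<ge>k0. \<forall>a :: nat \<Rightarrow> real. (\<forall>n. \<bar>a n\<bar> \<le> 1) \<longrightarrow>
    norm (\<Sum>n<2^k. a n *\<^sub>R (U ^^ n) x) \<le> e * 2 ^ k"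
proof -
  define q where "q = (norm x)\<^sup>2 / 2 + 1"
  have q: "q > 0" unfolding q_def by (rule add_nonneg_pos) auto
  obtain k0 where k0: "\<And>k c. k \<ge> k0 \<Longrightarrow> cmod c = 1 \<Longrightarrow> norm (avg c k x) < e\<^sup>2 / q"
    using uniform_mean_ergodic[OF x, of "e\<^sup>2 / q"] e q by auto
  show ?thesis
  proof (intro exI allI impI)
    fix k and a :: "nat \<Rightarrow> real" assume k: "k0 \<le> k" and a: "\<forall>n. \<bar>a n\<bar> \<le> 1"
    have "(norm (\<Sum>n<2^k. a n *\<^sub>R (U ^^ n) x))\<^sup>2
        = (\<Sum>n<2^k. \<Sum>l<2^k. a n * a l * inner ((U ^^ n) x) ((U ^^ l) x))"
      by (simp add: power2_norm_eq_inner inner_sum_left inner_sum_right sum_distrib_left mult_ac inner_commute)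
    also have "\<dots> \<le> (\<Sum>n<2^k. \<Sum>l<2^k. cmod (cinner ((U ^^ n) x) ((U ^^ l) x)))"
    proof (intro sum_mono)
      fix n l :: nat
      have "\<bar>a n * a l\<bar> \<le> 1" using a by (simp add: abs_mult mult_le_one)
      have "a n * a l * inner ((U ^^ n) x) ((U ^^ l) x) \<le> \<bar>a n * a l\<bar> * \<bar>inner ((U ^^ n) x) ((U ^^ l) x)\<bar>"
        by (simp flip: abs_mult)
      also have "\<dots> \<le> 1 * cmod (cinner ((U ^^ n) x) ((U ^^ l) x))"
        using \<open>\<bar>a n * a l\<bar> \<le> 1\<close> by (intro mult_mono) (auto simp: inner_eq_Re_cinner abs_Re_le_cmod)
      finally show "a n * a l * inner ((U ^^ n) x) ((U ^^ l) x) \<le> cmod (cinner ((U ^^ n) x) ((U ^^ l) x))"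
        by simp
    qed
    also have "\<dots> \<le> e\<^sup>2 / q * (2 ^ k)\<^sup>2 * q"
      unfolding q_def using k0[OF k] q e by (intro gram_sum_bound x) (auto simp: q_def less_imp_le)
    also have "\<dots> = (e * 2 ^ k)\<^sup>2" using q by (simp add: power_mult_distrib)
    finally show "norm (\<Sum>n<2^k. a n *\<^sub>R (U ^^ n) x) \<le> e * 2 ^ k"
      by (rule power2_le_imp_le) (use e in simp)
  qed
qed

end

locale compact_on =
  fixes K :: "'a::complex_hilbert set" and A :: "'a \<Rightarrow> 'b::real_inner"
  assumes sub: "csubspace K"
    and A_add: "x \<in> K \<Longrightarrow> y \<in> K \<Longrightarrow> A (x + y) = A x + A y"
    and A_scaleR: "x \<in> K \<Longrightarrow> A (r *\<^sub>R x) = r *\<^sub>R A x"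
    and subseq: "(\<And>n. s n \<in> K \<and> norm (s n) \<le> 1) \<Longrightarrow> \<exists>r y. strict_mono (r::nat \<Rightarrow> nat) \<and> (\<lambda>n. A (s (r n))) \<longlonglongrightarrow> y"
begin

lemma A_sum:
  assumes "\<And>i. i \<in> I \<Longrightarrow> f i \<in> K"
  shows "A (\<Sum>i\<in>I. f i) = (\<Sum>i\<in>I. A (f i))"
proof -
  have "A 0 = 0" using A_scaleR[of 0 0] csubspace_0[OF sub] by simp
  with assms show ?thesis
    by (induction I rule: infinite_finite_induct) (auto simp: A_add csubspace_sum[OF sub])
qed

lemma finite_net:
  assumes e: "e > 0"
  shows "\<exists>F. finite F \<and> (\<forall>x\<in>K. norm x \<le> 1 \<longrightarrow> (\<exists>v\<in>F. norm (A x - v) < e))"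
proof -
  define S where "S = A ` (K \<inter> cball 0 1)"
  have "Met_TC.mtotally_bounded S"
    unfolding Met_TC.mtotally_bounded_sequentially
  proof (intro conjI allI impI)
    fix \<sigma> :: "nat \<Rightarrow> 'b" assume "range \<sigma> \<subseteq> S"
    then have "\<forall>n. \<exists>x. x \<in> K \<and> norm x \<le> 1 \<and> \<sigma> n = A x" by (fastforce simp: S_def)
    then obtain s where s: "\<And>n. s n \<in> K \<and> norm (s n) \<le> 1" "\<And>n. \<sigma> n = A (s n)" by metis
    obtain r y where "strict_mono (r::nat \<Rightarrow> nat)" "(\<lambda>n. A (s (r n))) \<longlonglongrightarrow> y"
      using subseq[of s] s(1) by blast
    then have "strict_mono r \<and> Cauchy (\<sigma> \<circ> r)"
      using LIMSEQ_imp_Cauchy by (auto simp: o_def s(2))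
    then show "\<exists>r. strict_mono r \<and> Met_TC.MCauchy (\<sigma> \<circ> r)" by auto
  qed auto
  then obtain F where "finite F" "S \<subseteq> (\<Union>x\<in>F. ball x e)"
    using e unfolding Met_TC.mtotally_bounded_def by auto
  then show ?thesis
    by (intro exI[of _ F]) (fastforce simp: S_def dist_norm norm_minus_commute)
qed

lemma bounded: "\<exists>C>0. \<forall>x\<in>K. norm (A x) \<le> C * norm x"
proof -
  obtain F where F: "finite F" "\<And>x. x \<in> K \<Longrightarrow> norm x \<le> 1 \<Longrightarrow> \<exists>v\<in>F. norm (A x - v) < 1"
    using finite_net[of 1] by auto
  define C where "C = (\<Sum>v\<in>F. norm v) + 1"
  have C: "C > 0" unfolding C_def by (simp add: sum_nonneg add_nonneg_pos)
  have unit: "norm (A x) \<le> C" if x: "x \<in> K" "norm x \<le> 1" for x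
  proof -
    obtain v where v: "v \<in> F" "norm (A x - v) < 1" using F(2)[OF x] by blast
    have "norm v \<le> (\<Sum>v\<in>F. norm v)" using v F(1) by (intro member_le_sum) auto
    then show ?thesis using norm_triangle_sub[of "A x" v] v(2) by (simp add: C_def)
  qed
  have "norm (A x) \<le> C * norm x" if x: "x \<in> K" for x
  proof (cases "x = 0")
    case True
    then show ?thesis using A_scaleR[of x 0] x by simp
  next
    case False
    have "norm (A (inverse (norm x) *\<^sub>R x)) \<le> C"
      by (rule unit) (use False x csubspace_scaleR[OF sub] in auto)
    then show ?thesis using False by (simp add: A_scaleR x field_simps)
  qed
  then show ?thesis using C by blast
qed

end

locale compact_after_isometry = isometry_without_eigenvectors K U + compact_on K A
  for K :: "'a::complex_hilbert set" and U and A :: "'a \<Rightarrow> 'b::real_inner"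
begin

lemma orbit_average_tendsto_0_unit:
  assumes x: "x \<in> K" "norm x \<le> 1"
  shows "(\<lambda>k. (\<Sum>n<2^k. (norm (A ((U ^^ n) x)))\<^sup>2) / 2 ^ k) \<longlonglongrightarrow> 0"
proof (rule LIMSEQ_I)
  fix e :: real assume e: "0 < e"
  obtain C where C: "C > 0" "\<And>x. x \<in> K \<Longrightarrow> norm (A x) \<le> C * norm x" using bounded by blast
  define \<delta> where "\<delta> = e / (2 * C)"
  have \<delta>: "\<delta> > 0" using C(1) e by (simp add: \<delta>_def)
  obtain F where F: "finite F" "\<And>x. x \<in> K \<Longrightarrow> norm x \<le> 1 \<Longrightarrow> \<exists>v\<in>F. norm (A x - v) < \<delta>"
    using finite_net[OF \<delta>] by auto
  define y where "y n = A ((U ^^ n) x)" for n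
  have y_le: "norm (y n) \<le> C" for n
  proof -
    have "norm (y n) \<le> C * norm x"
      using C(2)[OF pow_mem[OF x(1)], of n] by (simp add: y_def norm_pow x)
    also have "\<dots> \<le> C * 1" using x(2) C(1) by (intro mult_left_mono) auto
    finally show ?thesis by simp
  qed
  have y2: "(norm (y n))\<^sup>2 \<le> C * \<delta> + (\<Sum>v\<in>F. \<bar>inner (y n) v\<bar>)" for n
  proof -
    obtain v where v: "v \<in> F" "norm (y n - v) < \<delta>"
      using F(2)[OF pow_mem[OF x(1)], of n] x norm_pow[OF x(1), of n] by (auto simp: y_def)
    have "(norm (y n))\<^sup>2 = inner (y n) (y n - v) + inner (y n) v"
      by (simp add: power2_norm_eq_inner inner_diff_right)
    also have "inner (y n) (y n - v) \<le> norm (y n) * norm (y n - v)" by (rule norm_cauchy_schwarz)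
    also have "\<dots> \<le> C * \<delta>" using y_le[of n] v C(1) by (intro mult_mono) auto
    also have "inner (y n) v \<le> (\<Sum>v\<in>F. \<bar>inner (y n) v\<bar>)"
      using member_le_sum[OF v(1), of "\<lambda>v. \<bar>inner (y n) v\<bar>"] F(1) by simp
    finally show ?thesis by simp
  qed
  define q where "q = e / (4 * C * (1 + (\<Sum>v\<in>F. norm v)))"
  have sumF: "0 \<le> (\<Sum>v\<in>F. norm v)" by (simp add: sum_nonneg)
  then have q: "q > 0" using e C(1) by (simp add: q_def add_pos_nonneg)
  obtain k0 where k0: "\<And>k a. k \<ge> k0 \<Longrightarrow> (\<forall>n. \<bar>a n :: real\<bar> \<le> 1) \<Longrightarrow>
      norm (\<Sum>n<2^k. a n *\<^sub>R (U ^^ n) x) \<le> q * 2 ^ k"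
    using weighted_orbit_sums_small[OF x(1) q] by blast
  have "norm ((\<Sum>n<2^k. (norm (y n))\<^sup>2) / 2 ^ k - 0) < e" if k: "k \<ge> k0" for k
  proof -
    have one: "(\<Sum>n<2^k. \<bar>inner (y n) v\<bar>) \<le> C * (q * 2 ^ k) * norm v" for v
    proof -
      define a where "a n = sgn (inner (y n) v)" for n
      define w where "w = (\<Sum>n<2^k. a n *\<^sub>R (U ^^ n) x)"
      have wK: "w \<in> K" unfolding w_def
        by (intro csubspace_sum[OF csubspace_K] K_closed(4) pow_mem x)
      have "A w = (\<Sum>n<2^k. A (a n *\<^sub>R (U ^^ n) x))"
        unfolding w_def by (intro A_sum K_closed(4) pow_mem x)
      also have "\<dots> = (\<Sum>n<2^k. a n *\<^sub>R y n)" by (simp add: A_scaleR pow_mem x y_def)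
      finally have "inner (A w) v = (\<Sum>n<2^k. \<bar>inner (y n) v\<bar>)"
        by (simp add: inner_sum_left a_def abs_sgn mult.commute)
      moreover have "inner (A w) v \<le> norm (A w) * norm v" by (rule norm_cauchy_schwarz)
      moreover have "norm (A w) \<le> C * (q * 2 ^ k)"
      proof -
        have "norm w \<le> q * 2 ^ k" unfolding w_def by (rule k0[OF k]) (simp add: a_def abs_sgn_eq)
        then show ?thesis using C(2)[OF wK] C(1) by (meson less_imp_le mult_left_mono order_trans)
      qed
      ultimately show ?thesis by (metis mult_right_mono norm_ge_zero order_trans)
    qed
    have "(\<Sum>n<2^k. (norm (y n))\<^sup>2) \<le> (\<Sum>n<2^k. C * \<delta> + (\<Sum>v\<in>F. \<bar>inner (y n) v\<bar>))"
      by (intro sum_mono y2)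
    also have "\<dots> = 2 ^ k * (C * \<delta>) + (\<Sum>v\<in>F. \<Sum>n<2^k. \<bar>inner (y n) v\<bar>)"
      by (simp add: sum.distrib sum.swap[of _ F])
    also have "\<dots> \<le> 2 ^ k * (C * \<delta>) + (\<Sum>v\<in>F. C * (q * 2 ^ k) * norm v)"
      by (intro add_left_mono sum_mono one)
    also have "\<dots> = 2 ^ k * (C * \<delta> + C * q * (\<Sum>v\<in>F. norm v))"
      by (simp add: sum_distrib_left algebra_simps)
    also have "\<dots> < 2 ^ k * e"
    proof -
      have "C * \<delta> = e / 2" using C(1) by (simp add: \<delta>_def)
      moreover have "C * q * (\<Sum>v\<in>F. norm v) < e / 2"
      proof -
        have "C * q * (\<Sum>v\<in>F. norm v) \<le> C * q * (1 + (\<Sum>v\<in>F. norm v))"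
          using C(1) q by (intro mult_left_mono) auto
        also have "\<dots> = e / 4" using C(1) sumF by (simp add: q_def field_simps add_pos_nonneg[THEN less_imp_neq[symmetric]])
        finally show ?thesis using e by simp
      qed
      ultimately show ?thesis by simp
    qed
    finally show ?thesis by (simp add: sum_nonneg field_simps)
  qed
  then show "\<exists>no. \<forall>k\<ge>no. norm ((\<Sum>n<2^k. (norm (A ((U ^^ n) x)))\<^sup>2) / 2 ^ k - 0) < e"
    unfolding y_def by blast
qed

lemma orbit_average_tendsto_0:
  assumes x: "x \<in> K"
  shows "(\<lambda>k. (\<Sum>n<2^k. (norm (A ((U ^^ n) x)))\<^sup>2) / 2 ^ k) \<longlonglongrightarrow> 0"
proof -
  define r where "r = norm x + 1"
  have r: "r > 0" by (simp add: r_def add_nonneg_pos)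
  define u where "u = inverse r *\<^sub>R x"
  have u: "u \<in> K" "norm u \<le> 1" using x r by (auto simp: u_def K_closed(4) r_def field_simps)
  have "x = r *\<^sub>R u" using r by (simp add: u_def)
  then have eq: "A ((U ^^ n) x) = r *\<^sub>R A ((U ^^ n) u)" for n
    using pow_scaleC[OF u(1), of n "complex_of_real r"]
    by (simp add: A_scaleR pow_mem u flip: scaleR_scaleC)
  have "(\<lambda>k. r\<^sup>2 * ((\<Sum>n<2^k. (norm (A ((U ^^ n) u)))\<^sup>2) / 2 ^ k)) \<longlonglongrightarrow> r\<^sup>2 * 0"
    by (intro tendsto_intros orbit_average_tendsto_0_unit u)
  then show ?thesis by (simp add: eq power_mult_distrib sum_distrib_left)
qed

end

section \<open>The Hilbert space of square-integrable functions on the circle\<close>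

lemma L2_measurable: "f \<in> L2 \<Longrightarrow> f \<in> borel_measurable borel"
  by (simp add: L2_def measurable_cong_sets[OF sets_m refl])

lemma L2_integrable: "f \<in> L2 \<Longrightarrow> integrable m (\<lambda>z. (cmod (f z))\<^sup>2)"
  by (simp add: L2_def)

lemma L2_I:
  "f \<in> borel_measurable borel \<Longrightarrow> integrable m (\<lambda>z. (cmod (f z))\<^sup>2) \<Longrightarrow> f \<in> L2"
  by (simp add: L2_def measurable_cong_sets[OF sets_m refl])

lemma L2_bounded:
  assumes [measurable]: "f \<in> borel_measurable borel" and "AE z in m. cmod (f z) \<le> C"
  shows "f \<in> L2"
proof (rule L2_I)
  show "integrable m (\<lambda>z. (cmod (f z))\<^sup>2)"
  proof (rule m.integrable_const_bound[of _ "C\<^sup>2"])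
    show "AE z in m. norm ((cmod (f z))\<^sup>2) \<le> C\<^sup>2"
      using assms(2) by eventually_elim (auto intro!: power_mono)
  qed measurable
qed fact

lemma L2_mult_integrable:
  assumes f: "f \<in> L2" and g: "g \<in> L2"
  shows "integrable m (\<lambda>z. f z * cnj (g z))"
proof (rule Bochner_Integration.integrable_bound)
  note [measurable] = L2_measurable[OF f] L2_measurable[OF g]
  show "integrable m (\<lambda>z. (cmod (f z))\<^sup>2 + (cmod (g z))\<^sup>2)"
    by (intro Bochner_Integration.integrable_add L2_integrable f g)
  show "(\<lambda>z. f z * cnj (g z)) \<in> borel_measurable m" by measurable
  have "cmod (f z) * cmod (g z) \<le> (cmod (f z))\<^sup>2 + (cmod (g z))\<^sup>2" for z
    using sum_squares_bound[of "cmod (f z)" "cmod (g z)"]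
      mult_nonneg_nonneg[OF norm_ge_zero[of "f z"] norm_ge_zero[of "g z"]] by linarith
  then show "AE z in m. norm (f z * cnj (g z)) \<le> norm ((cmod (f z))\<^sup>2 + (cmod (g z))\<^sup>2)"
    by (auto simp: norm_mult)
qed

lemma L2_const [simp]: "(\<lambda>_. c) \<in> L2"
  by (rule L2_bounded[where C = "cmod c"]) auto

lemma L2_scale: "f \<in> L2 \<Longrightarrow> (\<lambda>z. c * f z) \<in> L2"
  using L2_measurable[of f] L2_integrable[of f]
  by (intro L2_I) (auto simp: norm_mult power_mult_distrib)

lemma L2_add:
  assumes f: "f \<in> L2" and g: "g \<in> L2"
  shows "(\<lambda>z. f z + g z) \<in> L2"
proof (rule L2_I)
  note [measurable] = L2_measurable[OF f] L2_measurable[OF g]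
  show "(\<lambda>z. f z + g z) \<in> borel_measurable borel" by measurable
  show "integrable m (\<lambda>z. (cmod (f z + g z))\<^sup>2)"
  proof (rule Bochner_Integration.integrable_bound)
    show "integrable m (\<lambda>z. 2 * (cmod (f z))\<^sup>2 + 2 * (cmod (g z))\<^sup>2)"
      by (intro Bochner_Integration.integrable_add integrable_mult_right L2_integrable f g)
    show "(\<lambda>z. (cmod (f z + g z))\<^sup>2) \<in> borel_measurable m" by measurable
    have "(cmod (f z + g z))\<^sup>2 \<le> 2 * (cmod (f z))\<^sup>2 + 2 * (cmod (g z))\<^sup>2" for z
      using parallelogram[of "f z" "g z"] zero_le_power2[of "cmod (f z - g z)"] by linarith
    then show "AE z in m. norm ((cmod (f z + g z))\<^sup>2) \<le> norm (2 * (cmod (f z))\<^sup>2 + 2 * (cmod (g z))\<^sup>2)"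
      by auto
  qed
qed

lemma L2_minus: "f \<in> L2 \<Longrightarrow> (\<lambda>z. - f z) \<in> L2"
  using L2_scale[of f "- 1"] by simp

lemma L2_diff: "f \<in> L2 \<Longrightarrow> g \<in> L2 \<Longrightarrow> (\<lambda>z. f z - g z) \<in> L2"
  using L2_add[of f "\<lambda>z. - g z"] L2_minus[of g] by simp

lemma L2_cnj: "f \<in> L2 \<Longrightarrow> (\<lambda>z. cnj (f z)) \<in> L2"
  using L2_measurable[of f] L2_integrable[of f] by (intro L2_I) auto

lemma l2_inner_cong:
  assumes "f \<in> L2" "f' \<in> L2" "g \<in> L2" "g' \<in> L2"
    and "AE z in m. f z = f' z" "AE z in m. g z = g' z"
  shows "l2_inner f g = l2_inner f' g'"
proof -
  note [measurable] = assms(1-4)[THEN L2_measurable]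
  show ?thesis
    unfolding l2_inner_def
  proof (rule integral_cong_AE)
    show "AE z in m. f z * cnj (g z) = f' z * cnj (g' z)"
      using assms(5,6) by eventually_elim simp
  qed measurable
qed

quotient_type l2 = "complex \<Rightarrow> complex" / partial:
  "\<lambda>f g. f \<in> L2 \<and> g \<in> L2 \<and> (AE z in m. f z = g z)"
  morphisms rep cls
proof (rule part_equivpI)
  show "\<exists>f. f \<in> L2 \<and> f \<in> L2 \<and> (AE z in m. f z = f z)"
    by (intro exI[of _ "\<lambda>_. 0"]) simp
  show "symp (\<lambda>f g. f \<in> L2 \<and> g \<in> L2 \<and> (AE z in m. f z = g z))"
    by (rule sympI) (auto elim: eventually_mono)
  show "transp (\<lambda>f g. f \<in> L2 \<and> g \<in> L2 \<and> (AE z in m. f z = g z))"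
  proof (rule transpI)
    fix f g h :: "complex \<Rightarrow> complex"
    assume *: "f \<in> L2 \<and> g \<in> L2 \<and> (AE z in m. f z = g z)"
      and **: "g \<in> L2 \<and> h \<in> L2 \<and> (AE z in m. g z = h z)"
    have "AE z in m. f z = g z" "AE z in m. g z = h z" using * ** by auto
    then have "AE z in m. f z = h z" by eventually_elim simp
    then show "f \<in> L2 \<and> h \<in> L2 \<and> (AE z in m. f z = h z)" using * ** by simp
  qed
qed

lemma rep_L2 [simp]: "rep x \<in> L2"
  using Quotient3_rep_reflp[OF Quotient3_l2] by blast

lemma cls_rep [simp]: "cls (rep x) = x"
  by (rule Quotient3_abs_rep[OF Quotient3_l2])

lemma cls_eqI: "f \<in> L2 \<Longrightarrow> g \<in> L2 \<Longrightarrow> AE z in m. f z = g z \<Longrightarrow> cls f = cls g"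
  using Quotient3_rel_abs[OF Quotient3_l2] by blast

lemma cls_eqD: "f \<in> L2 \<Longrightarrow> g \<in> L2 \<Longrightarrow> cls f = cls g \<Longrightarrow> AE z in m. f z = g z"
  using Quotient3_rel[OF Quotient3_l2, of f g] by simp

lemma rep_cls: "f \<in> L2 \<Longrightarrow> AE z in m. rep (cls f) z = f z"
  by (rule cls_eqD) auto

lemma l2_cases: obtains f where "f \<in> L2" "x = cls f"
  using rep_L2 cls_rep by metis

instantiation l2 :: real_vector
begin

lift_definition zero_l2 :: l2 is "\<lambda>_. 0" by simp

lift_definition plus_l2 :: "l2 \<Rightarrow> l2 \<Rightarrow> l2" is "\<lambda>f g z. f z + g z"
  by (auto intro: L2_add elim: eventually_elim2)

lift_definition minus_l2 :: "l2 \<Rightarrow> l2 \<Rightarrow> l2" is "\<lambda>f g z. f z - g z"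
  by (auto intro: L2_diff elim: eventually_elim2)

lift_definition uminus_l2 :: "l2 \<Rightarrow> l2" is "\<lambda>f z. - f z"
  by (auto intro: L2_minus)

lift_definition scaleR_l2 :: "real \<Rightarrow> l2 \<Rightarrow> l2" is "\<lambda>r f z. complex_of_real r * f z"
  by (auto intro: L2_scale elim: eventually_mono)

instance
proof
  fix x y z :: l2 and a b :: real
  show "x + y + z = x + (y + z)" by transfer (simp add: L2_add add.assoc)
  show "x + y = y + x" by transfer (simp add: L2_add add.commute)
  show "0 + x = x" by transfer simp
  show "- x + x = 0" by transfer simp
  show "x - y = x + - y" by transfer (simp add: L2_diff)
  show "a *\<^sub>R (x + y) = a *\<^sub>R x + a *\<^sub>R y"
    by transfer (simp add: L2_add L2_scale distrib_left)
  show "(a + b) *\<^sub>R x = a *\<^sub>R x + b *\<^sub>R x"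
    by transfer (simp add: L2_add L2_scale distrib_right)
  show "a *\<^sub>R b *\<^sub>R x = (a * b) *\<^sub>R x"
    by transfer (simp add: L2_scale mult.assoc)
  show "1 *\<^sub>R x = x" by transfer simp
qed

end

lift_definition scl :: "complex \<Rightarrow> l2 \<Rightarrow> l2" is "\<lambda>c f z. c * f z"
  by (auto intro: L2_scale elim: eventually_mono)

lift_definition cinn :: "l2 \<Rightarrow> l2 \<Rightarrow> complex" is l2_inner
  by (auto intro: l2_inner_cong)

lemma cls_add: "f \<in> L2 \<Longrightarrow> g \<in> L2 \<Longrightarrow> cls f + cls g = cls (\<lambda>z. f z + g z)"
  by (rule plus_l2.abs_eq) auto

lemma cls_diff: "f \<in> L2 \<Longrightarrow> g \<in> L2 \<Longrightarrow> cls f - cls g = cls (\<lambda>z. f z - g z)"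
  by (rule minus_l2.abs_eq) auto

lemma cinn_cls: "f \<in> L2 \<Longrightarrow> g \<in> L2 \<Longrightarrow> cinn (cls f) (cls g) = l2_inner f g"
  by (rule cinn.abs_eq) auto

lemma cinn_commute: "cinn x y = cnj (cinn y x)"
proof (cases x rule: l2_cases; cases y rule: l2_cases)
  fix f g assume "f \<in> L2" "x = cls f" "g \<in> L2" "y = cls g"
  then show ?thesis
    by (simp add: cinn_cls l2_inner_def mult.commute flip: Bochner_Integration.integral_cnj)
qed

lemma cinn_add_left: "cinn (x + y) z = cinn x z + cinn y z"
proof (cases x rule: l2_cases; cases y rule: l2_cases; cases z rule: l2_cases)
  fix f g h assume "f \<in> L2" "x = cls f" "g \<in> L2" "y = cls g" "h \<in> L2" "z = cls h"
  then show ?thesis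
    by (simp add: cinn_cls l2_inner_def cls_add L2_add distrib_right L2_mult_integrable)
qed

lemma cls_scl: "f \<in> L2 \<Longrightarrow> scl c (cls f) = cls (\<lambda>z. c * f z)"
  by (rule scl.abs_eq) auto

lemma cinn_scl_left: "cinn (scl c x) y = c * cinn x y"
proof (cases x rule: l2_cases; cases y rule: l2_cases)
  fix f g assume "f \<in> L2" "x = cls f" "g \<in> L2" "y = cls g"
  then show ?thesis by (simp add: cinn_cls l2_inner_def cls_scl L2_scale mult.assoc)
qed

lemma l2_inner_self: "f \<in> L2 \<Longrightarrow> l2_inner f f = complex_of_real (\<integral>z. (cmod (f z))\<^sup>2 \<partial>m)"
  unfolding l2_inner_def complex_norm_square[symmetric] by (rule integral_of_real[OF L2_integrable])

lemma cinn_self_cls: "f \<in> L2 \<Longrightarrow> Re (cinn (cls f) (cls f)) = (\<integral>z. (cmod (f z))\<^sup>2 \<partial>m)"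
  by (simp add: cinn_cls l2_inner_self)

lemma cinn_self_eq_0:
  assumes "Re (cinn x x) = 0"
  shows "x = 0"
proof (cases x rule: l2_cases)
  case (1 f)
  then have "(\<integral>z. (cmod (f z))\<^sup>2 \<partial>m) = 0" using assms by (simp add: cinn_self_cls)
  then have "AE z in m. (cmod (f z))\<^sup>2 = 0"
    using integral_nonneg_eq_0_iff_AE[OF L2_integrable[OF 1(1)]] by simp
  then have "AE z in m. f z = 0" by simp
  then show ?thesis unfolding 1(2) zero_l2_def using 1(1) by (intro cls_eqI) auto
qed

instantiation l2 :: real_inner
begin

definition inner_l2 :: "l2 \<Rightarrow> l2 \<Rightarrow> real" where "inner_l2 x y = Re (cinn x y)"
definition norm_l2 :: "l2 \<Rightarrow> real" where "norm_l2 x = sqrt (inner x x)"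
definition dist_l2 :: "l2 \<Rightarrow> l2 \<Rightarrow> real" where "dist_l2 x y = norm (x - y)"
definition sgn_l2 :: "l2 \<Rightarrow> l2" where "sgn_l2 x = x /\<^sub>R norm x"
definition uniformity_l2 :: "(l2 \<times> l2) filter" where
  "uniformity_l2 = (INF e\<in>{0 <..}. principal {(x, y). dist x y < e})"
definition open_l2 :: "l2 set \<Rightarrow> bool" where
  "open_l2 S = (\<forall>x\<in>S. \<forall>\<^sub>F (x', y) in uniformity. x' = x \<longrightarrow> y \<in> S)"

instance
proof
  fix x y z :: l2 and r :: real and S :: "l2 set"
  show "dist x y = norm (x - y)" by (rule dist_l2_def)
  show "sgn x = x /\<^sub>R norm x" by (rule sgn_l2_def)
  show "uniformity = (INF e\<in>{0 <..}. principal {(x, y::l2). dist x y < e})" by (rule uniformity_l2_def)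
  show "open S = (\<forall>x\<in>S. \<forall>\<^sub>F (x', y) in uniformity. x' = x \<longrightarrow> y \<in> S)" by (rule open_l2_def)
  show "inner x y = inner y x"
    unfolding inner_l2_def by (subst cinn_commute) simp
  show "inner (x + y) z = inner x z + inner y z" by (simp add: inner_l2_def cinn_add_left)
  have "r *\<^sub>R x = scl (complex_of_real r) x" by transfer (simp add: L2_scale)
  then show "inner (r *\<^sub>R x) y = r * inner x y" by (simp add: inner_l2_def cinn_scl_left)
  obtain f where f: "f \<in> L2" "x = cls f" by (rule l2_cases)
  show "0 \<le> inner x x" unfolding inner_l2_def f(2) cinn_self_cls[OF f(1)] by simp
  have "(0::l2) = scl 0 0" by transfer simp
  then have "cinn 0 0 = 0" using cinn_scl_left[of 0 0 0] by simp
  then show "inner x x = 0 \<longleftrightarrow> x = 0" using cinn_self_eq_0 by (auto simp: inner_l2_def)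
  show "norm x = sqrt (inner x x)" by (rule norm_l2_def)
qed

end

lemma norm_cls: "f \<in> L2 \<Longrightarrow> norm (cls f) = l2_norm f"
  by (simp add: norm_l2_def inner_l2_def cinn_self_cls l2_norm_def)

lemma norm_cls_sq: "f \<in> L2 \<Longrightarrow> (norm (cls f))\<^sup>2 = (\<integral>z. (cmod (f z))\<^sup>2 \<partial>m)"
  by (simp add: norm_cls l2_norm_def)

lemma nn_integral_cls:
  assumes "f \<in> L2"
  shows "(\<integral>\<^sup>+z. ennreal ((cmod (f z))\<^sup>2) \<partial>m) = ennreal ((norm (cls f))\<^sup>2)"
  unfolding norm_cls_sq[OF assms]
  by (rule nn_integral_eq_integral) (auto intro: L2_integrable assms)

lemma nn_integral_cmod_le:
  assumes f: "f \<in> L2"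
  shows "(\<integral>\<^sup>+z. ennreal (cmod (f z)) \<partial>m) \<le> ennreal (norm (cls f))"
proof -
  have abs: "(\<lambda>z. complex_of_real (cmod (f z))) \<in> L2"
    using L2_measurable[OF f] L2_integrable[OF f] by (intro L2_I) auto
  have int: "integrable m (\<lambda>z. cmod (f z))"
  proof -
    have "integrable m (\<lambda>z. f z * cnj 1)" by (rule L2_mult_integrable[OF f L2_const])
    then show ?thesis by (simp add: integrable_norm)
  qed
  have "(\<integral>z. cmod (f z) \<partial>m) = inner (cls (\<lambda>z. complex_of_real (cmod (f z)))) (cls (\<lambda>_. 1))"
    using abs by (simp add: inner_l2_def cinn_cls l2_inner_def)
  also have "\<dots> \<le> norm (cls (\<lambda>z. complex_of_real (cmod (f z)))) * norm (cls (\<lambda>_. 1))"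
    by (rule norm_cauchy_schwarz)
  also have "\<dots> = norm (cls f)"
    using abs f by (simp add: norm_cls l2_norm_def m.prob_space[simplified])
  finally show ?thesis
    using int by (subst nn_integral_eq_integral) auto
qed

instance l2 :: complete_space
proof
  fix X :: "nat \<Rightarrow> l2" assume X: "Cauchy X"
  have "\<forall>k. \<exists>N. \<forall>i\<ge>N. \<forall>j\<ge>N. dist (X i) (X j) < (1/2) ^ k"
    using metric_CauchyD[OF X] by (meson half_gt_zero zero_less_one zero_less_power)
  then obtain N where N: "\<And>k i j. i \<ge> N k \<Longrightarrow> j \<ge> N k \<Longrightarrow> dist (X i) (X j) < (1/2) ^ k"
    by metis
  define r where "r k = k + (\<Sum>i\<le>k. N i)" for k
  have r: "strict_mono r" by (rule strict_monoI_Suc) (simp add: r_def)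
  have rN: "N k \<le> r j" if "k \<le> j" for k j
    unfolding r_def using member_le_sum[of k "{..j}" N] that by simp
  define f where "f k = rep (X (r k))" for k
  have fL: "f k \<in> L2" for k by (simp add: f_def)
  have clsf: "cls (f k) = X (r k)" for k by (simp add: f_def)
  note [measurable] = L2_measurable[OF fL]
  have d: "norm (cls (\<lambda>z. f j z - f k z)) < (1/2) ^ k" if "k \<le> j" for j k
    using N[of k "r j" "r k"] rN[OF that] rN[of k k] that
    by (simp add: cls_diff[OF fL fL, symmetric] clsf dist_norm)
  have "(\<integral>\<^sup>+z. (\<Sum>k. ennreal (cmod (f (Suc k) z - f k z))) \<partial>m)
      = (\<Sum>k. \<integral>\<^sup>+z. ennreal (cmod (f (Suc k) z - f k z)) \<partial>m)"
    by (rule nn_integral_suminf) measurable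
  also have "\<dots> \<le> (\<Sum>k. ennreal ((1/2) ^ k))"
  proof (intro suminf_le)
    fix k
    have "(\<integral>\<^sup>+z. ennreal (cmod (f (Suc k) z - f k z)) \<partial>m) \<le> ennreal (norm (cls (\<lambda>z. f (Suc k) z - f k z)))"
      by (rule nn_integral_cmod_le[OF L2_diff[OF fL fL]])
    also have "\<dots> \<le> ennreal ((1/2) ^ k)" using d[of k "Suc k"] by (intro ennreal_leI) simp
    finally show "(\<integral>\<^sup>+z. ennreal (cmod (f (Suc k) z - f k z)) \<partial>m) \<le> ennreal ((1/2) ^ k)" .
  qed auto
  also have "\<dots> = ennreal (\<Sum>k. (1/2) ^ k)"
    by (rule suminf_ennreal2[OF _ summable_geometric]) auto
  also have "\<dots> < \<infinity>" by (simp only: infinity_ennreal_def ennreal_less_top)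
  finally have "AE z in m. (\<Sum>k. ennreal (cmod (f (Suc k) z - f k z))) \<noteq> \<infinity>"
    by (intro nn_integral_noteq_infinite) auto
  then have conv: "AE z in m. (\<lambda>k. f k z) \<longlonglongrightarrow> lim (\<lambda>k. f k z)"
  proof eventually_elim
    fix z assume "(\<Sum>k. ennreal (cmod (f (Suc k) z - f k z))) \<noteq> \<infinity>"
    then have "summable (\<lambda>k. cmod (f (Suc k) z - f k z))"
      by (intro summable_suminf_not_top) auto
    then have "summable (\<lambda>k. f (Suc k) z - f k z)" by (rule summable_norm_cancel)
    then have "convergent (\<lambda>n. \<Sum>k<n. f (Suc k) z - f k z)" by (simp add: summable_iff_convergent)
    then have "convergent (\<lambda>n. (f n z - f 0 z) + f 0 z)"
      unfolding sum_lessThan_telescope[of "\<lambda>k. f k z"] by (rule convergent_add[OF _ convergent_const])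
    then show "(\<lambda>k. f k z) \<longlonglongrightarrow> lim (\<lambda>k. f k z)" by (simp add: convergent_LIMSEQ_iff)
  qed
  define h where "h z = lim (\<lambda>k. f k z)" for z
  have [measurable]: "h \<in> borel_measurable borel"
    unfolding h_def by (rule borel_measurable_lim_metric) measurable
  have tail: "(\<integral>\<^sup>+z. ennreal ((cmod (h z - f k z))\<^sup>2) \<partial>m) \<le> ennreal (((1/2) ^ k)\<^sup>2)" for k
  proof -
    have "(\<integral>\<^sup>+z. ennreal ((cmod (h z - f k z))\<^sup>2) \<partial>m)
        = (\<integral>\<^sup>+z. liminf (\<lambda>j. ennreal ((cmod (f j z - f k z))\<^sup>2)) \<partial>m)"
    proof (rule nn_integral_cong_AE)
      show "AE z in m. ennreal ((cmod (h z - f k z))\<^sup>2) = liminf (\<lambda>j. ennreal ((cmod (f j z - f k z))\<^sup>2))"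
        using conv
      proof eventually_elim
        fix z assume "(\<lambda>k. f k z) \<longlonglongrightarrow> lim (\<lambda>k. f k z)"
        then have "(\<lambda>j. ennreal ((cmod (f j z - f k z))\<^sup>2)) \<longlonglongrightarrow> ennreal ((cmod (h z - f k z))\<^sup>2)"
          unfolding h_def by (intro tendsto_intros)
        then show "ennreal ((cmod (h z - f k z))\<^sup>2) = liminf (\<lambda>j. ennreal ((cmod (f j z - f k z))\<^sup>2))"
          using lim_imp_Liminf[OF sequentially_bot] by metis
      qed
    qed
    also have "\<dots> \<le> liminf (\<lambda>j. \<integral>\<^sup>+z. ennreal ((cmod (f j z - f k z))\<^sup>2) \<partial>m)"
      by (rule nn_integral_liminf) measurable
    also have "\<dots> \<le> ennreal (((1/2) ^ k)\<^sup>2)"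
    proof (rule Liminf_le)
      show "\<forall>\<^sub>F j in sequentially. (\<integral>\<^sup>+z. ennreal ((cmod (f j z - f k z))\<^sup>2) \<partial>m) \<le> ennreal (((1/2) ^ k)\<^sup>2)"
        using eventually_ge_at_top[of k]
      proof eventually_elim
        fix j assume "k \<le> j"
        then show "(\<integral>\<^sup>+z. ennreal ((cmod (f j z - f k z))\<^sup>2) \<partial>m) \<le> ennreal (((1/2) ^ k)\<^sup>2)"
          unfolding nn_integral_cls[OF L2_diff[OF fL fL]]
          using d[of k j] by (intro ennreal_leI power_mono) auto
      qed
    qed simp
    finally show ?thesis .
  qed
  have hf: "(\<lambda>z. h z - f k z) \<in> L2" for k
  proof (rule L2_I)
    show "integrable m (\<lambda>z. (cmod (h z - f k z))\<^sup>2)"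
      using tail[of k] by (intro integrableI_bounded) (auto simp: less_top[symmetric] top_unique)
  qed measurable
  have hL: "h \<in> L2" using L2_add[OF hf[of 0] fL[of 0]] by simp
  have "dist (X (r k)) (cls h) \<le> (1/2) ^ k" for k
  proof -
    have "ennreal ((norm (cls (\<lambda>z. h z - f k z)))\<^sup>2) \<le> ennreal (((1/2) ^ k)\<^sup>2)"
      using tail[of k] nn_integral_cls[OF hf] by simp
    then have "(norm (cls (\<lambda>z. h z - f k z)))\<^sup>2 \<le> ((1/2) ^ k)\<^sup>2"
      by (subst (asm) ennreal_le_iff) simp_all
    then have "norm (cls (\<lambda>z. h z - f k z)) \<le> (1/2) ^ k"
      by (rule power2_le_imp_le) simp
    moreover have "dist (X (r k)) (cls h) = norm (cls h - cls (f k))"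
      unfolding clsf dist_norm by (rule norm_minus_commute)
    ultimately show ?thesis by (simp only: cls_diff[OF hL fL])
  qed
  then have "(\<lambda>k. dist (X (r k)) (cls h)) \<longlonglongrightarrow> 0"
    by (intro tendsto_sandwich[OF always_eventually always_eventually tendsto_const
          LIMSEQ_power_zero[of "1/2::real"]] allI) (simp_all only: zero_le_dist, simp)
  then have "(X \<circ> r) \<longlonglongrightarrow> cls h" by (simp add: tendsto_dist_iff[of _ "cls h"] o_def)
  then show "convergent X"
    using Cauchy_converges_subseq[OF X r] by (auto simp: convergent_def)
qed

instantiation l2 :: complex_hilbert
begin

definition scaleC_l2 :: "complex \<Rightarrow> l2 \<Rightarrow> l2" where "scaleC_l2 = scl"
definition cinner_l2 :: "l2 \<Rightarrow> l2 \<Rightarrow> complex" where "cinner_l2 = cinn"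

instance
proof
  fix x y z :: l2 and c d :: complex and r :: real
  show "c *\<^sub>C (x + y) = c *\<^sub>C x + c *\<^sub>C y"
    unfolding scaleC_l2_def by transfer (simp add: L2_add L2_scale distrib_left)
  show "(c + d) *\<^sub>C x = c *\<^sub>C x + d *\<^sub>C x"
    unfolding scaleC_l2_def by transfer (simp add: L2_add L2_scale distrib_right)
  show "c *\<^sub>C d *\<^sub>C x = (c * d) *\<^sub>C x"
    unfolding scaleC_l2_def by transfer (simp add: L2_scale mult.assoc)
  show "r *\<^sub>R x = complex_of_real r *\<^sub>C x"
    unfolding scaleC_l2_def by transfer (simp add: L2_scale)
  show "cinner x y = cnj (cinner y x)" unfolding cinner_l2_def by (rule cinn_commute)
  show "cinner (x + y) z = cinner x z + cinner y z" unfolding cinner_l2_def by (rule cinn_add_left)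
  show "cinner (c *\<^sub>C x) y = c * cinner x y"
    unfolding cinner_l2_def scaleC_l2_def by (rule cinn_scl_left)
  show "inner x y = Re (cinner x y)" unfolding cinner_l2_def by (rule inner_l2_def)
qed

end

lemma cinner_cls: "f \<in> L2 \<Longrightarrow> g \<in> L2 \<Longrightarrow> cinner (cls f) (cls g) = l2_inner f g"
  unfolding cinner_l2_def by (rule cinn_cls)

lemma scaleC_cls: "f \<in> L2 \<Longrightarrow> c *\<^sub>C cls f = cls (\<lambda>z. c * f z)"
  unfolding scaleC_l2_def by (rule cls_scl)

subsection \<open>Multiplication by unimodular functions\<close>

definition unimodular :: "(complex \<Rightarrow> complex) \<Rightarrow> bool" where
  "unimodular u \<longleftrightarrow> u \<in> borel_measurable borel \<and> (AE z in m. cmod (u z) = 1)"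

definition mulu :: "(complex \<Rightarrow> complex) \<Rightarrow> l2 \<Rightarrow> l2" where
  "mulu u x = cls (\<lambda>z. u z * rep x z)"

lemma unimodular_measurable: "unimodular u \<Longrightarrow> u \<in> borel_measurable borel"
  by (simp add: unimodular_def)

lemma unimodular_cnj: "unimodular u \<Longrightarrow> unimodular (\<lambda>z. cnj (u z))"
  by (auto simp: unimodular_def)

lemma unimodular_mult: "unimodular u \<Longrightarrow> unimodular v \<Longrightarrow> unimodular (\<lambda>z. u z * v z)"
  by (auto simp: unimodular_def norm_mult elim: eventually_elim2)

lemma unimodular_powi: "unimodular (\<lambda>z. z powi n)"
  using AE_cmod_powi by (simp add: unimodular_def)

lemma unimodular_L2: "unimodular u \<Longrightarrow> u \<in> L2"
  by (rule L2_bounded[where C = 1]) (auto simp: unimodular_def elim: eventually_mono)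

lemma L2_mult_unimodular:
  assumes u: "unimodular u" and f: "f \<in> L2"
  shows "(\<lambda>z. u z * f z) \<in> L2"
proof (rule L2_I)
  note [measurable] = unimodular_measurable[OF u] L2_measurable[OF f]
  show "(\<lambda>z. u z * f z) \<in> borel_measurable borel" by measurable
  have "AE z in m. cmod (u z) = 1" using u by (simp add: unimodular_def)
  then have "AE z in m. (cmod (f z))\<^sup>2 = (cmod (u z * f z))\<^sup>2"
    by eventually_elim (simp add: norm_mult)
  then show "integrable m (\<lambda>z. (cmod (u z * f z))\<^sup>2)"
    by (rule integrable_cong_AE_imp[OF L2_integrable[OF f], rotated]) measurable
qed

lemma mulu_cls:
  assumes u: "unimodular u" and f: "f \<in> L2"
  shows "mulu u (cls f) = cls (\<lambda>z. u z * f z)"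
  unfolding mulu_def
proof (rule cls_eqI)
  show "AE z in m. u z * rep (cls f) z = u z * f z"
    using rep_cls[OF f] by eventually_elim simp
qed (simp_all add: L2_mult_unimodular u f)

lemma mulu_add: "unimodular u \<Longrightarrow> mulu u (x + y) = mulu u x + mulu u y"
  by (cases x rule: l2_cases; cases y rule: l2_cases)
     (simp add: mulu_cls cls_add L2_add L2_mult_unimodular distrib_left)

lemma mulu_scaleC: "unimodular u \<Longrightarrow> mulu u (c *\<^sub>C x) = c *\<^sub>C mulu u x"
  by (cases x rule: l2_cases)
     (simp add: mulu_cls scaleC_cls L2_scale L2_mult_unimodular mult.left_commute)

lemma mulu_diff: "unimodular u \<Longrightarrow> mulu u (x - y) = mulu u x - mulu u y"
  by (cases x rule: l2_cases; cases y rule: l2_cases)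
     (simp add: mulu_cls cls_diff L2_diff L2_mult_unimodular right_diff_distrib)

lemma mulu_mulu: "unimodular u \<Longrightarrow> unimodular v \<Longrightarrow> mulu u (mulu v x) = mulu (\<lambda>z. u z * v z) x"
  by (cases x rule: l2_cases)
     (simp add: mulu_cls L2_mult_unimodular unimodular_mult mult.assoc)

lemma mulu_commute: "unimodular u \<Longrightarrow> unimodular v \<Longrightarrow> mulu u (mulu v x) = mulu v (mulu u x)"
  by (simp add: mulu_mulu mult.commute)

lemma mulu_cong:
  assumes "unimodular u" "unimodular v" "AE z in m. u z = v z"
  shows "mulu u x = mulu v x"
  unfolding mulu_def
  by (rule cls_eqI) (use assms in \<open>auto intro!: L2_mult_unimodular elim: eventually_mono\<close>)

lemma cmod_eq_1_mult_cnj: "cmod c = 1 \<Longrightarrow> c * cnj c = 1" "cmod c = 1 \<Longrightarrow> cnj c * c = 1"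
  by (simp_all add: complex_norm_square[symmetric] mult.commute[of "cnj c"])

lemma cinner_mulu:
  assumes u: "unimodular u"
  shows "cinner (mulu u x) (mulu u y) = cinner x y"
proof (cases x rule: l2_cases; cases y rule: l2_cases)
  fix f g assume f: "f \<in> L2" "x = cls f" and g: "g \<in> L2" "y = cls g"
  note [measurable] = unimodular_measurable[OF u] L2_measurable[OF f(1)] L2_measurable[OF g(1)]
  have "l2_inner (\<lambda>z. u z * f z) (\<lambda>z. u z * g z) = l2_inner f g"
    unfolding l2_inner_def
  proof (rule integral_cong_AE)
    have "AE z in m. cmod (u z) = 1" using u by (simp add: unimodular_def)
    then show "AE z in m. u z * f z * cnj (u z * g z) = f z * cnj (g z)"
    proof eventually_elim
      fix z assume z: "cmod (u z) = 1"
      have "u z * f z * cnj (u z * g z) = (u z * cnj (u z)) * (f z * cnj (g z))" by simp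
      then show "u z * f z * cnj (u z * g z) = f z * cnj (g z)"
        by (simp only: cmod_eq_1_mult_cnj[OF z] mult_1_left)
    qed
  qed measurable
  then show ?thesis using f g u by (simp add: mulu_cls cinner_cls L2_mult_unimodular)
qed

lemma mulu_cnj_mulu:
  assumes u: "unimodular u"
  shows "mulu (\<lambda>z. cnj (u z)) (mulu u x) = x" "mulu u (mulu (\<lambda>z. cnj (u z)) x) = x"
proof -
  have 1: "AE z in m. cmod (u z) = 1" using u by (simp add: unimodular_def)
  have one: "mulu (\<lambda>_. 1) x = x" by (simp add: mulu_def)
  have o: "unimodular (\<lambda>_. 1)" by (simp add: unimodular_def)
  show "mulu (\<lambda>z. cnj (u z)) (mulu u x) = x"
    unfolding mulu_mulu[OF unimodular_cnj[OF u] u]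
    by (subst mulu_cong[OF _ o]) (use 1 in \<open>auto intro!: unimodular_mult unimodular_cnj u simp: one cmod_eq_1_mult_cnj elim: eventually_mono\<close>)
  then show "mulu u (mulu (\<lambda>z. cnj (u z)) x) = x"
    by (simp add: mulu_commute u unimodular_cnj)
qed

lemma cinner_mulu_left:
  assumes u: "unimodular u"
  shows "cinner (mulu u x) y = cinner x (mulu (\<lambda>z. cnj (u z)) y)"
  using cinner_mulu[OF u, of x "mulu (\<lambda>z. cnj (u z)) y"] by (simp add: mulu_cnj_mulu u)

definition shift :: "int \<Rightarrow> l2 \<Rightarrow> l2" where
  "shift n = mulu (\<lambda>z. z powi n)"

definition fexp :: "int \<Rightarrow> l2" where
  "fexp n = cls (\<lambda>z. z powi n)"

lemma AE_neq_0: "AE z in m. z \<noteq> 0"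
  using AE_cmod_eq_1 by eventually_elim auto

lemma shift_shift: "shift i (shift j x) = shift (i + j) x"
  unfolding shift_def mulu_mulu[OF unimodular_powi unimodular_powi]
  by (rule mulu_cong)
     (use AE_neq_0 in \<open>auto intro!: unimodular_powi unimodular_mult simp: power_int_add elim: eventually_mono\<close>)

lemma shift_0 [simp]: "shift 0 x = x"
  by (simp add: shift_def mulu_def)

lemma cinner_shift_shift: "cinner (shift n x) (shift n y) = cinner x y"
  unfolding shift_def by (rule cinner_mulu[OF unimodular_powi])

lemma cinner_shift: "cinner (shift n x) y = cinner x (shift (- n) y)"
  using cinner_shift_shift[of n x "shift (- n) y"] by (simp add: shift_shift)

lemma shift_add: "shift n (x + y) = shift n x + shift n y"
  and shift_diff: "shift n (x - y) = shift n x - shift n y"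
  and shift_scaleC: "shift n (c *\<^sub>C x) = c *\<^sub>C shift n x"
  by (simp_all add: shift_def mulu_add mulu_diff mulu_scaleC unimodular_powi)

lemma shift_mulu: "unimodular u \<Longrightarrow> shift n (mulu u x) = mulu u (shift n x)"
  unfolding shift_def by (rule mulu_commute[OF unimodular_powi])

lemma powi_L2 [simp]: "(\<lambda>z. z powi n) \<in> L2"
  by (rule unimodular_L2[OF unimodular_powi])

lemma shift_fexp: "shift i (fexp j) = fexp (i + j)"
  unfolding shift_def fexp_def mulu_cls[OF unimodular_powi powi_L2]
  by (rule cls_eqI)
     (use AE_neq_0 in \<open>auto intro!: L2_mult_unimodular unimodular_powi simp: power_int_add elim: eventually_mono\<close>)

lemma cinner_fexp: "cinner (fexp i) (fexp j) = (if i = j then 1 else 0)"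
  using has_bochner_integral_powi[of i j 0]
  by (simp add: fexp_def cinner_cls l2_inner_def has_bochner_integral_iff)

lemma fc_eq: "f \<in> L2 \<Longrightarrow> fc f n = cinner (cls f) (fexp n)"
  by (simp add: fexp_def cinner_cls l2_inner_def fc_def)

subsection \<open>Uniqueness of Fourier coefficients\<close>

text \<open>The quantification over \<open>q\<close> is what carries the induction through products.\<close>

lemma integral_polynomial_eq_0:
  assumes "real_polynomial_function p"
  shows "integrable m q \<Longrightarrow> (\<And>n. (\<integral>z. q z * z powi n \<partial>m) = 0) \<Longrightarrow>
    integrable m (\<lambda>z. q z * complex_of_real (p z)) \<and> (\<forall>n. (\<integral>z. q z * complex_of_real (p z) * z powi n \<partial>m) = 0)"
  using assms
proof (induction p arbitrary: q rule: real_polynomial_function.induct)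
  case (linear f)
  define c where "c = (complex_of_real (f 1) - \<i> * complex_of_real (f \<i>)) / 2"
  have f_eq: "complex_of_real (f z) = c * z powi 1 + cnj c * z powi (-1)" if z: "cmod z = 1" for z
  proof -
    have "f z = f (Re z *\<^sub>R 1 + Im z *\<^sub>R \<i>)" by (rule arg_cong[of _ _ f]) (simp add: complex_eq_iff)
    also have "\<dots> = Re z * f 1 + Im z * f \<i>"
      using linear by (simp add: bounded_linear.linear linear_add linear_scale)
    finally have 1: "f z = Re z * f 1 + Im z * f \<i>" .
    have "inverse z = cnj z"
      using cmod_eq_1_mult_cnj(1)[OF z] by (metis inverse_unique)
    then have "z powi (- 1) = cnj z" by (simp add: power_int_minus)
    then show ?thesis
      unfolding complex_eq_iff by (simp add: 1 c_def flip: add_divide_distrib)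
  qed
  have q: "integrable m (\<lambda>z. q z * z powi n)" for n
  proof (rule Bochner_Integration.integrable_bound[OF linear.prems(1)])
    have [measurable]: "q \<in> borel_measurable m" using linear.prems(1) by (rule borel_measurable_integrable)
    show "(\<lambda>z. q z * z powi n) \<in> borel_measurable m" by measurable
    show "AE z in m. norm (q z * z powi n) \<le> norm (q z)"
      using AE_cmod_powi[of n] by eventually_elim (simp add: norm_mult)
  qed
  have meas: "(\<lambda>z. complex_of_real (f z)) \<in> borel_measurable m"
    unfolding measurable_cong_sets[OF sets_m refl]
    by (intro borel_measurable_continuous_onI continuous_intros linear_continuous_on linear.hyps)
  have AE1: "AE z in m. q z * complex_of_real (f z) = c * (q z * z powi 1) + cnj c * (q z * z powi (-1))"
    using AE_cmod_eq_1 by eventually_elim (simp add: f_eq algebra_simps)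
  have AE2: "AE z in m. q z * complex_of_real (f z) * z powi n
      = c * (q z * z powi (n + 1)) + cnj c * (q z * z powi (n - 1))" for n
    using AE_cmod_eq_1
  proof eventually_elim
    fix z assume z: "cmod z = 1"
    then have "z \<noteq> 0" by auto
    then have "z powi (n + 1) = z powi 1 * z powi n" "z powi (n - 1) = z powi (-1) * z powi n"
      by (simp_all add: power_int_add power_int_diff divide_inverse mult.commute)
    then show "q z * complex_of_real (f z) * z powi n
      = c * (q z * z powi (n + 1)) + cnj c * (q z * z powi (n - 1))"
      by (simp only: f_eq[OF z]) (simp only: algebra_simps)
  qed
  have mq [measurable]: "q \<in> borel_measurable m" using linear.prems(1) by (rule borel_measurable_integrable)
  note [measurable] = meas
  have "integrable m (\<lambda>z. q z * complex_of_real (f z))"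
    by (rule integrable_cong_AE_imp[of _ "\<lambda>z. c * (q z * z powi 1) + cnj c * (q z * z powi (-1))"])
       (use q[of 1] q[of "- 1"] AE1 in \<open>auto elim: eventually_mono\<close>)
  moreover have "(\<integral>z. q z * complex_of_real (f z) * z powi n \<partial>m) = 0" for n
  proof -
    have "(\<integral>z. q z * complex_of_real (f z) * z powi n \<partial>m)
        = (\<integral>z. c * (q z * z powi (n + 1)) + cnj c * (q z * z powi (n - 1)) \<partial>m)"
      by (rule integral_cong_AE[OF _ _ AE2]) measurable
    also have "\<dots> = 0" using q linear.prems(2) by simp
    finally show ?thesis .
  qed
  ultimately show ?case by blast
next
  case (const c)
  then show ?case by (auto simp: mult.assoc mult.left_commute[of _ "complex_of_real c"])
next
  case (add f g)
  have f: "integrable m (\<lambda>z. q z * complex_of_real (f z))"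
      "\<And>n. (\<integral>z. q z * complex_of_real (f z) * z powi n \<partial>m) = 0"
    and g: "integrable m (\<lambda>z. q z * complex_of_real (g z))"
      "\<And>n. (\<integral>z. q z * complex_of_real (g z) * z powi n \<partial>m) = 0"
    using add.IH add.prems by auto
  have pw: "integrable m (\<lambda>z. h z * z powi n)" if "integrable m h" for h n
  proof (rule Bochner_Integration.integrable_bound[OF that])
    have [measurable]: "h \<in> borel_measurable m" using that by (rule borel_measurable_integrable)
    show "(\<lambda>z. h z * z powi n) \<in> borel_measurable m" by measurable
    show "AE z in m. norm (h z * z powi n) \<le> norm (h z)"
      using AE_cmod_powi[of n] by eventually_elim (simp add: norm_mult)
  qed
  show ?case
    using f g pw[OF f(1)] pw[OF g(1)] by (simp add: distrib_left distrib_right)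
next
  case (mult f g)
  have f: "integrable m (\<lambda>z. q z * complex_of_real (f z))"
      "\<And>n. (\<integral>z. q z * complex_of_real (f z) * z powi n \<partial>m) = 0"
    using mult.IH(1) mult.prems by auto
  show ?case using mult.IH(2)[OF f] by (simp add: mult.assoc)
qed

lemma integral_continuous_eq_0:
  fixes \<phi> :: "complex \<Rightarrow> real"
  assumes q: "integrable m q" "\<And>n. (\<integral>z. q z * z powi n \<partial>m) = 0"
    and cont: "continuous_on UNIV \<phi>"
  shows "(\<integral>z. q z * complex_of_real (\<phi> z) \<partial>m) = 0"
proof -
  have [measurable]: "q \<in> borel_measurable m" using q(1) by (rule borel_measurable_integrable)
  have [measurable]: "\<phi> \<in> borel_measurable m"
    unfolding measurable_cong_sets[OF sets_m refl] by (rule borel_measurable_continuous_onI[OF cont])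
  define C where "C = (\<integral>z. cmod (q z) \<partial>m)"
  have C: "0 \<le> C" by (simp add: C_def)
  have le: "cmod (\<integral>z. q z * complex_of_real (\<phi> z) \<partial>m) \<le> e * C" if e: "e > 0" for e
  proof -
    obtain p where p: "real_polynomial_function p" "\<And>z. z \<in> sphere 0 1 \<Longrightarrow> \<bar>\<phi> z - p z\<bar> < e"
      using Stone_Weierstrass_real_polynomial_function[OF compact_sphere continuous_on_subset[OF cont] e]
      by (metis subset_UNIV)
    have P: "integrable m (\<lambda>z. q z * complex_of_real (p z))" "(\<integral>z. q z * complex_of_real (p z) * z powi 0 \<partial>m) = 0"
      using integral_polynomial_eq_0[OF p(1) q] by blast+
    have bnd: "AE z in m. cmod (q z * complex_of_real (\<phi> z - p z)) \<le> e * cmod (q z)"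
      using AE_cmod_eq_1
    proof eventually_elim
      fix z :: complex assume "cmod z = 1"
      then have "\<bar>\<phi> z - p z\<bar> \<le> e" using p(2)[of z] by simp
      then show "cmod (q z * complex_of_real (\<phi> z - p z)) \<le> e * cmod (q z)"
        using mult_right_mono[of "\<bar>\<phi> z - p z\<bar>" e "cmod (q z)"]
        by (simp add: norm_mult mult.commute del: of_real_diff)
    qed
    have [measurable]: "p \<in> borel_measurable m"
      unfolding measurable_cong_sets[OF sets_m refl]
      using p(1) by (intro borel_measurable_continuous_onI continuous_on_polymonial_function)
        (simp add: real_polynomial_function_eq)
    have int: "integrable m (\<lambda>z. q z * complex_of_real (\<phi> z - p z))"
    proof (rule Bochner_Integration.integrable_bound)
      show "integrable m (\<lambda>z. e * cmod (q z))" using q(1) by simp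
      show "AE z in m. norm (q z * complex_of_real (\<phi> z - p z)) \<le> norm (e * cmod (q z))"
        using bnd e by (auto elim: eventually_mono)
    qed measurable
    have "(\<integral>z. q z * complex_of_real (\<phi> z) \<partial>m)
        = (\<integral>z. q z * complex_of_real (\<phi> z - p z) + q z * complex_of_real (p z) \<partial>m)"
      by (simp add: algebra_simps)
    also have "\<dots> = (\<integral>z. q z * complex_of_real (\<phi> z - p z) \<partial>m)"
      using Bochner_Integration.integral_add[OF int P(1)] P(2) by simp
    finally have "cmod (\<integral>z. q z * complex_of_real (\<phi> z) \<partial>m) = cmod (\<integral>z. q z * complex_of_real (\<phi> z - p z) \<partial>m)"
      by simp
    also have "\<dots> \<le> (\<integral>z. cmod (q z * complex_of_real (\<phi> z - p z)) \<partial>m)"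
      by (rule Bochner_Integration.integral_norm_bound)
    also have "\<dots> \<le> (\<integral>z. e * cmod (q z) \<partial>m)"
      by (rule integral_mono_AE[OF integrable_norm[OF int] _ bnd]) (use q in simp)
    finally show ?thesis by (simp add: C_def)
  qed
  have "cmod (\<integral>z. q z * complex_of_real (\<phi> z) \<partial>m) \<le> 0"
  proof (rule field_le_epsilon)
    fix e :: real assume e: "0 < e"
    have "cmod (\<integral>z. q z * complex_of_real (\<phi> z) \<partial>m) \<le> e / (C + 1) * C"
      using le[of "e / (C + 1)"] e C by simp
    also have "\<dots> \<le> e" using e C by (simp add: field_simps)
    finally show "cmod (\<integral>z. q z * complex_of_real (\<phi> z) \<partial>m) \<le> 0 + e" by simp
  qed
  then show ?thesis by simp
qed

lemma integral_indicator_eq_0: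
  assumes q: "integrable m q" "\<And>n. (\<integral>z. q z * z powi n \<partial>m) = 0"
    and A: "A \<in> sets borel"
  shows "(\<integral>z. indicator A z *\<^sub>R q z \<partial>m) = 0"
proof -
  have [measurable]: "q \<in> borel_measurable m" using q(1) by (rule borel_measurable_integrable)
  have int: "integrable m (\<lambda>z. indicator B z *\<^sub>R q z)" if "B \<in> sets borel" for B
    using integrable_mult_indicator[of B m q] that q(1) by simp
  have all: "(\<integral>z. q z \<partial>m) = 0" using q(2)[of 0] by simp
  have cl: "(\<integral>z. indicator B z *\<^sub>R q z \<partial>m) = 0" if B: "closed B" for B
  proof (cases "B = {}")
    case False
    define \<phi> where "\<phi> k z = max 0 (1 - real k * infdist z B)" for k z
    have c: "continuous_on UNIV (\<phi> k)" for k unfolding \<phi>_def by (intro continuous_intros)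
    have [measurable]: "\<phi> k \<in> borel_measurable m" for k
      unfolding measurable_cong_sets[OF sets_m refl] by (rule borel_measurable_continuous_onI[OF c])
    have [measurable]: "B \<in> sets m" using B by simp
    have "(\<lambda>k. \<integral>z. q z * complex_of_real (\<phi> k z) \<partial>m) \<longlonglongrightarrow> (\<integral>z. indicator B z *\<^sub>R q z \<partial>m)"
    proof (rule integral_dominated_convergence[where w = "\<lambda>z. cmod (q z)"])
      show "AE z in m. (\<lambda>k. q z * complex_of_real (\<phi> k z)) \<longlonglongrightarrow> indicator B z *\<^sub>R q z"
      proof (rule AE_I2)
        fix z
        have "(\<lambda>k. \<phi> k z) \<longlonglongrightarrow> indicator B z"
        proof (cases "z \<in> B")
          case True
          then have "infdist z B = 0" by simp
          then show ?thesis using True by (simp add: \<phi>_def)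
        next
          case z: False
          then have pos: "infdist z B > 0"
            using infdist_pos_not_in_closed[OF B False] by simp
          obtain k0 :: nat where k0: "1 / infdist z B < real k0" using reals_Archimedean2 by blast
          have "\<phi> k z = 0" if "k \<ge> k0" for k
          proof -
            have "1 / infdist z B < real k" using k0 that by linarith
            then have "1 < real k * infdist z B" using pos by (simp add: field_simps)
            then show ?thesis by (simp add: \<phi>_def)
          qed
          then have "eventually (\<lambda>k. \<phi> k z = 0) sequentially"
            unfolding eventually_sequentially by blast
          then show ?thesis using z by (simp add: tendsto_eventually)
        qed
        then have "(\<lambda>k. q z * complex_of_real (\<phi> k z)) \<longlonglongrightarrow> q z * complex_of_real (indicator B z)"
          by (intro tendsto_intros)
        then show "(\<lambda>k. q z * complex_of_real (\<phi> k z)) \<longlonglongrightarrow> indicator B z *\<^sub>R q z"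
          by (simp add: scaleR_conv_of_real mult.commute)
      qed
      show "AE z in m. norm (q z * complex_of_real (\<phi> k z)) \<le> cmod (q z)" for k
      proof (rule AE_I2)
        fix z
        have "\<bar>\<phi> k z\<bar> \<le> 1" by (simp add: \<phi>_def infdist_nonneg)
        then show "norm (q z * complex_of_real (\<phi> k z)) \<le> cmod (q z)"
          using mult_left_mono[of "\<bar>\<phi> k z\<bar>" 1 "cmod (q z)"] by (simp add: norm_mult)
      qed
    qed (use q(1) in auto)
    moreover have "(\<integral>z. q z * complex_of_real (\<phi> k z) \<partial>m) = 0" for k
      by (rule integral_continuous_eq_0[OF q c])
    ultimately show ?thesis using LIMSEQ_unique[OF _ tendsto_const[of 0]] by simp
  qed simp
  have "Int_stable (Collect closed :: complex set set)" by (auto simp: Int_stable_def)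
  moreover have "Collect closed \<subseteq> Pow (UNIV :: complex set)" by simp
  moreover have "A \<in> sigma_sets UNIV (Collect closed)"
    using A by (simp add: borel_eq_closed sets_measure_of)
  ultimately show ?thesis
  proof (induction rule: sigma_sets_induct_disjoint)
    case (basic B)
    then show ?case using cl by simp
  next
    case empty
    show ?case by simp
  next
    case (compl B)
    have "B \<in> sets borel" using compl.hyps by (simp add: borel_eq_closed sets_measure_of)
    have "(\<integral>z. indicator (UNIV - B) z *\<^sub>R q z \<partial>m) = (\<integral>z. q z - indicator B z *\<^sub>R q z \<partial>m)"
      by (intro Bochner_Integration.integral_cong) (auto simp: indicator_def)
    also have "\<dots> = 0" using int[OF \<open>B \<in> sets borel\<close>] q(1) all compl.IH by simp
    finally show ?case .
  next
    case (union B)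
    have Bm: "B i \<in> sets m" for i using union.hyps by (auto simp: borel_eq_closed sets_measure_of)
    have "(\<integral>z. indicator (\<Union>i. B i) z *\<^sub>R q z \<partial>m) = (\<Sum>i. \<integral>z. indicator (B i) z *\<^sub>R q z \<partial>m)"
      using lebesgue_integral_countable_add[of B m q, OF Bm _ ] union.hyps int[of "\<Union>i. B i"] Bm
      unfolding set_lebesgue_integral_def set_integrable_def disjoint_family_on_def by auto
    then show ?case by (simp add: union.IH)
  qed
qed

lemma AE_eq_0_if_integrals_eq_0:
  fixes h :: "complex \<Rightarrow> real"
  assumes h: "integrable m h" and 0: "\<And>A. A \<in> sets borel \<Longrightarrow> (\<integral>z. indicator A z *\<^sub>R h z \<partial>m) = 0"
  shows "AE z in m. h z = 0"
proof -
  have le: "AE z in m. g z \<le> 0"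
    if g: "integrable m g" and 0: "\<And>A. A \<in> sets borel \<Longrightarrow> (\<integral>z. indicator A z *\<^sub>R g z \<partial>m) = 0"
    for g :: "complex \<Rightarrow> real"
  proof -
    have [measurable]: "g \<in> borel_measurable borel"
      using borel_measurable_integrable[OF g] by (simp add: measurable_cong_sets[OF sets_m refl])
    define A where "A = {z. g z > 0}"
    have A: "A \<in> sets borel" unfolding A_def by measurable
    have "AE z in m. indicator A z *\<^sub>R g z = 0"
    proof (subst integral_nonneg_eq_0_iff_AE[symmetric])
      show "integrable m (\<lambda>z. indicator A z *\<^sub>R g z)"
        using integrable_mult_indicator[of A m g] A g by simp
    qed (use 0[OF A] in \<open>auto simp: A_def indicator_def\<close>)
    then show ?thesis by eventually_elim (auto simp: A_def indicator_def not_less split: if_splits)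
  qed
  have "AE z in m. h z \<le> 0" by (rule le[OF h 0])
  moreover have "AE z in m. - h z \<le> 0" by (rule le) (use h 0 in auto)
  ultimately show ?thesis by eventually_elim auto
qed

lemma Fourier_unique:
  assumes "\<And>n. cinner x (fexp n) = 0"
  shows "x = 0"
proof (cases x rule: l2_cases)
  case (1 f)
  have q: "integrable m f"
    using L2_mult_integrable[OF 1(1) L2_const[of 1]] by simp
  have "(\<integral>z. f z * z powi n \<partial>m) = 0" for n
  proof -
    have [measurable]: "f \<in> borel_measurable borel" by (rule L2_measurable[OF 1(1)])
    have "(\<integral>z. f z * z powi n \<partial>m) = (\<integral>z. f z * cnj (z powi (- n)) \<partial>m)"
    proof (rule integral_cong_AE)
      show "AE z in m. f z * z powi n = f z * cnj (z powi (- n))"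
        using AE_cmod_eq_1
      proof eventually_elim
        fix z :: complex assume z: "cmod z = 1"
        have "inverse (cnj z) = z"
          using cmod_eq_1_mult_cnj(2)[OF z] by (metis inverse_unique)
        then show "f z * z powi n = f z * cnj (z powi (- n))"
          by (simp add: power_int_minus flip: power_int_inverse)
      qed
    qed measurable
    then show ?thesis
      using assms[of "- n"] by (simp add: 1 fexp_def cinner_cls l2_inner_def)
  qed
  note 0 = integral_indicator_eq_0[OF q this]
  have "AE z in m. Re (f z) = 0"
  proof (rule AE_eq_0_if_integrals_eq_0)
    fix A :: "complex set" assume A: "A \<in> sets borel"
    have "integrable m (\<lambda>z. indicator A z *\<^sub>R f z)"
      using integrable_mult_indicator[of A m f] A q by simp
    from integral_Re[OF this] show "(\<integral>z. indicator A z *\<^sub>R Re (f z) \<partial>m) = 0"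
      using 0[OF A] by simp
  qed (use q in auto)
  moreover have "AE z in m. Im (f z) = 0"
  proof (rule AE_eq_0_if_integrals_eq_0)
    fix A :: "complex set" assume A: "A \<in> sets borel"
    have "integrable m (\<lambda>z. indicator A z *\<^sub>R f z)"
      using integrable_mult_indicator[of A m f] A q by simp
    from integral_Im[OF this] show "(\<integral>z. indicator A z *\<^sub>R Im (f z) \<partial>m) = 0"
      using 0[OF A] by simp
  qed (use q in auto)
  ultimately have "AE z in m. f z = 0" by eventually_elim (simp add: complex_eq_iff)
  then show ?thesis unfolding 1(2) zero_l2_def using 1(1) by (intro cls_eqI) auto
qed

section \<open>Model spaces\<close>

definition H2s :: "l2 set" where
  "H2s = {x. \<forall>n<0. cinner x (fexp n) = 0}"

definition model :: "(complex \<Rightarrow> complex) \<Rightarrow> l2 set" where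
  "model \<theta> = {x \<in> H2s. \<forall>h\<in>H2s. cinner x (mulu \<theta> h) = 0}"

lemma H2_iff: "f \<in> L2 \<Longrightarrow> f \<in> H2 \<longleftrightarrow> cls f \<in> H2s"
  by (simp add: H2_def H2s_def fc_eq)

lemma H2_L2: "f \<in> H2 \<Longrightarrow> f \<in> L2"
  by (simp add: H2_def)

lemma fexp_mem_H2s: "n \<ge> 0 \<Longrightarrow> fexp n \<in> H2s"
  by (simp add: H2s_def cinner_fexp)

lemma csubspace_H2s: "csubspace H2s"
proof -
  have *: "H2s = {x. \<forall>h\<in>fexp ` {..<0}. cinner x h = 0}" by (auto simp: H2s_def)
  show ?thesis unfolding * by (rule csubspace_orthogonal)
qed

lemma shift_mem_H2s: "x \<in> H2s \<Longrightarrow> n \<ge> 0 \<Longrightarrow> shift n x \<in> H2s"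
  by (auto simp: H2s_def cinner_shift shift_fexp)

lemma H2s_orthogonal:
  assumes x: "\<And>n. n \<ge> 0 \<Longrightarrow> cinner x (fexp n) = 0" and h: "h \<in> H2s"
  shows "cinner h x = 0"
proof -
  define E where "E = {y. \<forall>e\<in>fexp ` {0..}. cinner y e = 0}"
  have E: "csubspace E" "closed E"
    unfolding E_def by (rule csubspace_orthogonal closed_orthogonal)+
  define p where "p = proj E h"
  have orth: "cinner (h - p) y = 0" if "y \<in> E" for y
    using proj_orthogonal[OF E that] by (simp add: p_def)
  have pE: "p \<in> E" unfolding p_def by (rule proj_mem[OF E])
  have "cinner p (fexp n) = 0" for n
  proof (cases "n \<ge> 0")
    case True
    then show ?thesis using pE by (auto simp: E_def)
  next
    case False
    then have "fexp n \<in> E" by (auto simp: E_def cinner_fexp)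
    with orth[of "fexp n"] h False show ?thesis by (simp add: cinner_diff_left H2s_def)
  qed
  then have "p = 0" by (rule Fourier_unique)
  moreover have "x \<in> E" using x by (auto simp: E_def)
  ultimately show ?thesis using orth[of x] by simp
qed

lemma cnj_cinner_eq_0: "cinner x y = 0 \<Longrightarrow> cinner y (x::'a::complex_hilbert) = 0"
  by (metis cinner_commute complex_cnj_zero)

locale inner_function =
  fixes \<theta> :: "complex \<Rightarrow> complex"
  assumes inner: "inner_fun \<theta>"
begin

lemma unimodular: "unimodular \<theta>"
  using inner by (simp add: inner_fun_def unimodular_def measurable_cong_sets[OF sets_m refl])

lemma theta_L2: "\<theta> \<in> L2"
  by (rule unimodular_L2[OF unimodular])

definition t :: l2 where "t = cls \<theta>"

lemma t_mem_H2s: "t \<in> H2s"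
  using inner fc_eq[OF theta_L2] by (simp add: t_def H2s_def inner_fun_def)

lemma mulu_fexp: "mulu \<theta> (fexp n) = shift n t"
  unfolding fexp_def t_def shift_def mulu_cls[OF unimodular powi_L2]
    mulu_cls[OF unimodular_powi theta_L2] by (simp add: mult.commute)

lemma model_eq: "model \<theta> = {x. \<forall>h\<in>fexp ` {..<0} \<union> mulu \<theta> ` H2s. cinner x h = 0}"
  by (auto simp: model_def H2s_def)

lemma csubspace_model: "csubspace (model \<theta>)" and closed_model: "closed (model \<theta>)"
  unfolding model_eq by (rule csubspace_orthogonal closed_orthogonal)+

lemma model_memI:
  assumes x: "x \<in> H2s" and orth: "\<And>n. n \<ge> 0 \<Longrightarrow> cinner x (shift n t) = 0"
  shows "x \<in> model \<theta>"
  unfolding model_def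
proof (intro CollectI conjI x ballI)
  fix h assume h: "h \<in> H2s"
  have "cinner h (mulu (\<lambda>z. cnj (\<theta> z)) x) = 0"
    using orth unfolding mulu_fexp[symmetric]
    by (intro H2s_orthogonal[OF _ h])
       (simp add: cinner_mulu_left unimodular_cnj unimodular)
  then have "cinner (mulu \<theta> h) x = 0" by (simp add: cinner_mulu_left unimodular)
  then show "cinner x (mulu \<theta> h) = 0" by (rule cnj_cinner_eq_0)
qed

lemma model_memD:
  assumes "x \<in> model \<theta>"
  shows "x \<in> H2s" "n \<ge> 0 \<Longrightarrow> cinner x (shift n t) = 0"
  unfolding mulu_fexp[symmetric] using assms fexp_mem_H2s[of n] by (simp_all add: model_def)

lemma Kmod_iff: "f \<in> L2 \<Longrightarrow> f \<in> Kmod \<theta> \<longleftrightarrow> cls f \<in> model \<theta>"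
proof -
  assume f: "f \<in> L2"
  have "(\<forall>h\<in>H2. l2_inner f (\<lambda>z. \<theta> z * h z) = 0) \<longleftrightarrow> (\<forall>x\<in>H2s. cinner (cls f) (mulu \<theta> x) = 0)"
  proof (intro iffI ballI)
    fix x assume *: "\<forall>h\<in>H2. l2_inner f (\<lambda>z. \<theta> z * h z) = 0" and x: "x \<in> H2s"
    have "rep x \<in> H2" using x by (simp add: H2_iff)
    with * show "cinner (cls f) (mulu \<theta> x) = 0"
      using mulu_cls[OF unimodular, of "rep x"] f
      by (simp add: cinner_cls L2_mult_unimodular unimodular)
  next
    fix h assume *: "\<forall>x\<in>H2s. cinner (cls f) (mulu \<theta> x) = 0" and h: "h \<in> H2"
    have "cls h \<in> H2s" using h H2_iff[OF H2_L2[OF h]] by simp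
    from *[rule_format, OF this] show "l2_inner f (\<lambda>z. \<theta> z * h z) = 0"
      using H2_L2[OF h] f by (simp add: mulu_cls unimodular cinner_cls L2_mult_unimodular)
  qed
  then show ?thesis using f by (simp add: Kmod_def model_def H2_iff)
qed

lemma Kmod_L2: "f \<in> Kmod \<theta> \<Longrightarrow> f \<in> L2"
  by (simp add: Kmod_def H2_L2)

end

subsection \<open>The Clark unitary operator and its symmetry\<close>

definition cj :: "l2 \<Rightarrow> l2" where
  "cj x = cls (\<lambda>z. cnj (rep x z))"

lemma cj_cls:
  assumes f: "f \<in> L2"
  shows "cj (cls f) = cls (\<lambda>z. cnj (f z))"
  unfolding cj_def
  by (rule cls_eqI) (use rep_cls[OF f] in \<open>auto intro!: L2_cnj f elim: eventually_mono\<close>)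

lemma cj_add: "cj (x + y) = cj x + cj y"
  by (cases x rule: l2_cases; cases y rule: l2_cases) (simp add: cj_cls cls_add L2_add L2_cnj)

lemma cj_diff: "cj (x - y) = cj x - cj y"
  by (cases x rule: l2_cases; cases y rule: l2_cases) (simp add: cj_cls cls_diff L2_diff L2_cnj)

lemma cj_scaleC: "cj (c *\<^sub>C x) = cnj c *\<^sub>C cj x"
  by (cases x rule: l2_cases) (simp add: cj_cls scaleC_cls L2_scale L2_cnj)

lemma cj_mulu: "unimodular u \<Longrightarrow> cj (mulu u x) = mulu (\<lambda>z. cnj (u z)) (cj x)"
  by (cases x rule: l2_cases)
     (simp add: cj_cls mulu_cls L2_mult_unimodular unimodular_cnj L2_cnj)

lemma cj_fexp: "cj (fexp n) = fexp (- n)"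
  unfolding fexp_def cj_cls[OF powi_L2]
proof (rule cls_eqI)
  show "AE z in m. cnj (z powi n) = z powi - n"
    using AE_cmod_eq_1
  proof eventually_elim
    fix z :: complex assume z: "cmod z = 1"
    have "inverse z = cnj z" using cmod_eq_1_mult_cnj(1)[OF z] by (metis inverse_unique)
    then show "cnj (z powi n) = z powi - n" by (simp add: power_int_minus flip: power_int_inverse)
  qed
qed (rule L2_cnj[OF powi_L2], rule powi_L2)

lemma cj_shift: "cj (shift n x) = shift (- n) (cj x)"
proof -
  have "mulu (\<lambda>z. cnj (z powi n)) y = mulu (\<lambda>z. z powi (- n)) y" for y
  proof (rule mulu_cong)
    show "AE z in m. cnj (z powi n) = z powi - n"
      using cls_eqD[OF L2_cnj[OF powi_L2] powi_L2] cj_fexp[of n]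
      by (simp add: fexp_def cj_cls)
  qed (rule unimodular_cnj[OF unimodular_powi], rule unimodular_powi)
  then show ?thesis by (simp only: shift_def cj_mulu[OF unimodular_powi])
qed

lemma cinner_cj: "cinner (cj x) (cj y) = cnj (cinner x y)"
  by (cases x rule: l2_cases; cases y rule: l2_cases)
     (simp add: cj_cls cinner_cls L2_cnj l2_inner_def flip: Bochner_Integration.integral_cnj)

locale inner_function_0 = inner_function +
  assumes val0: "val0 \<theta> = 0"
begin

definition one :: l2 where "one = fexp 0"

definition U :: "l2 \<Rightarrow> l2" where
  "U x = shift 1 x + cinner x (shift (- 1) t) *\<^sub>C (one - t)"

definition V :: "l2 \<Rightarrow> l2" where
  "V x = shift (- 1) x + cinner x one *\<^sub>C (shift (- 1) t - fexp (- 1))"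

definition C :: "l2 \<Rightarrow> l2" where
  "C x = shift (- 1) (mulu \<theta> (cj x))"

lemma cinner_t_fexp: "n \<le> 0 \<Longrightarrow> cinner t (fexp n) = 0"
  using t_mem_H2s val0 fc_eq[OF theta_L2, of 0]
  by (cases "n = 0") (auto simp: H2s_def val0_def t_def)

lemma shift_one: "shift n one = fexp n"
  by (simp add: one_def shift_fexp)

lemma cinner_t_t: "cinner t t = 1"
  using cinner_mulu[OF unimodular, of one one]
  by (simp add: one_def mulu_fexp cinner_fexp)

lemma cinner_one_one: "cinner one one = 1"
  by (simp add: one_def cinner_fexp)

lemma cinner_one_t: "cinner one t = 0" and cinner_t_one: "cinner t one = 0"
  using cinner_t_fexp[of 0] by (auto simp: one_def intro: cnj_cinner_eq_0[of t])

lemma one_mem: "one \<in> model \<theta>"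
proof (rule model_memI)
  show "one \<in> H2s" by (simp add: one_def fexp_mem_H2s)
  fix n :: int assume "n \<ge> 0"
  then have "cinner (shift n t) one = 0"
    by (simp add: cinner_shift shift_one cinner_t_fexp)
  then show "cinner one (shift n t) = 0" by (rule cnj_cinner_eq_0)
qed

lemma U_mem:
  assumes x: "x \<in> model \<theta>"
  shows "U x \<in> model \<theta>"
proof -
  define c where "c = cinner x (shift (- 1) t)"
  have "shift 1 x - c *\<^sub>C t \<in> model \<theta>"
  proof (rule model_memI)
    show "shift 1 x - c *\<^sub>C t \<in> H2s"
      by (intro csubspaceD[OF csubspace_H2s] shift_mem_H2s model_memD[OF x] t_mem_H2s) simp
    fix n :: int assume n: "n \<ge> 0"
    show "cinner (shift 1 x - c *\<^sub>C t) (shift n t) = 0"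
    proof (cases "n = 0")
      case True
      then show ?thesis
        by (simp add: cinner_diff_left cinner_scaleC_left cinner_t_t cinner_shift c_def)
    next
      case False
      have "cinner t (shift n t) = cinner one (fexp n)"
        using cinner_mulu[OF unimodular, of one "fexp n"] by (simp add: one_def mulu_fexp)
      moreover have "cinner (shift 1 x) (shift n t) = 0"
        using model_memD(2)[OF x, of "n - 1"] n False
        by (simp add: cinner_shift shift_shift add.commute[of "- 1"])
      ultimately show ?thesis
        using False by (simp add: cinner_diff_left cinner_scaleC_left one_def cinner_fexp)
    qed
  qed
  moreover have "U x = (shift 1 x - c *\<^sub>C t) + c *\<^sub>C one"
    by (simp add: U_def c_def scaleC_diff_right)
  ultimately show ?thesis
    using csubspaceD[OF csubspace_model] one_mem by metis
qed

lemma norm_U: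
  assumes x: "x \<in> model \<theta>"
  shows "norm (U x) = norm x"
proof -
  define c where "c = cinner x (shift (- 1) t)"
  define y where "y = shift 1 x - c *\<^sub>C t"
  have x1: "cinner (shift 1 x) one = 0"
    using model_memD(1)[OF x] by (simp add: cinner_shift shift_one H2s_def)
  have y1: "cinner y one = 0"
    using x1 by (simp add: y_def cinner_diff_left cinner_scaleC_left cinner_t_one)
  have yt: "cinner y t = 0"
    by (simp add: y_def cinner_diff_left cinner_scaleC_left cinner_t_t cinner_shift c_def)
  have "U x = y + c *\<^sub>C one" by (simp add: U_def y_def c_def scaleC_diff_right)
  then have "(norm (U x))\<^sup>2 = (norm y)\<^sup>2 + (norm (c *\<^sub>C one))\<^sup>2"
    using norm_add_Pythagoras[of y "c *\<^sub>C one"] y1 by (simp add: cinner_scaleC_right)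
  moreover have "(norm one)\<^sup>2 = 1" "(norm t)\<^sup>2 = 1"
    using cinner_self[of one] cinner_self[of t]
    by (simp_all add: cinner_one_one cinner_t_t flip: of_real_power)
  moreover have "(norm (shift 1 x))\<^sup>2 = (norm y)\<^sup>2 + (norm (c *\<^sub>C t))\<^sup>2"
    using norm_add_Pythagoras[of y "c *\<^sub>C t"] yt by (simp add: cinner_scaleC_right y_def)
  moreover have "(norm (shift 1 x))\<^sup>2 = (norm x)\<^sup>2"
    using cinner_shift_shift[of 1 x x] by (simp add: cinner_self flip: of_real_power)
  ultimately have "(norm (U x))\<^sup>2 = (norm x)\<^sup>2" by (simp add: power_mult_distrib)
  then show ?thesis by (rule power2_eq_imp_eq) auto
qed

lemma V_mem:
  assumes x: "x \<in> model \<theta>"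
  shows "V x \<in> model \<theta>"
proof -
  define d where "d = cinner x one"
  have V: "V x = (shift (- 1) x - d *\<^sub>C fexp (- 1)) + d *\<^sub>C shift (- 1) t"
    by (simp add: V_def d_def scaleC_diff_right)
  show ?thesis
  proof (rule model_memI)
    show "V x \<in> H2s"
      unfolding H2s_def
    proof (intro CollectI allI impI)
      fix n :: int assume n: "n < 0"
      have "cinner x (fexp (1 + n)) - d * cinner (fexp (- 1)) (fexp n) = 0"
        using model_memD(1)[OF x] n by (cases "n = - 1") (auto simp: H2s_def cinner_fexp d_def one_def)
      then show "cinner (V x) (fexp n) = 0"
        using n unfolding V cinner_add_left cinner_diff_left cinner_scaleC_left cinner_shift shift_fexp
        by (simp add: cinner_t_fexp)
    qed
    fix n :: int assume n: "n \<ge> 0"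
    have "cinner (shift (- 1) x) (shift n t) = 0"
      using model_memD(2)[OF x, of "1 + n"] n by (simp add: cinner_shift shift_shift)
    moreover have "cinner (fexp (- 1)) (shift n t) = 0"
      by (rule cnj_cinner_eq_0) (use n in \<open>simp add: cinner_shift shift_fexp cinner_t_fexp\<close>)
    moreover have "cinner (shift (- 1) t) (shift n t) = cinner (fexp (- 1)) (fexp n)"
      using cinner_mulu[OF unimodular, of "fexp (- 1)" "fexp n"] by (simp add: mulu_fexp)
    ultimately show "cinner (V x) (shift n t) = 0"
      using n by (simp add: V cinner_add_left cinner_diff_left cinner_scaleC_left cinner_fexp)
  qed
qed

lemma UV:
  assumes x: "x \<in> model \<theta>"
  shows "U (V x) = x"
proof -
  have "cinner (V x) (shift (- 1) t) = cinner (shift 1 (V x)) t"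
    by (simp add: cinner_shift)
  also have s: "shift 1 (V x) = x + cinner x one *\<^sub>C (t - one)"
    by (simp add: V_def shift_add shift_scaleC shift_diff shift_shift shift_fexp one_def)
  also have "cinner \<dots> t = cinner x one"
    using model_memD(2)[OF x, of 0]
    by (simp add: cinner_add_left cinner_scaleC_left cinner_diff_left cinner_t_t cinner_one_t)
  finally show ?thesis
    unfolding U_def s by (simp add: scaleC_diff_right)
qed

lemma VU:
  assumes x: "x \<in> model \<theta>"
  shows "V (U x) = x"
proof -
  define c where "c = cinner x (shift (- 1) t)"
  have "cinner (shift 1 x) one = 0"
    using model_memD(1)[OF x] by (simp add: cinner_shift shift_one H2s_def)
  then have "cinner (U x) one = c"
    by (simp add: U_def c_def cinner_add_left cinner_scaleC_left cinner_diff_left cinner_t_one cinner_one_one)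
  moreover have "shift (- 1) (U x) = x + c *\<^sub>C (fexp (- 1) - shift (- 1) t)"
    by (simp add: U_def c_def shift_add shift_scaleC shift_diff shift_shift shift_one)
  ultimately show ?thesis by (simp add: V_def scaleC_diff_right)
qed

lemma U_add: "U (x + y) = U x + U y"
  by (simp add: U_def shift_add cinner_add_left scaleC_add_left)

lemma U_scaleC: "U (c *\<^sub>C x) = c *\<^sub>C U x"
  by (simp add: U_def shift_scaleC cinner_scaleC_left scaleC_add_right scaleC_scaleC)

lemma mulu_cj_t: "mulu \<theta> (cj t) = one"
proof -
  have "t = mulu \<theta> one" by (simp add: one_def mulu_fexp)
  then have "cj t = mulu (\<lambda>z. cnj (\<theta> z)) one"
    by (simp add: cj_mulu unimodular one_def cj_fexp)
  then show ?thesis by (simp add: mulu_cnj_mulu unimodular)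
qed

lemma C_scaleC: "C (c *\<^sub>C x) = cnj c *\<^sub>C C x"
  by (simp add: C_def cj_scaleC mulu_scaleC unimodular shift_scaleC)

lemma C_add: "C (x + y) = C x + C y"
  by (simp add: C_def cj_add mulu_add unimodular shift_add)

lemma C_diff: "C (x - y) = C x - C y"
  by (simp add: C_def cj_diff mulu_diff unimodular shift_diff)

lemma C_shift: "C (shift n x) = shift (- n) (C x)"
  by (simp add: C_def cj_shift shift_shift shift_mulu[OF unimodular, symmetric] add.commute)

lemma C_one: "C one = shift (- 1) t"
  by (simp add: C_def one_def cj_fexp mulu_fexp)

lemma C_t: "C t = fexp (- 1)"
  by (simp add: C_def mulu_cj_t shift_one)

lemma C_fexp: "C (fexp (- 1)) = t"
  by (simp add: C_def cj_fexp mulu_fexp shift_shift)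

lemma cinner_C: "cinner (C x) (C y) = cnj (cinner x y)"
  by (simp add: C_def cinner_shift_shift cinner_mulu unimodular cinner_cj)

lemma C_U: "C (U x) = V (C x)"
proof -
  have "cinner (C x) one = cnj (cinner x (shift (- 1) t))"
    using cinner_C[of x "shift (- 1) t"] by (simp add: C_shift C_t shift_fexp one_def)
  then show ?thesis
    by (simp add: U_def V_def C_add C_scaleC C_shift C_diff C_one C_t)
qed

lemma C_V: "C (V x) = U (C x)"
proof -
  have "cinner (C x) (shift (- 1) t) = cnj (cinner x one)"
    using cinner_C[of x one] by (simp add: C_one)
  then show ?thesis
    by (simp add: U_def V_def C_add C_scaleC C_shift C_diff C_one C_fexp C_t shift_shift
        shift_fexp one_def)
qed

lemma cmod_rep_C: "AE z in m. cmod (rep (C x) z) = cmod (rep x z)"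
proof (cases x rule: l2_cases)
  case (1 f)
  have "C x = cls (\<lambda>z. z powi (- 1) * (\<theta> z * cnj (f z)))"
    by (simp only: 1 C_def shift_def cj_cls[OF 1(1)] mulu_cls[OF unimodular L2_cnj[OF 1(1)]]
        mulu_cls[OF unimodular_powi L2_mult_unimodular[OF unimodular L2_cnj[OF 1(1)]]])
  then have "AE z in m. rep (C x) z = z powi (- 1) * (\<theta> z * cnj (f z))"
    using rep_cls[OF L2_mult_unimodular[OF unimodular_powi L2_mult_unimodular[OF unimodular L2_cnj[OF 1(1)]]], of "- 1"]
    by simp
  moreover have "AE z in m. cmod (\<theta> z) = 1" using unimodular by (simp add: unimodular_def)
  moreover have "AE z in m. rep x z = f z" unfolding 1(2) by (rule rep_cls[OF 1(1)])
  ultimately show ?thesis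
    using AE_cmod_powi[of "- 1"] by eventually_elim (simp only: norm_mult complex_mod_cnj mult_1_left)
qed

lemma cyclic:
  assumes x: "x \<in> model \<theta>" and orth: "\<And>n. cinner ((V ^^ n) x) one = 0"
  shows "x = 0"
proof (rule Fourier_unique)
  fix k :: int
  have V: "(V ^^ n) x = shift (- int n) x" for n
  proof (induction n)
    case (Suc n)
    have "cinner (shift (- int n) x) one = 0" using orth[of n] by (simp only: Suc)
    then have "V (shift (- int n) x) = shift (- int (Suc n)) x" by (simp add: V_def shift_shift)
    then show ?case by (simp only: funpow.simps o_apply Suc)
  qed simp
  define n where "n = nat (k + 1)"
  have "(V ^^ n) x \<in> model \<theta>" by (induction n) (auto simp: x V_mem)
  then have "shift (- int n) x \<in> H2s" using model_memD(1) by (simp add: V)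
  then have "cinner (shift (- int n) x) (fexp (k - int n)) = 0"
    by (auto simp: H2s_def n_def)
  then show "cinner x (fexp k) = 0" by (simp add: cinner_shift shift_fexp)
qed

end

section \<open>Comparing forward and backward averages\<close>

lemma shifted_sum_le:
  fixes f :: "int \<Rightarrow> complex"
  assumes b: "\<And>i. cmod (f i) \<le> b"
  shows "cmod ((\<Sum>n<N. f (int n + s)) - (\<Sum>n<N. f (int n))) \<le> 2 * b * \<bar>real_of_int s\<bar>"
proof -
  define S where "S s = (\<Sum>n<N. f (int n + s))" for s
  have step: "cmod (S (s + 1) - S s) \<le> 2 * b" for s
  proof -
    have "S (s + 1) - S s = (\<Sum>n<N. f (int (Suc n) + s) - f (int n + s))"
      by (simp add: S_def sum_subtractf add.commute add.left_commute)
    also have "\<dots> = f (int N + s) - f (int 0 + s)"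
      by (rule sum_lessThan_telescope[of "\<lambda>n. f (int n + s)"])
    finally show ?thesis
      using norm_triangle_ineq4[of "f (int N + s)" "f (int 0 + s)"] b[of "int N + s"] b[of "int 0 + s"]
      by simp
  qed
  have "cmod (S s - S 0) \<le> 2 * b * \<bar>real_of_int s\<bar>"
  proof (induction s rule: int_induct[of _ 0])
    case (step1 i)
    then show ?case
      using norm_triangle_ineq[of "S (i + 1) - S i" "S i - S 0"] step[of i] by (simp add: algebra_simps)
  next
    case (step2 i)
    then show ?case
      using norm_triangle_ineq[of "S (i - 1) - S i" "S i - S 0"] step[of "i - 1"]
      by (simp add: norm_minus_commute algebra_simps)
  qed simp
  then show ?thesis by (simp add: S_def)
qed

lemma toeplitz_averages:
  fixes B :: "int \<Rightarrow> int \<Rightarrow> complex" and a :: "int \<Rightarrow> complex"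
  assumes b: "\<And>i j. cmod (B i j) \<le> b"
  shows "(\<lambda>N. ((\<Sum>n<N. \<Sum>k\<in>I. \<Sum>l\<in>I. a k * cnj (a l) * B (int n + k) (int n + l))
     - (\<Sum>n<N. \<Sum>k\<in>I. \<Sum>l\<in>I. a k * cnj (a l) * B (int n - l - 1) (int n - k - 1))) / of_nat N) \<longlonglongrightarrow> 0"
    (is "(\<lambda>N. (?P N - ?Q N) / of_nat N) \<longlonglongrightarrow> 0")
proof -
  define c where "c = (\<Sum>k\<in>I. \<Sum>l\<in>I. cmod (a k * cnj (a l)) * (2 * b * \<bar>real_of_int (k + l + 1)\<bar>))"
  have le: "cmod (?P N - ?Q N) \<le> c" for N
  proof -
    have "?P N - ?Q N = (\<Sum>k\<in>I. \<Sum>l\<in>I. a k * cnj (a l) *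
        ((\<Sum>n<N. B (int n + k) (int n + l)) - (\<Sum>n<N. B (int n - l - 1) (int n - k - 1))))"
      by (simp add: sum_subtractf right_diff_distrib sum_distrib_left sum.swap[of _ _ "{..<N}"])
    also have "cmod \<dots> \<le> c"
      unfolding c_def
    proof (intro sum_norm_le)
      fix k l
      have "cmod ((\<Sum>n<N. B (int n + k) (int n + l)) - (\<Sum>n<N. B (int n - l - 1) (int n - k - 1)))
          \<le> 2 * b * \<bar>real_of_int (k + l + 1)\<bar>"
        using shifted_sum_le[of "\<lambda>i. B (i - l - 1) (i - k - 1)" b "k + l + 1" N] b
        by (simp add: algebra_simps)
      then show "cmod (a k * cnj (a l) * ((\<Sum>n<N. B (int n + k) (int n + l)) - (\<Sum>n<N. B (int n - l - 1) (int n - k - 1))))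
          \<le> cmod (a k * cnj (a l)) * (2 * b * \<bar>real_of_int (k + l + 1)\<bar>)"
        unfolding norm_mult[of "a k * cnj (a l)"] by (intro mult_left_mono) auto
    qed
    finally show ?thesis .
  qed
  have "(\<lambda>N. c / real N) \<longlonglongrightarrow> 0" by (rule lim_const_over_n)
  then show ?thesis
    by (rule Lim_null_comparison[rotated])
       (use le in \<open>auto intro!: always_eventually divide_right_mono simp: norm_divide\<close>)
qed

locale symmetric_isometry = isometry_without_eigenvectors K U
  for K :: "'a::complex_hilbert set" and U +
  fixes V C :: "'a \<Rightarrow> 'a" and e :: 'a
  assumes V_mem: "x \<in> K \<Longrightarrow> V x \<in> K"
    and UV: "x \<in> K \<Longrightarrow> U (V x) = x" and VU: "x \<in> K \<Longrightarrow> V (U x) = x"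
    and e_mem: "e \<in> K"
    and cyclic: "x \<in> K \<Longrightarrow> (\<And>n. cinner ((V ^^ n) x) e = 0) \<Longrightarrow> x = 0"
    and C_add: "C (x + y) = C x + C y"
    and C_scaleC: "C (c *\<^sub>C x) = cnj c *\<^sub>C C x"
    and C_U: "C (U x) = V (C x)" and C_V: "C (V x) = U (C x)"
    and C_e: "C e = V e"
begin

lemma V_add: "x \<in> K \<Longrightarrow> y \<in> K \<Longrightarrow> V (x + y) = V x + V y"
  using VU[of "V x + V y"] by (simp add: U_add V_mem UV K_closed(2))

lemma V_scaleC: "x \<in> K \<Longrightarrow> V (c *\<^sub>C x) = c *\<^sub>C V x"
  using VU[of "c *\<^sub>C V x"] by (simp add: U_scaleC V_mem UV K_closed(3))

lemma powV_mem: "x \<in> K \<Longrightarrow> (V ^^ n) x \<in> K"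
  by (induction n) (auto simp: V_mem)

lemma powU_powV: "x \<in> K \<Longrightarrow> (U ^^ n) ((V ^^ n) x) = x"
proof (induction n)
  case (Suc n)
  have "(U ^^ Suc n) ((V ^^ Suc n) x) = (U ^^ n) (U (V ((V ^^ n) x)))"
    by (subst funpow_Suc_right) simp
  then show ?case using Suc by (simp add: UV powV_mem)
qed simp

lemma powU_powV_le: "x \<in> K \<Longrightarrow> n \<le> j \<Longrightarrow> (U ^^ j) ((V ^^ n) x) = (U ^^ (j - n)) x"
  using funpow_add[of "j - n" n U] by (simp add: powU_powV)

definition orb :: "int \<Rightarrow> 'a" where
  "orb i = (if i \<ge> 0 then (U ^^ nat i) e else (V ^^ nat (- i)) e)"

lemma orb_mem: "orb i \<in> K"
  by (simp add: orb_def pow_mem powV_mem e_mem)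

lemma U_orb: "U (orb i) = orb (i + 1)"
proof (cases "i \<ge> 0")
  case True
  then show ?thesis by (simp add: orb_def nat_add_distrib)
next
  case False
  then have "nat (- i) = Suc (nat (- (i + 1)))" by simp
  then have "orb i = V ((V ^^ nat (- (i + 1))) e)" using False by (simp add: orb_def)
  then have "U (orb i) = (V ^^ nat (- (i + 1))) e" by (simp add: UV powV_mem e_mem)
  then show ?thesis using False by (auto simp: orb_def)
qed

lemma V_orb: "V (orb i) = orb (i - 1)"
  using U_orb[of "i - 1"] VU[OF orb_mem, of "i - 1"] by simp

lemma powU_orb: "(U ^^ n) (orb i) = orb (int n + i)"
  by (induction n) (simp_all add: U_orb add_ac)

lemma C_orb: "C (orb i) = orb (- i - 1)"
proof (induction i rule: int_induct[of _ 0])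
  case base
  have "C (orb 0) = V (orb 0)" using C_e by (simp add: orb_def)
  then show ?case by (simp add: V_orb)
next
  case (step1 i)
  then show ?case by (simp add: C_U V_orb flip: U_orb)
next
  case (step2 i)
  then show ?case using C_V[of "orb i"] by (simp add: V_orb U_orb)
qed

definition comb :: "int set \<Rightarrow> (int \<Rightarrow> complex) \<Rightarrow> 'a" where
  "comb I a = (\<Sum>k\<in>I. a k *\<^sub>C orb k)"

lemma comb_mem: "comb I a \<in> K"
  unfolding comb_def by (intro csubspace_sum[OF csubspace_K] K_closed(3) orb_mem)

lemma powU_comb: "(U ^^ n) (comb I a) = (\<Sum>k\<in>I. a k *\<^sub>C orb (int n + k))"
  unfolding comb_def
  by (subst pow_sum) (simp_all add: K_closed(3) orb_mem pow_scaleC powU_orb)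

lemma V_zero: "V 0 = 0"
  using V_scaleC[of 0 0] K_closed(1) by simp

lemma V_sum: "(\<And>i. i \<in> I \<Longrightarrow> f i \<in> K) \<Longrightarrow> V (\<Sum>i\<in>I. f i) = (\<Sum>i\<in>I. V (f i))"
  by (induction I rule: infinite_finite_induct)
     (auto simp: V_zero V_add csubspace_sum[OF csubspace_K])

lemma powV_comb: "(V ^^ n) (comb I a) = (\<Sum>k\<in>I. a k *\<^sub>C orb (k - int n))"
proof (induction n)
  case 0
  show ?case by (simp add: comb_def)
next
  case (Suc n)
  have "(V ^^ Suc n) (comb I a) = V (\<Sum>k\<in>I. a k *\<^sub>C orb (k - int n))"
    by (simp only: funpow.simps o_apply Suc)
  then show ?case
    by (simp add: V_sum K_closed(3) orb_mem V_scaleC V_orb diff_diff_eq add.commute)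
qed

lemma powV_comb_eq: "\<exists>J b. finite J \<and> (V ^^ n) (comb I a) = comb J b" if "finite I"
proof (intro exI conjI)
  show "finite ((\<lambda>k. k - int n) ` I)" using that by simp
  show "(V ^^ n) (comb I a) = comb ((\<lambda>k. k - int n) ` I) (\<lambda>k. a (k + int n))"
    unfolding powV_comb unfolding comb_def by (subst sum.reindex) (auto simp: inj_on_def)
qed

lemma C_zero: "C 0 = 0"
  using C_scaleC[of 0 0] by simp

lemma C_sum: "C (\<Sum>i\<in>I. f i) = (\<Sum>i\<in>I. C (f i))"
  by (induction I rule: infinite_finite_induct) (auto simp: C_zero C_add)

lemma C_powV_comb: "C ((V ^^ n) (comb I a)) = (\<Sum>k\<in>I. cnj (a k) *\<^sub>C orb (int n - k - 1))"
  unfolding powV_comb C_sum by (simp add: C_scaleC C_orb)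

lemma comb_dense:
  assumes x: "x \<in> K"
  shows "x \<in> closure {comb I a | I a. finite I}"
proof (rule mem_closure_if_orthogonal_trivial[OF _ csubspace_K closed_K _ _ x])
  let ?S = "{comb I a | I a. finite I}"
  show "?S \<subseteq> K" using comb_mem by auto
  show "csubspace ?S"
    unfolding csubspace_def
  proof (intro conjI ballI allI)
    have "0 = comb {} (\<lambda>_. 0)" by (simp add: comb_def)
    then show "0 \<in> ?S" by blast
  next
    fix x y assume "x \<in> ?S" "y \<in> ?S"
    then obtain I a J b where *: "finite I" "x = comb I a" "finite J" "y = comb J b" by auto
    have ext: "comb I a = (\<Sum>k\<in>I \<union> J. (if k \<in> I then a k else 0) *\<^sub>C orb k)"
        "comb J b = (\<Sum>k\<in>I \<union> J. (if k \<in> J then b k else 0) *\<^sub>C orb k)"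
      unfolding comb_def using *(1,3) by (auto intro!: sum.mono_neutral_cong_left)
    have "x + y = comb (I \<union> J) (\<lambda>k. (if k \<in> I then a k else 0) + (if k \<in> J then b k else 0))"
      unfolding *(2,4) ext by (simp add: comb_def scaleC_add_left sum.distrib)
    then show "x + y \<in> ?S" using *(1,3) by blast
  next
    fix c x assume "x \<in> ?S"
    then obtain I a where *: "finite I" "x = comb I a" by auto
    have "c *\<^sub>C x = comb I (\<lambda>k. c * a k)"
      unfolding *(2) by (simp add: comb_def scaleC_sum_right scaleC_scaleC)
    then show "c *\<^sub>C x \<in> ?S" using *(1) by blast
  qed
  fix y assume y: "y \<in> K" and orth: "\<forall>h\<in>?S. cinner y h = 0"
  show "y = 0"
  proof (rule cyclic[OF y])
    fix n
    have "orb (int n) = comb {int n} (\<lambda>_. 1)" by (simp add: comb_def)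
    then have "orb (int n) \<in> ?S" by blast
    then have "cinner y ((U ^^ n) e) = 0" using orth by (simp add: orb_def)
    then show "cinner ((V ^^ n) y) e = 0"
      using cinner_pow[OF powV_mem[OF y, of n] e_mem, of n] by (simp add: powU_powV y)
  qed
qed

text \<open>The symmetry reverses the orbit of \<open>e\<close> and conjugates coefficients. As the averaged
  form \<open>cinner (G \<cdot>) (G \<cdot>)\<close> is asymptotically a Toeplitz form in the orbit vectors,
  it cannot distinguish the two directions of time.\<close>

lemma forward_backward_averages:
  fixes G :: "'a \<Rightarrow> 'b::complex_hilbert"
  assumes add: "\<And>x y. x \<in> K \<Longrightarrow> y \<in> K \<Longrightarrow> G (x + y) = G x + G y"
    and scale: "\<And>c x. x \<in> K \<Longrightarrow> G (c *\<^sub>C x) = c *\<^sub>C G x"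
    and bdd: "\<And>x. x \<in> K \<Longrightarrow> norm (G x) \<le> b * norm x"
    and GC: "\<And>x. C x \<in> K \<Longrightarrow> x \<in> K \<Longrightarrow> norm (G (C x)) = norm (G x)"
  shows "(\<lambda>N. ((\<Sum>n<N. (norm (G ((U ^^ n) (comb I a))))\<^sup>2)
     - (\<Sum>n<N. (norm (G ((V ^^ n) (comb I a))))\<^sup>2)) / real N) \<longlonglongrightarrow> 0"
proof -
  have G_zero: "G 0 = 0" using scale[of 0 0] K_closed(1) by simp
  have G_sum: "G (\<Sum>i\<in>J. f i) = (\<Sum>i\<in>J. G (f i))" if "\<And>i. i \<in> J \<Longrightarrow> f i \<in> K" for f and J :: "int set"
    using that by (induction J rule: infinite_finite_induct)
     (auto simp: G_zero add csubspace_sum[OF csubspace_K])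
  define B where "B i j = cinner (G (orb i)) (G (orb j))" for i j
  have norm_orb: "norm (orb i) = norm e" for i
  proof (cases "i \<ge> 0")
    case True
    then show ?thesis by (simp add: orb_def norm_pow e_mem)
  next
    case False
    then show ?thesis
      using norm_pow[OF powV_mem[OF e_mem, of "nat (- i)"], of "nat (- i)"]
      by (simp add: orb_def powU_powV e_mem)
  qed
  have B_le: "cmod (B i j) \<le> (b * norm e) * (b * norm e)" for i j
    unfolding B_def using bdd[OF orb_mem, of i] bdd[OF orb_mem, of j]
    by (intro order_trans[OF cmod_cinner_le] mult_mono) (auto simp: norm_orb intro: order_trans[OF norm_ge_zero])
  have sq: "complex_of_real ((norm (G (\<Sum>k\<in>I. c k *\<^sub>C orb (p k))))\<^sup>2)
      = (\<Sum>k\<in>I. \<Sum>l\<in>I. c k * cnj (c l) * B (p k) (p l))" for c p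
  proof -
    have "G (\<Sum>k\<in>I. c k *\<^sub>C orb (p k)) = (\<Sum>k\<in>I. c k *\<^sub>C G (orb (p k)))"
      by (subst G_sum) (simp_all add: K_closed(3) orb_mem scale)
    then show ?thesis
      unfolding cinner_self[symmetric] B_def
      by (simp only: cinner_sum_left cinner_scaleC_left)
         (simp only: cinner_sum_right cinner_scaleC_right sum_distrib_left mult.assoc)
  qed
  have U_sq: "complex_of_real ((norm (G ((U ^^ n) (comb I a))))\<^sup>2)
      = (\<Sum>k\<in>I. \<Sum>l\<in>I. a k * cnj (a l) * B (int n + k) (int n + l))" for n
    unfolding powU_comb by (rule sq)
  have V_sq: "complex_of_real ((norm (G ((V ^^ n) (comb I a))))\<^sup>2)
      = (\<Sum>k\<in>I. \<Sum>l\<in>I. a k * cnj (a l) * B (int n - l - 1) (int n - k - 1))" for n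
  proof -
    have CK: "C ((V ^^ n) (comb I a)) \<in> K"
      unfolding C_powV_comb by (intro csubspace_sum[OF csubspace_K] K_closed(3) orb_mem)
    have "complex_of_real ((norm (G ((V ^^ n) (comb I a))))\<^sup>2)
        = complex_of_real ((norm (G (C ((V ^^ n) (comb I a)))))\<^sup>2)"
      by (simp only: GC[OF CK powV_mem[OF comb_mem]])
    also have "\<dots> = (\<Sum>k\<in>I. \<Sum>l\<in>I. cnj (a k) * cnj (cnj (a l)) * B (int n - k - 1) (int n - l - 1))"
      unfolding C_powV_comb by (rule sq)
    also have "\<dots> = (\<Sum>k\<in>I. \<Sum>l\<in>I. a k * cnj (a l) * B (int n - l - 1) (int n - k - 1))"
      by (subst sum.swap) (simp add: mult.commute)
    finally show ?thesis .
  qed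
  have "(\<lambda>N. complex_of_real (((\<Sum>n<N. (norm (G ((U ^^ n) (comb I a))))\<^sup>2)
     - (\<Sum>n<N. (norm (G ((V ^^ n) (comb I a))))\<^sup>2)) / real N)) \<longlonglongrightarrow> complex_of_real 0"
    using toeplitz_averages[of B, OF B_le, where I = I and a = a]
    unfolding of_real_divide of_real_diff of_real_sum U_sq V_sq by simp
  then show ?thesis by (simp only: tendsto_of_real_iff)
qed

text \<open>The two factors \<open>M\<close> come from moving forward in time from \<open>x\<close> to the far future,
  and from the far past to the point \<open>(V ^^ n) x\<close>.\<close>

lemma backward_orbit_bound:
  fixes G X A :: "'a \<Rightarrow> 'b::complex_hilbert"
  assumes add: "\<And>x y. x \<in> K \<Longrightarrow> y \<in> K \<Longrightarrow> G (x + y) = G x + G y"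
    and scale: "\<And>c x. x \<in> K \<Longrightarrow> G (c *\<^sub>C x) = c *\<^sub>C G x"
    and bdd: "\<And>x. x \<in> K \<Longrightarrow> norm (G x) \<le> b * norm x"
    and GC: "\<And>x. C x \<in> K \<Longrightarrow> x \<in> K \<Longrightarrow> norm (G (C x)) = norm (G x)"
    and split: "\<And>x. x \<in> K \<Longrightarrow> (norm (G x))\<^sup>2 = (norm (X x))\<^sup>2 + (norm (A x))\<^sup>2"
    and small: "\<And>x. x \<in> K \<Longrightarrow> (\<lambda>k. (\<Sum>n<2^k. (norm (A ((U ^^ n) x)))\<^sup>2) / 2 ^ k) \<longlonglongrightarrow> 0"
    and fwd: "\<And>x n. x \<in> K \<Longrightarrow> norm (X ((U ^^ n) x)) \<le> M * norm (X x)"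
    and M: "M \<ge> 0" and I: "finite I"
  shows "norm (X ((V ^^ n) (comb I a))) \<le> M\<^sup>2 * norm (X (comb I a))"
proof -
  define x where "x = comb I a"
  have x: "x \<in> K" by (simp add: x_def comb_mem)
  define y where "y = (V ^^ n) x"
  have y: "y \<in> K" by (simp add: y_def powV_mem x)
  obtain J c where J: "y = comb J c" using powV_comb_eq[OF I, of n a] unfolding y_def x_def by blast
  define SU where "SU N = (\<Sum>j<N. (norm (G ((U ^^ j) y)))\<^sup>2)" for N
  define SV where "SV N = (\<Sum>j<N. (norm (G ((V ^^ j) y)))\<^sup>2)" for N
  define SA where "SA N = (\<Sum>j<N. (norm (A ((U ^^ j) y)))\<^sup>2)" for N
  define c0 where "c0 = (\<Sum>j<n. (norm (X ((U ^^ j) y)))\<^sup>2)"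
  have pow2: "filterlim (\<lambda>k. 2 ^ k :: nat) at_top sequentially"
    by (rule filterlim_subseq) (simp add: strict_mono_def)
  have D: "(\<lambda>k. (SU (2 ^ k) - SV (2 ^ k)) / 2 ^ k) \<longlonglongrightarrow> 0"
    using filterlim_compose[OF forward_backward_averages[OF add scale bdd GC, of J c] pow2]
    by (simp add: SU_def SV_def J)
  have SA0: "(\<lambda>k. SA (2 ^ k) / 2 ^ k) \<longlonglongrightarrow> 0"
    unfolding SA_def by (rule small[OF y])
  have c00: "(\<lambda>k. c0 * (1 / 2) ^ k) \<longlonglongrightarrow> c0 * 0"
    by (intro tendsto_intros LIMSEQ_power_zero) auto
  have past: "(norm (X y))\<^sup>2 * N \<le> M\<^sup>2 * SV N" for N
  proof -
    have "(norm (X y))\<^sup>2 \<le> M\<^sup>2 * (norm (G ((V ^^ j) y)))\<^sup>2" for j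
    proof -
      have "norm (X y) \<le> M * norm (X ((V ^^ j) y))"
        using fwd[OF powV_mem[OF y, of j], of j] by (simp add: powU_powV y)
      then have "(norm (X y))\<^sup>2 \<le> (M * norm (X ((V ^^ j) y)))\<^sup>2" by (intro power_mono) auto
      also have "\<dots> \<le> M\<^sup>2 * (norm (G ((V ^^ j) y)))\<^sup>2"
        unfolding power_mult_distrib split[OF powV_mem[OF y]] by (intro mult_left_mono) auto
      finally show ?thesis .
    qed
    then have "(\<Sum>j<N. (norm (X y))\<^sup>2) \<le> (\<Sum>j<N. M\<^sup>2 * (norm (G ((V ^^ j) y)))\<^sup>2)"
      by (intro sum_mono)
    then show ?thesis by (simp add: SV_def sum_distrib_left mult.commute)
  qed
  have future: "SU N \<le> c0 + N * (M\<^sup>2 * (norm (X x))\<^sup>2) + SA N" for N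
  proof -
    have "(\<Sum>j<N. (norm (X ((U ^^ j) y)))\<^sup>2)
        \<le> (\<Sum>j<N. (if j < n then (norm (X ((U ^^ j) y)))\<^sup>2 else 0) + M\<^sup>2 * (norm (X x))\<^sup>2)"
    proof (rule sum_mono)
      fix j
      show "(norm (X ((U ^^ j) y)))\<^sup>2 \<le> (if j < n then (norm (X ((U ^^ j) y)))\<^sup>2 else 0) + M\<^sup>2 * (norm (X x))\<^sup>2"
      proof (cases "j < n")
        case False
        then have "norm (X ((U ^^ j) y)) \<le> M * norm (X x)"
          using fwd[OF x, of "j - n"] by (simp add: y_def powU_powV_le x)
        then have "(norm (X ((U ^^ j) y)))\<^sup>2 \<le> (M * norm (X x))\<^sup>2" by (intro power_mono) auto
        then show ?thesis using False by (simp add: power_mult_distrib)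
      qed simp
    qed
    also have "\<dots> = (\<Sum>j\<in>{..<N} \<inter> {..<n}. (norm (X ((U ^^ j) y)))\<^sup>2) + N * (M\<^sup>2 * (norm (X x))\<^sup>2)"
      by (simp add: sum.distrib sum.inter_restrict lessThan_iff)
    also have "(\<Sum>j\<in>{..<N} \<inter> {..<n}. (norm (X ((U ^^ j) y)))\<^sup>2) \<le> c0"
      unfolding c0_def by (rule sum_mono2) auto
    finally show ?thesis
      by (simp add: SU_def SA_def split pow_mem y sum.distrib)
  qed
  have "(norm (X y))\<^sup>2 \<le> M\<^sup>2 * (c0 * (1 / 2) ^ k + M\<^sup>2 * (norm (X x))\<^sup>2 + SA (2 ^ k) / 2 ^ k
      - (SU (2 ^ k) - SV (2 ^ k)) / 2 ^ k)" for k
  proof -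
    have "SV (2 ^ k) \<le> c0 + 2 ^ k * (M\<^sup>2 * (norm (X x))\<^sup>2) + SA (2 ^ k) - (SU (2 ^ k) - SV (2 ^ k))"
      using future[of "2 ^ k"] by simp
    then have "M\<^sup>2 * SV (2 ^ k) \<le> M\<^sup>2 * (c0 + 2 ^ k * (M\<^sup>2 * (norm (X x))\<^sup>2) + SA (2 ^ k) - (SU (2 ^ k) - SV (2 ^ k)))"
      by (intro mult_left_mono) auto
    then have "(norm (X y))\<^sup>2 * 2 ^ k \<le> M\<^sup>2 * (c0 + 2 ^ k * (M\<^sup>2 * (norm (X x))\<^sup>2) + SA (2 ^ k) - (SU (2 ^ k) - SV (2 ^ k)))"
      using past[of "2 ^ k"] by simp
    then have "(norm (X y))\<^sup>2 \<le> M\<^sup>2 * (c0 + 2 ^ k * (M\<^sup>2 * (norm (X x))\<^sup>2) + SA (2 ^ k) - (SU (2 ^ k) - SV (2 ^ k))) / 2 ^ k"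
      by (simp add: pos_le_divide_eq)
    also have "\<dots> = M\<^sup>2 * (c0 * (1 / 2) ^ k + M\<^sup>2 * (norm (X x))\<^sup>2 + SA (2 ^ k) / 2 ^ k
      - (SU (2 ^ k) - SV (2 ^ k)) / 2 ^ k)"
    proof -
      have *: "m2 * (p + P * q + r - s) / P = m2 * (p * (1 / P) + q + r / P - s / P)"
        if "P \<noteq> 0" for m2 p P q r s :: real
        using that by (simp add: field_simps)
      show ?thesis unfolding power_one_over by (rule *) simp
    qed
    finally show ?thesis .
  qed
  moreover have "(\<lambda>k. M\<^sup>2 * (c0 * (1 / 2) ^ k + M\<^sup>2 * (norm (X x))\<^sup>2 + SA (2 ^ k) / 2 ^ k
      - (SU (2 ^ k) - SV (2 ^ k)) / 2 ^ k)) \<longlonglongrightarrow> M\<^sup>2 * (c0 * 0 + M\<^sup>2 * (norm (X x))\<^sup>2 + 0 - 0)"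
    by (intro tendsto_mult tendsto_add tendsto_diff tendsto_const c00[simplified] SA0 D c00)
  ultimately have "(norm (X y))\<^sup>2 \<le> M\<^sup>2 * (c0 * 0 + M\<^sup>2 * (norm (X x))\<^sup>2 + 0 - 0)"
    by (intro LIMSEQ_le_const) auto
  then have "(norm (X y))\<^sup>2 \<le> (M\<^sup>2 * norm (X x))\<^sup>2" by (simp add: power_mult_distrib power2_eq_square mult_ac)
  then show ?thesis unfolding x_def[symmetric] y_def[symmetric] by (rule power2_le_imp_le) simp
qed

end

section \<open>Passing from representatives to classes\<close>

definition represents :: "(complex \<Rightarrow> complex) set \<Rightarrow> l2 set \<Rightarrow> bool" where
  "represents M S \<longleftrightarrow> M \<subseteq> L2 \<and> (\<forall>f\<in>L2. f \<in> M \<longleftrightarrow> cls f \<in> S)"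

lemma representsD:
  assumes "represents M S"
  shows "f \<in> M \<Longrightarrow> f \<in> L2" "f \<in> M \<Longrightarrow> cls f \<in> S"
    "f \<in> L2 \<Longrightarrow> cls f \<in> S \<Longrightarrow> f \<in> M" "x \<in> S \<Longrightarrow> rep x \<in> M"
  using assms rep_L2[of x] by (auto simp: represents_def simp del: rep_L2)

lemma (in inner_function) represents_Kmod: "represents (Kmod \<theta>) (model \<theta>)"
  using Kmod_iff Kmod_L2 by (auto simp: represents_def)

lemma cls_eq_iff_l2_norm:
  assumes "f \<in> L2" "g \<in> L2"
  shows "l2_norm (\<lambda>z. f z - g z) = 0 \<longleftrightarrow> cls f = cls g"
  using norm_cls[OF L2_diff[OF assms]] cls_diff[OF assms] by auto

lemma Proj_represents:
  assumes r: "represents M S" and S: "csubspace S" "closed S" and f: "f \<in> L2"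
  shows Proj_mem: "Proj M f \<in> M" and cls_Proj: "cls (Proj M f) = proj S (cls f)"
proof -
  have inner: "l2_inner (\<lambda>z. f z - p z) h = cinner (cls f - cls p) (cls h)" if "p \<in> M" "h \<in> M" for p h
    using that representsD(1)[OF r] f by (simp add: cls_diff cinner_cls L2_diff)
  have p0: "rep (proj S (cls f)) \<in> M" by (rule representsD(4)[OF r proj_mem[OF S]])
  define Q where "Q p \<longleftrightarrow> p \<in> M \<and> (\<forall>h\<in>M. l2_inner (\<lambda>z. f z - p z) h = 0)" for p
  have "Q (rep (proj S (cls f)))"
    using p0 proj_orthogonal[OF S representsD(2)[OF r]] by (auto simp: Q_def inner)
  then have "Q (SOME p. Q p)" by (rule someI[where P = Q])
  then have "Proj M f \<in> M \<and> (\<forall>h\<in>M. l2_inner (\<lambda>z. f z - Proj M f z) h = 0)"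
    unfolding Proj_def Q_def .
  then have P: "Proj M f \<in> M" "\<And>h. h \<in> M \<Longrightarrow> cinner (cls f - cls (Proj M f)) (cls h) = 0"
    using inner by auto
  show "Proj M f \<in> M" by (rule P)
  have "cinner (cls f - cls (Proj M f)) x = 0" if "x \<in> S" for x
    using P(2)[OF representsD(4)[OF r that]] by simp
  then show "cls (Proj M f) = proj S (cls f)"
    using proj_unique[OF S representsD(2)[OF r P(1)]] by simp
qed

lemma represents_ocomp:
  assumes r: "represents M S"
  shows "represents (ocomp M) {x. \<forall>h\<in>S. cinner x h = 0}"
proof -
  have "(\<forall>h\<in>M. l2_inner f h = 0) \<longleftrightarrow> (\<forall>x\<in>S. cinner (cls f) x = 0)" if f: "f \<in> L2" for f
  proof (intro iffI ballI)
    fix x assume *: "\<forall>h\<in>M. l2_inner f h = 0" and x: "x \<in> S"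
    from *[rule_format, OF representsD(4)[OF r x]] show "cinner (cls f) x = 0"
      using cinner_cls[OF f rep_L2, of x] by simp
  next
    fix h assume *: "\<forall>x\<in>S. cinner (cls f) x = 0" and h: "h \<in> M"
    from *[rule_format, OF representsD(2)[OF r h]] show "l2_inner f h = 0"
      using cinner_cls[OF f representsD(1)[OF r h]] by simp
  qed
  then show ?thesis by (auto simp: represents_def ocomp_def)
qed

definition lift_op :: "((complex \<Rightarrow> complex) \<Rightarrow> (complex \<Rightarrow> complex)) \<Rightarrow> l2 \<Rightarrow> l2" where
  "lift_op T x = cls (T (rep x))"

locale represented_op =
  fixes M S N R T
  assumes rM: "represents M S" and S: "csubspace S" and rN: "represents N R"
    and bdd: "bounded_op M N T"
begin

lemma op_mem: "f \<in> M \<Longrightarrow> T f \<in> N"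
  using bdd by (simp add: bounded_op_def)

lemmas op_L2 = representsD(1)[OF rN op_mem]

lemma comb_mem: "f \<in> M \<Longrightarrow> g \<in> M \<Longrightarrow> (\<lambda>w. f w + c * g w) \<in> M"
  and cls_comb: "f \<in> M \<Longrightarrow> g \<in> M \<Longrightarrow> cls (\<lambda>w. f w + c * g w) = cls f + c *\<^sub>C cls g"
proof -
  assume *: "f \<in> M" "g \<in> M"
  note L = representsD(1)[OF rM *(1)] representsD(1)[OF rM *(2)]
  show c: "cls (\<lambda>w. f w + c * g w) = cls f + c *\<^sub>C cls g"
    by (simp add: scaleC_cls cls_add L2_scale L)
  show "(\<lambda>w. f w + c * g w) \<in> M"
    by (rule representsD(3)[OF rM])
       (auto simp: c intro!: L2_add L2_scale L csubspaceD(2,3)[OF S] representsD(2)[OF rM] *)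
qed

lemma cls_linear:
  assumes "f \<in> M" "g \<in> M"
  shows "cls (T (\<lambda>w. f w + c * g w)) = cls (T f) + c *\<^sub>C cls (T g)"
proof -
  note L = op_L2[OF assms(1)] op_L2[OF assms(2)]
  have "l2_norm (\<lambda>z. T (\<lambda>w. f w + c * g w) z - (T f z + c * T g z)) = 0"
    using bdd assms by (simp add: bounded_op_def)
  then have "cls (T (\<lambda>w. f w + c * g w)) = cls (\<lambda>z. T f z + c * T g z)"
    using cls_eq_iff_l2_norm[OF op_L2[OF comb_mem[OF assms]] L2_add[OF L(1) L2_scale[OF L(2)]]]
    by blast
  then show ?thesis by (simp add: scaleC_cls cls_add L2_scale L)
qed

lemma cls_bounded: "\<exists>C\<ge>0. \<forall>f\<in>M. norm (cls (T f)) \<le> C * norm (cls f)"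
proof -
  obtain C where C: "\<And>f. f \<in> M \<Longrightarrow> l2_norm (T f) \<le> C * l2_norm f"
    using bdd unfolding bounded_op_def by blast
  have "norm (cls (T f)) \<le> \<bar>C\<bar> * norm (cls f)" if "f \<in> M" for f
  proof -
    have "norm (cls (T f)) \<le> C * norm (cls f)"
      using C[OF that] by (simp add: norm_cls op_L2 representsD(1)[OF rM] that)
    also have "\<dots> \<le> \<bar>C\<bar> * norm (cls f)" by (intro mult_right_mono) auto
    finally show ?thesis .
  qed
  then show ?thesis by (intro exI[of _ "\<bar>C\<bar>"]) auto
qed

lemma lift_cls:
  assumes f: "f \<in> M"
  shows "lift_op T (cls f) = cls (T f)"
proof -
  define h where "h = rep (cls f)"
  have h: "h \<in> M" unfolding h_def by (rule representsD(4)[OF rM representsD(2)[OF rM f]])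
  have "cls (\<lambda>w. f w + (- 1) * h w) = cls f + (- 1) *\<^sub>C cls h" by (rule cls_comb[OF f h])
  also have "\<dots> = 0" by (simp only: scaleC_minus_one h_def cls_rep add.right_inverse)
  finally have "cls (T (\<lambda>w. f w + (- 1) * h w)) = 0"
    using cls_bounded comb_mem[OF f h, of "- 1"] by (metis mult_zero_right norm_le_zero_iff norm_zero)
  then have "cls (T f) + (- 1) *\<^sub>C cls (T h) = 0" by (simp only: cls_linear[OF f h])
  then show ?thesis by (simp add: lift_op_def h_def scaleC_minus_one)
qed

lemma lift_mem: "x \<in> S \<Longrightarrow> lift_op T x \<in> R"
  unfolding lift_op_def by (intro representsD(2)[OF rN] op_mem representsD(4)[OF rM])

lemma lift_linear:
  assumes "x \<in> S" "y \<in> S"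
  shows "lift_op T (x + c *\<^sub>C y) = lift_op T x + c *\<^sub>C lift_op T y"
proof -
  note r = representsD(4)[OF rM assms(1)] representsD(4)[OF rM assms(2)]
  have "lift_op T (cls (\<lambda>w. rep x w + c * rep y w)) = cls (T (rep x)) + c *\<^sub>C cls (T (rep y))"
    unfolding lift_cls[OF comb_mem[OF r]] by (rule cls_linear[OF r])
  then show ?thesis unfolding cls_comb[OF r] by (simp add: lift_op_def)
qed

lemma lift_diff: "x \<in> S \<Longrightarrow> y \<in> S \<Longrightarrow> lift_op T (x - y) = lift_op T x - lift_op T y"
  using lift_linear[of x y "- 1"] by (simp add: scaleC_minus_one)

lemma lift_scaleC:
  assumes "x \<in> S"
  shows "lift_op T (c *\<^sub>C x) = c *\<^sub>C lift_op T x"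
proof -
  have "lift_op T 0 = 0"
    using lift_diff[OF assms assms] by simp
  then show ?thesis using lift_linear[OF csubspace_0[OF S] assms, of c] by simp
qed

lemma lift_bounded: "\<exists>C\<ge>0. \<forall>x\<in>S. norm (lift_op T x) \<le> C * norm x"
proof -
  obtain C where C: "C \<ge> 0" "\<And>f. f \<in> M \<Longrightarrow> norm (cls (T f)) \<le> C * norm (cls f)"
    using cls_bounded by blast
  have "norm (lift_op T x) \<le> C * norm x" if "x \<in> S" for x
    using C(2)[OF representsD(4)[OF rM that]] by (simp add: lift_op_def)
  then show ?thesis using C(1) by blast
qed

end

locale represented_endo = represented_op M S M S T for M S T
begin

lemma pow_mem: "f \<in> M \<Longrightarrow> (T ^^ n) f \<in> M"
  by (induction n) (auto simp: op_mem)

lemma cls_pow: "f \<in> M \<Longrightarrow> cls ((T ^^ n) f) = (lift_op T ^^ n) (cls f)"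
  by (induction n) (auto simp: pow_mem simp flip: lift_cls)

lemma lift_pow_mem: "x \<in> S \<Longrightarrow> (lift_op T ^^ n) x \<in> S"
  by (induction n) (auto simp: lift_mem)

lemma lift_pow_scaleC: "x \<in> S \<Longrightarrow> (lift_op T ^^ n) (c *\<^sub>C x) = c *\<^sub>C (lift_op T ^^ n) x"
  by (induction n) (auto simp: lift_scaleC lift_pow_mem)

lemma lift_pow_diff: "x \<in> S \<Longrightarrow> y \<in> S \<Longrightarrow> (lift_op T ^^ n) (x - y) = (lift_op T ^^ n) x - (lift_op T ^^ n) y"
  by (induction n) (auto simp: lift_diff lift_pow_mem)

lemma lift_pow_bounded: "\<exists>C\<ge>0. \<forall>x\<in>S. norm ((lift_op T ^^ n) x) \<le> C * norm x"
proof -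
  obtain C where C: "C \<ge> 0" "\<And>x. x \<in> S \<Longrightarrow> norm (lift_op T x) \<le> C * norm x"
    using lift_bounded by blast
  have "norm ((lift_op T ^^ n) x) \<le> C ^ n * norm x" if x: "x \<in> S" for x
  proof (induction n)
    case (Suc n)
    have "norm (lift_op T ((lift_op T ^^ n) x)) \<le> C * norm ((lift_op T ^^ n) x)"
      by (rule C(2)[OF lift_pow_mem[OF x]])
    also have "\<dots> \<le> C * (C ^ n * norm x)" by (intro mult_left_mono Suc C(1))
    finally show ?case by (simp add: mult.assoc)
  qed simp
  then show ?thesis using C(1) by (intro exI[of _ "C ^ n"]) auto
qed

lemma l2_norm_pow: "f \<in> M \<Longrightarrow> l2_norm ((T ^^ n) f) = norm ((lift_op T ^^ n) (cls f))"
  using norm_cls[OF representsD(1)[OF rM pow_mem]] cls_pow by simp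

lemma norm_lift_pow_le_op_norm:
  assumes le: "op_norm M (T ^^ n) \<le> ennreal B" and B: "B \<ge> 0" and x: "x \<in> S"
  shows "norm ((lift_op T ^^ n) x) \<le> B * norm x"
proof (cases "x = 0")
  case True
  then show ?thesis using lift_pow_scaleC[OF x, of n 0] by simp
next
  case False
  define u where "u = complex_of_real (inverse (norm x)) *\<^sub>C x"
  have u: "u \<in> S" unfolding u_def by (rule csubspaceD(3)[OF S x])
  have nu: "norm u = 1" using False by (simp add: u_def norm_inverse)
  have r: "rep u \<in> M" by (rule representsD(4)[OF rM u])
  have "ennreal (l2_norm ((T ^^ n) (rep u))) \<le> op_norm M (T ^^ n)"
    unfolding op_norm_def
  proof (rule SUP_upper)
    show "rep u \<in> {f \<in> M. l2_norm f \<le> 1}" using r nu norm_cls[OF rep_L2, of u] by simp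
  qed
  also note le
  finally have "norm ((lift_op T ^^ n) u) \<le> B" using B by (simp add: l2_norm_pow[OF r])
  moreover have "(lift_op T ^^ n) u = complex_of_real (inverse (norm x)) *\<^sub>C (lift_op T ^^ n) x"
    unfolding u_def by (rule lift_pow_scaleC[OF x])
  ultimately show ?thesis using False by (simp add: norm_inverse norm_divide field_simps)
qed

lemma op_norm_le:
  assumes "\<And>x. x \<in> S \<Longrightarrow> norm ((lift_op T ^^ n) x) \<le> B * norm x" and B: "B \<ge> 0"
  shows "op_norm M (T ^^ n) \<le> ennreal B"
  unfolding op_norm_def
proof (rule SUP_least)
  fix f assume "f \<in> {f \<in> M. l2_norm f \<le> 1}"
  then have f: "f \<in> M" "l2_norm f \<le> 1" by auto
  have "l2_norm ((T ^^ n) f) \<le> B * norm (cls f)"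
    unfolding l2_norm_pow[OF f(1)] by (rule assms(1)[OF representsD(2)[OF rM f(1)]])
  also have "\<dots> \<le> B * 1"
    using f norm_cls[OF representsD(1)[OF rM f(1)]] by (intro mult_left_mono B) simp
  finally show "ennreal (l2_norm ((T ^^ n) f)) \<le> ennreal B" by (simp add: ennreal_leI)
qed

end

context inner_function_0
begin

lemma proj_shift:
  assumes x: "x \<in> model \<theta>"
  shows "proj (model \<theta>) (shift 1 x) = shift 1 x - cinner x (shift (- 1) t) *\<^sub>C t"
proof (rule proj_unique[OF csubspace_model closed_model])
  have "shift 1 x - cinner x (shift (- 1) t) *\<^sub>C t = U x - cinner x (shift (- 1) t) *\<^sub>C one"
    by (simp add: U_def scaleC_diff_right)
  then show "shift 1 x - cinner x (shift (- 1) t) *\<^sub>C t \<in> model \<theta>"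
    using csubspaceD(3,6)[OF csubspace_model] U_mem[OF x] one_mem by metis
  fix h assume "h \<in> model \<theta>"
  then have "cinner h t = 0" using model_memD(2)[of h 0] by simp
  then have "cinner t h = 0" by (rule cnj_cinner_eq_0)
  then show "cinner (shift 1 x - (shift 1 x - cinner x (shift (- 1) t) *\<^sub>C t)) h = 0"
    by (simp add: cinner_scaleC_left)
qed

lemma U1:
  assumes f: "f \<in> Kmod \<theta>"
  shows U1_mem: "U1 \<theta> f \<in> Kmod \<theta>" and cls_U1: "cls (U1 \<theta> f) = U (cls f)"
proof -
  define x where "x = cls f"
  have fL: "f \<in> L2" by (rule Kmod_L2[OF f])
  have x: "x \<in> model \<theta>" using f Kmod_iff[OF fL] by (simp add: x_def)
  have uc: "unimodular (\<lambda>z. cnj z)" and ui: "unimodular (\<lambda>z. z)"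
    using unimodular_cnj[OF unimodular_powi[of 1]] unimodular_powi[of 1] by simp_all
  have wf: "(\<lambda>w. w * f w) \<in> L2" by (rule L2_mult_unimodular[OF ui fL])
  have sh: "cls (\<lambda>w. w * f w) = shift 1 x"
    using mulu_cls[OF unimodular_powi fL, of 1] by (simp add: shift_def x_def)
  have tL: "(\<lambda>w. cnj w * \<theta> w) \<in> L2" by (rule L2_mult_unimodular[OF uc theta_L2])
  have "cls (\<lambda>w. cnj w * \<theta> w) = shift (- 1) t"
    unfolding t_def shift_def mulu_cls[OF unimodular_powi theta_L2]
  proof (rule cls_eqI[OF tL L2_mult_unimodular[OF unimodular_powi theta_L2]])
    show "AE z in m. cnj z * \<theta> z = z powi - 1 * \<theta> z"
      using AE_cmod_eq_1
    proof eventually_elim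
      fix z :: complex assume z: "cmod z = 1"
      have "inverse z = cnj z" using cmod_eq_1_mult_cnj(1)[OF z] by (metis inverse_unique)
      then show "cnj z * \<theta> z = z powi - 1 * \<theta> z" by (simp add: power_int_minus)
    qed
  qed
  then have c: "l2_inner f (\<lambda>w. cnj w * \<theta> w) = cinner x (shift (- 1) t)"
    using cinner_cls[OF fL tL] by (simp add: x_def)
  note P = Proj_represents[OF represents_Kmod csubspace_model closed_model wf]
  have PL: "Proj (Kmod \<theta>) (\<lambda>w. w * f w) \<in> L2" by (rule Kmod_L2[OF P(1)])
  have UL: "U1 \<theta> f \<in> L2"
    unfolding U1_def by (rule L2_add[OF PL L2_const])
  have one: "one = cls (\<lambda>_. 1)" by (simp add: one_def fexp_def)
  have "cls (U1 \<theta> f) = proj (model \<theta>) (shift 1 x) + cinner x (shift (- 1) t) *\<^sub>C one"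
    unfolding U1_def c cls_add[OF PL L2_const, symmetric] P(2) sh one scaleC_cls[OF L2_const] by simp
  then show "cls (U1 \<theta> f) = U (cls f)"
    unfolding proj_shift[OF x] by (simp add: U_def x_def scaleC_diff_right)
  then show "U1 \<theta> f \<in> Kmod \<theta>"
    using Kmod_iff[OF UL] U_mem[OF x] by (simp add: x_def)
qed

lemma isometry_without_eigenvectors_U:
  assumes "\<not> has_eigenvalue (Kmod \<theta>) (U1 \<theta>)"
  shows "isometry_without_eigenvectors (model \<theta>) U"
proof
  fix x c assume x: "x \<in> model \<theta>" and eig: "U x = c *\<^sub>C x"
  define f where "f = rep x"
  have f: "f \<in> Kmod \<theta>" unfolding f_def by (rule representsD(4)[OF represents_Kmod x])
  note fL = Kmod_L2[OF f] and UL = Kmod_L2[OF U1_mem[OF f]]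
  have "cls (U1 \<theta> f) = cls (\<lambda>z. c * f z)"
    by (simp add: cls_U1 f scaleC_cls[OF fL, symmetric] eig) (simp add: f_def eig)
  then have "l2_norm (\<lambda>z. U1 \<theta> f z - c * f z) = 0"
    using cls_eq_iff_l2_norm[OF UL L2_scale[OF fL]] by simp
  then have "l2_norm f = 0" using assms f unfolding has_eigenvalue_def by blast
  then show "x = 0" using norm_cls[OF fL] by (simp add: f_def)
qed (auto intro: csubspace_model closed_model U_mem norm_U simp: U_add U_scaleC)

lemma symmetric_isometry_U:
  assumes "\<not> has_eigenvalue (Kmod \<theta>) (U1 \<theta>)"
  shows "symmetric_isometry (model \<theta>) U V C one"
proof -
  interpret isometry_without_eigenvectors "model \<theta>" U
    by (rule isometry_without_eigenvectors_U[OF assms])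
  have "C one = V one"
    by (simp add: C_one V_def cinner_one_one shift_one)
  then show ?thesis
    by unfold_locales (auto intro: V_mem UV VU one_mem cyclic C_add C_scaleC C_U C_V)
qed

end

theorem theorem6p1:
  fixes \<theta> \<omega> g :: "complex \<Rightarrow> complex"
    and T Tinv :: "(complex \<Rightarrow> complex) \<Rightarrow> (complex \<Rightarrow> complex)"
  assumes inner_\<theta>: "inner_fun \<theta>" and inner_\<omega>: "inner_fun \<omega>"
    and \<theta>0: "val0 \<theta> = 0"
    and no_eig: "\<not> has_eigenvalue (Kmod \<theta>) (U1 \<theta>)"
    and g: "g \<in> L2"
    and welldef: "\<forall>f\<in>Kmod \<theta>. (\<lambda>z. g z * f z) \<in> L2"
    and X_bdd: "bounded_op (Kmod \<theta>) (Kmod \<omega>) (\<lambda>f. Proj (Kmod \<omega>) (\<lambda>z. g z * f z))"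
    and X_dense: "\<forall>h\<in>Kmod \<omega>. \<forall>\<epsilon>>0. \<exists>f\<in>Kmod \<theta>.
                    l2_norm (\<lambda>z. Proj (Kmod \<omega>) (\<lambda>w. g w * f w) z - h z) < \<epsilon>"
    and K_cpt: "compact_oper (Kmod \<theta>) (\<lambda>f. Proj (ocomp (Kmod \<omega>)) (\<lambda>z. g z * f z))"
    and T_bdd: "bounded_op (Kmod \<omega>) (Kmod \<omega>) T"
    and Tinv_bdd: "bounded_op (Kmod \<omega>) (Kmod \<omega>) Tinv"
    and Tinv_left: "\<forall>h\<in>Kmod \<omega>. l2_norm (\<lambda>z. Tinv (T h) z - h z) = 0"
    and Tinv_right: "\<forall>h\<in>Kmod \<omega>. l2_norm (\<lambda>z. T (Tinv h) z - h z) = 0"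
    and intertw: "\<forall>f\<in>Kmod \<theta>.
       l2_norm (\<lambda>z. Proj (Kmod \<omega>) (\<lambda>w. g w * U1 \<theta> f w) z
                   - T (Proj (Kmod \<omega>) (\<lambda>w. g w * f w)) z) = 0"
  shows "(SUP n. op_norm (Kmod \<omega>) (Tinv ^^ n)) \<le> (SUP n. op_norm (Kmod \<omega>) (T ^^ n))\<^sup>2"
proof -
  interpret mt: inner_function_0 \<theta> by unfold_locales (rule inner_\<theta>, rule \<theta>0)
  interpret mo: inner_function \<omega> by unfold_locales (rule inner_\<omega>)
  interpret sym: symmetric_isometry "model \<theta>" mt.U mt.V mt.C mt.one
    by (rule mt.symmetric_isometry_U[OF no_eig])
  note r\<theta> = mt.represents_Kmod and r\<omega> = mo.represents_Kmod
  note S\<omega> = mo.csubspace_model mo.closed_model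
  interpret X: represented_op "Kmod \<theta>" "model \<theta>" "Kmod \<omega>" "model \<omega>" "\<lambda>f. Proj (Kmod \<omega>) (\<lambda>z. g z * f z)"
    by unfold_locales (rule r\<theta> mt.csubspace_model r\<omega> X_bdd)+
  interpret T: represented_endo "Kmod \<omega>" "model \<omega>" T
    by unfold_locales (rule r\<omega> S\<omega> T_bdd)+
  interpret Ti: represented_endo "Kmod \<omega>" "model \<omega>" Tinv
    by unfold_locales (rule r\<omega> S\<omega> Tinv_bdd)+
  define G where "G x = cls (\<lambda>z. g z * rep x z)" for x
  define X where "X x = proj (model \<omega>) (G x)" for x
  define A where "A x = G x - X x" for x
  have gL: "(\<lambda>z. g z * f z) \<in> L2" if "f \<in> Kmod \<theta>" for f using welldef that by blast
  have grL: "(\<lambda>z. g z * rep x z) \<in> L2" if "x \<in> model \<theta>" for x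
    by (rule gL[OF representsD(4)[OF r\<theta> that]])
  have G_cls: "G (cls f) = cls (\<lambda>z. g z * f z)" if f: "f \<in> Kmod \<theta>" for f
    unfolding G_def
  proof (rule cls_eqI)
    show "AE z in m. g z * rep (cls f) z = g z * f z"
      using rep_cls[OF mt.Kmod_L2[OF f]] by eventually_elim simp
  qed (use gL f representsD(4)[OF r\<theta> representsD(2)[OF r\<theta> f]] in auto)
  have G_lin: "G (x + c *\<^sub>C y) = G x + c *\<^sub>C G y" if x: "x \<in> model \<theta>" and y: "y \<in> model \<theta>" for x y c
  proof -
    note rr = representsD(4)[OF r\<theta> x] representsD(4)[OF r\<theta> y]
    have "G (cls (\<lambda>w. rep x w + c * rep y w)) = cls (\<lambda>z. g z * (rep x z + c * rep y z))"
      by (rule G_cls[OF X.comb_mem[OF rr]])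
    also have "(\<lambda>z. g z * (rep x z + c * rep y z)) = (\<lambda>z. g z * rep x z + c * (g z * rep y z))"
      by (simp add: algebra_simps)
    also have "cls \<dots> = G x + c *\<^sub>C G y"
      unfolding G_def by (simp add: scaleC_cls cls_add L2_scale grL x y)
    finally show ?thesis unfolding X.cls_comb[OF rr] by simp
  qed
  have zero: "0 \<in> model \<theta>" by (rule sym.K_closed(1))
  have G_add: "G (x + y) = G x + G y" if "x \<in> model \<theta>" "y \<in> model \<theta>" for x y
    using G_lin[OF that, of 1] by simp
  have G_zero: "G 0 = 0" using G_add[OF zero zero] by simp
  have G_scale: "G (c *\<^sub>C x) = c *\<^sub>C G x" if "x \<in> model \<theta>" for c x
    using G_lin[OF zero that, of c] by (simp add: G_zero)
  have cls_X: "cls (Proj (Kmod \<omega>) (\<lambda>z. g z * f z)) = X (cls f)" if "f \<in> Kmod \<theta>" for f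
    unfolding X_def G_cls[OF that] by (rule cls_Proj[OF r\<omega> S\<omega> gL[OF that]])
  have lift_X: "lift_op (\<lambda>f. Proj (Kmod \<omega>) (\<lambda>z. g z * f z)) x = X x" if "x \<in> model \<theta>" for x
    unfolding lift_op_def using cls_X[OF representsD(4)[OF r\<theta> that]] by simp
  have X_mem: "X x \<in> model \<omega>" for x unfolding X_def by (rule proj_mem[OF S\<omega>])
  have X_lin: "X (x + c *\<^sub>C y) = X x + c *\<^sub>C X y" if "x \<in> model \<theta>" "y \<in> model \<theta>" for x y c
    using X.lift_linear[OF that, of c] that by (simp add: lift_X sym.K_closed)
  have X_diff: "X (x - y) = X x - X y" if "x \<in> model \<theta>" "y \<in> model \<theta>" for x y
    using X_lin[OF that, of "- 1"] by (simp add: scaleC_minus_one)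
  obtain bX where bX: "bX \<ge> 0" "\<And>x. x \<in> model \<theta> \<Longrightarrow> norm (X x) \<le> bX * norm x"
    using X.lift_bounded lift_X by auto
  have split: "(norm (G x))\<^sup>2 = (norm (X x))\<^sup>2 + (norm (A x))\<^sup>2" for x
    using norm_add_Pythagoras[of "A x" "X x"] proj_orthogonal[OF S\<omega> X_mem, of "G x" x]
    by (simp add: A_def flip: X_def)
  have A_lin: "A (x + c *\<^sub>C y) = A x + c *\<^sub>C A y" if "x \<in> model \<theta>" "y \<in> model \<theta>" for x y c
    using that by (simp add: A_def G_lin X_lin scaleC_diff_right)
  have A_add: "A (x + y) = A x + A y" if "x \<in> model \<theta>" "y \<in> model \<theta>" for x y
    using A_lin[OF that, of 1] by simp
  have A_zero: "A 0 = 0" using A_add[OF zero zero] by simp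
  define O\<omega> where "O\<omega> = {x. \<forall>h\<in>model \<omega>. cinner x h = 0}"
  have O\<omega>: "csubspace O\<omega>" "closed O\<omega>"
    unfolding O\<omega>_def by (rule csubspace_orthogonal closed_orthogonal)+
  have rO: "represents (ocomp (Kmod \<omega>)) O\<omega>"
    unfolding O\<omega>_def by (rule represents_ocomp[OF r\<omega>])
  have projO: "proj O\<omega> (G x) = A x" for x
  proof (rule proj_unique[OF O\<omega>])
    show "A x \<in> O\<omega>" using proj_orthogonal[OF S\<omega>, of _ "G x"] by (simp add: O\<omega>_def A_def X_def)
    fix h assume "h \<in> O\<omega>"
    then have "cinner h (X x) = 0" using X_mem by (simp add: O\<omega>_def)
    then show "cinner (G x - A x) h = 0" by (simp add: A_def cnj_cinner_eq_0)
  qed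
  interpret cpt: compact_on "model \<theta>" A
  proof
    fix s :: "nat \<Rightarrow> l2" assume s: "\<And>n. s n \<in> model \<theta> \<and> norm (s n) \<le> 1"
    have rs: "rep (s n) \<in> Kmod \<theta>" for n using representsD(4)[OF r\<theta>] s by blast
    moreover have "l2_norm (rep (s n)) \<le> 1" for n using s[of n] norm_cls[OF rep_L2, of "s n"] by simp
    ultimately obtain r y where ry: "strict_mono (r :: nat \<Rightarrow> nat)" "y \<in> L2"
      "(\<lambda>n. l2_norm (\<lambda>z. Proj (ocomp (Kmod \<omega>)) (\<lambda>z. g z * rep (s (r n)) z) z - y z)) \<longlonglongrightarrow> 0"
      using K_cpt[unfolded compact_oper_def, rule_format, of "\<lambda>n. rep (s n)"] by blast
    have "l2_norm (\<lambda>z. Proj (ocomp (Kmod \<omega>)) (\<lambda>z. g z * rep (s n) z) z - y z) = dist (A (s n)) (cls y)" for n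
    proof -
      note P = Proj_represents[OF rO O\<omega> gL[OF rs[of n]]]
      have "cls (Proj (ocomp (Kmod \<omega>)) (\<lambda>z. g z * rep (s n) z)) = A (s n)"
        unfolding P(2) G_cls[OF rs, symmetric] by (simp add: projO)
      then show ?thesis
        using norm_cls[OF L2_diff[OF representsD(1)[OF rO P(1)] ry(2)]]
          cls_diff[OF representsD(1)[OF rO P(1)] ry(2)]
        by (simp add: dist_norm)
    qed
    then have "(\<lambda>n. A (s (r n))) \<longlonglongrightarrow> cls y" using ry(3) by (simp add: tendsto_dist_iff[of _ "cls y"])
    then show "\<exists>r y. strict_mono (r :: nat \<Rightarrow> nat) \<and> (\<lambda>n. A (s (r n))) \<longlonglongrightarrow> y" using ry(1) by blast
  qed (use A_lin[OF zero] in \<open>auto simp: A_zero A_add scaleR_scaleC mt.csubspace_model\<close>)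
  interpret ca: compact_after_isometry "model \<theta>" mt.U A ..
  obtain bA where bA: "\<And>x. x \<in> model \<theta> \<Longrightarrow> norm (A x) \<le> bA * norm x" using cpt.bounded by blast
  have G_bdd: "norm (G x) \<le> (bX + bA) * norm x" if "x \<in> model \<theta>" for x
    using norm_triangle_ineq[of "X x" "A x"] bX(2)[OF that] bA[OF that]
    by (simp add: A_def distrib_right)
  have GC: "norm (G (mt.C x)) = norm (G x)" if Cx: "mt.C x \<in> model \<theta>" and x: "x \<in> model \<theta>" for x
  proof -
    note [measurable] = L2_measurable[OF grL[OF Cx]] L2_measurable[OF grL[OF x]]
    have "(\<integral>z. (cmod (g z * rep (mt.C x) z))\<^sup>2 \<partial>m) = (\<integral>z. (cmod (g z * rep x z))\<^sup>2 \<partial>m)"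
    proof (rule integral_cong_AE)
      show "AE z in m. (cmod (g z * rep (mt.C x) z))\<^sup>2 = (cmod (g z * rep x z))\<^sup>2"
        using mt.cmod_rep_C[of x] by eventually_elim (simp add: norm_mult)
    qed measurable
    then have "(norm (G (mt.C x)))\<^sup>2 = (norm (G x))\<^sup>2"
      unfolding G_def norm_cls_sq[OF grL[OF Cx]] norm_cls_sq[OF grL[OF x]] .
    then show ?thesis by (rule power2_eq_imp_eq) auto
  qed
  have TX: "lift_op T (X x) = X (mt.U x)" if x: "x \<in> model \<theta>" for x
  proof -
    define f where "f = rep x"
    have f: "f \<in> Kmod \<theta>" unfolding f_def by (rule representsD(4)[OF r\<theta> x])
    note Uf = mt.U1_mem[OF f]
    have P1: "Proj (Kmod \<omega>) (\<lambda>w. g w * f w) \<in> Kmod \<omega>" by (rule Proj_mem[OF r\<omega> S\<omega> gL[OF f]])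
    have P2: "Proj (Kmod \<omega>) (\<lambda>w. g w * U1 \<theta> f w) \<in> Kmod \<omega>" by (rule Proj_mem[OF r\<omega> S\<omega> gL[OF Uf]])
    have "cls (Proj (Kmod \<omega>) (\<lambda>w. g w * U1 \<theta> f w)) = cls (T (Proj (Kmod \<omega>) (\<lambda>w. g w * f w)))"
      using intertw f cls_eq_iff_l2_norm[OF representsD(1)[OF r\<omega> P2] T.op_L2[OF P1]] by blast
    then show ?thesis
      unfolding cls_X[OF Uf] T.lift_cls[OF P1, symmetric] cls_X[OF f] mt.cls_U1[OF f] by (simp add: f_def)
  qed
  have TX_pow: "(lift_op T ^^ n) (X x) = X ((mt.U ^^ n) x)" if "x \<in> model \<theta>" for n x
    by (induction n) (simp_all add: TX sym.pow_mem that)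
  have TiT: "lift_op Tinv (lift_op T y) = y" if y: "y \<in> model \<omega>" for y
  proof -
    have ry: "rep y \<in> Kmod \<omega>" by (rule representsD(4)[OF r\<omega> y])
    have "cls (Tinv (T (rep y))) = cls (rep y)"
      using Tinv_left ry cls_eq_iff_l2_norm[OF Ti.op_L2[OF T.op_mem[OF ry]] rep_L2] by blast
    then show ?thesis using Ti.lift_cls[OF T.op_mem[OF ry]] T.lift_cls[OF ry] by simp
  qed
  have TiX: "(lift_op Tinv ^^ n) (X x) = X ((mt.V ^^ n) x)" if x: "x \<in> model \<theta>" for n x
  proof (induction n)
    case (Suc n)
    define y where "y = (mt.V ^^ n) x"
    have y: "y \<in> model \<theta>" unfolding y_def by (rule sym.powV_mem[OF x])
    have "lift_op Tinv (X y) = lift_op Tinv (lift_op T (X (mt.V y)))"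
      by (simp add: TX mt.V_mem mt.UV y)
    also have "\<dots> = X (mt.V y)" by (rule TiT[OF X_mem])
    finally show ?case using Suc by (simp add: y_def)
  qed simp
  show ?thesis
  proof (cases "SUP n. op_norm (Kmod \<omega>) (T ^^ n)")
    case top
    show ?thesis unfolding top power2_eq_square by (simp add: ennreal_top_mult)
  next
    case (real M)
    have fwd: "norm (X ((mt.U ^^ n) x)) \<le> M * norm (X x)" if "x \<in> model \<theta>" for n x
    proof -
      have "op_norm (Kmod \<omega>) (T ^^ n) \<le> ennreal M"
        unfolding real(2)[symmetric] by (rule SUP_upper) simp
      from T.norm_lift_pow_le_op_norm[OF this real(1) X_mem[of x]] show ?thesis
        by (simp add: TX_pow that)
    qed
    have backward: "norm (X ((mt.V ^^ n) (sym.comb I a))) \<le> M\<^sup>2 * norm (X (sym.comb I a))" if "finite I" for n I a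
      using G_add G_scale G_bdd GC split ca.orbit_average_tendsto_0 fwd real(1) that
      by (rule sym.backward_orbit_bound)
    have main: "norm ((lift_op Tinv ^^ n) y) \<le> M\<^sup>2 * norm y" if y: "y \<in> model \<omega>" for n y
    proof (rule field_le_epsilon)
      fix \<epsilon> :: real assume \<epsilon>: "0 < \<epsilon>"
      obtain c where c: "c \<ge> 0" "\<And>y. y \<in> model \<omega> \<Longrightarrow> norm ((lift_op Tinv ^^ n) y) \<le> c * norm y"
        using Ti.lift_pow_bounded by blast
      define \<delta> where "\<delta> = \<epsilon> / (M\<^sup>2 + c + 1)"
      have pos: "M\<^sup>2 + c + 1 > 0"
        by (intro add_nonneg_pos add_nonneg_nonneg zero_le_power2 c(1) zero_less_one)
      have "\<delta> * (M\<^sup>2 + c + 1) = \<epsilon>" using pos by (simp add: \<delta>_def)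
      moreover have "\<delta> > 0" using \<epsilon> pos by (simp add: \<delta>_def)
      ultimately have \<delta>: "\<delta> > 0" "\<delta> * (M\<^sup>2 + c) \<le> \<epsilon>" by (auto simp: distrib_left)
      have ry: "rep y \<in> Kmod \<omega>" by (rule representsD(4)[OF r\<omega> y])
      obtain f where f: "f \<in> Kmod \<theta>"
        "l2_norm (\<lambda>z. Proj (Kmod \<omega>) (\<lambda>w. g w * f w) z - rep y z) < \<delta> / 2"
        using X_dense ry \<delta>(1) by (meson half_gt_zero)
      define x where "x = cls f"
      have x: "x \<in> model \<theta>" unfolding x_def by (rule representsD(2)[OF r\<theta> f(1)])
      have PL: "Proj (Kmod \<omega>) (\<lambda>w. g w * f w) \<in> L2"
        by (rule representsD(1)[OF r\<omega> Proj_mem[OF r\<omega> S\<omega> gL[OF f(1)]]])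
      have near: "norm (X x - y) < \<delta> / 2"
        using f(2) norm_cls[OF L2_diff[OF PL rep_L2], of y] cls_diff[OF PL rep_L2, of y] cls_X[OF f(1)]
        by (simp add: x_def)
      have "\<delta> / (2 * (bX + 1)) > 0" using \<delta>(1) bX(1) by simp
      then obtain u where u: "u \<in> {sym.comb I a | I a. finite I}" "dist u x < \<delta> / (2 * (bX + 1))"
        using sym.comb_dense[OF x] unfolding closure_approachable by blast
      then obtain I a where Ia: "finite I" "u = sym.comb I a" by blast
      have uK: "u \<in> model \<theta>" unfolding Ia(2) by (rule sym.comb_mem)
      have "norm (X u - X x) \<le> bX * norm (u - x)"
        using bX(2)[of "u - x"] X_diff[OF uK x] sym.K_closed(6)[OF uK x] by simp
      also have "\<dots> \<le> (bX + 1) * norm (u - x)" by (intro mult_right_mono) auto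
      also have "\<dots> < \<delta> / 2"
        using u(2) bX(1) by (simp add: dist_norm field_simps)
      finally have ux: "norm (X u - y) < \<delta>"
        using norm_triangle_ineq[of "X u - X x" "X x - y"] near by simp
      have "norm ((lift_op Tinv ^^ n) y) \<le> norm ((lift_op Tinv ^^ n) (X u)) + norm ((lift_op Tinv ^^ n) (X u - y))"
        using norm_triangle_ineq4[of "(lift_op Tinv ^^ n) (X u)" "(lift_op Tinv ^^ n) (X u - y)"]
        by (simp add: Ti.lift_pow_diff X_mem y)
      also have "\<dots> \<le> M\<^sup>2 * norm (X u) + c * norm (X u - y)"
        using backward[OF Ia(1), of n a] c(2)[OF csubspaceD(6)[OF S\<omega>(1) X_mem y], of u]
        by (simp add: TiX uK flip: Ia(2))
      also have "\<dots> \<le> M\<^sup>2 * (norm y + \<delta>) + c * \<delta>"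
        using ux c(1) norm_triangle_ineq[of y "X u - y"] by (intro add_mono mult_left_mono) auto
      also have "\<dots> \<le> M\<^sup>2 * norm y + \<epsilon>" using \<delta>(2) by (simp add: algebra_simps)
      finally show "norm ((lift_op Tinv ^^ n) y) \<le> M\<^sup>2 * norm y + \<epsilon>" .
    qed
    have "op_norm (Kmod \<omega>) (Tinv ^^ n) \<le> ennreal (M\<^sup>2)" for n
      by (rule Ti.op_norm_le) (simp_all add: main)
    then show ?thesis
      unfolding real(2) using real(1) by (auto intro!: SUP_least simp: ennreal_power)
  qed
qed

end
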